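(* Let $G$ be a three-dimensional, connected Lie group equipped with a (left-invariant) contact form $\theta$ and with the left-invariant sub-Riemannian metric $g_{CC}$ on $\mathcal{H}=\ker\theta$ having left-invariant orthonormal frame $\{X,Y\}$ as described in the context. Suppose that $G$ is non-compact and non-unimodular, and let $\mu_G$ be the Haar measure $d\mu_G=\theta\wedge d\theta$ on $G$. Then for every $\mu_G$-measurable domain $\Omega\subset G$ bounded by a $C^1$-surface $\Sigma=\partial\Omega$, the following isoperimetric inequality holds: $$\mathrm{Vol}_G(\Omega)\le C\cdot \mathrm{Per}_G(\Sigma),$$ where $C=C(G)$ is a positive constant.
   Context: Setting. $G$ is a connected 3-dimensional Lie group with a left-invariant contact 1-form $\theta$, with $\theta\wedge d\theta>0$. The horizontal distribution is $\mathcal{H}=\ker\theta=\mathrm{span}\{X,Y\}$ with $X,Y$ left-invariant. $T$ is the Reeb field: the left-invariant field with $\theta(T)=1$ and $i_T d\theta=0$. The coframe dual to $\{X,Y,T\}$ is $\{\omega_1,\omega_2,\theta\}$. The sub-Riemannian metric $g_{CC}$ is the left-invariant metric on $\mathcal{H}$ making $\{X,Y\}$ orthonormal. One has $[X,Y]=a_3X+b_3Y+cT$ with constants $a_3,b_3\in\mathbb{R}$ and $c<0$, and $\theta\wedge d\theta=(-c)\,\omega_1\wedge\omega_2\wedge\theta$. The constant $C(G)$ depends on $G$ together with this structure ($\theta$, $g_{CC}$), but not on $\Omega$. Unimodularity. $G$ is unimodular if $\mathrm{tr}(\mathrm{ad}_Z)=0$ for every $Z$ in the Lie algebra of $G$;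 otherwise it is non-unimodular. Volume. $\mathrm{Vol}_G(\Omega)=\mu_G(\Omega)$, where $d\mu_G=\theta\wedge d\theta$ is the left-invariant Haar measure. Perimeter. Let $\Sigma$ be a surface given as $\{u=0\}$ with $du\ne0$ on $\Sigma$. Its horizontal gradient is $\nabla_H u=X(u)X+Y(u)Y$; a point of $\Sigma$ is characteristic if $\nabla_H u=0$ there; away from characteristic points the horizontal unit normal is $\nu_H=\nabla_Hu/\|\nabla_Hu\|$, where $\|\nabla_H u\|=\sqrt{X(u)^2+Y(u)^2}$. For $\epsilon>0$ let $g_\epsilon$ be the Riemannian metric on $G$ with orthonormal frame $\{X,Y,\epsilon T\}$, and let $d\Sigma_\epsilon$ be the area element induced on $\Sigma$ by $g_\epsilon$. The perimeter (horizontal area) of a $C^1$-surface $\Sigma=\partial\Omega$ is $$\mathrm{Per}_G(\Sigma)=\int_\Sigma i_{\nu_H}d\mu_G\big|_\Sigma=(-c)\lim_{\epsilon\to0^+}\int_\Sigma \epsilon\,d\Sigma_\epsilon .$$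
   Formalization: The domain Ω is additionally required to have finite volume; without this the inequality fails, e.g. for Ω = G or the complement of a closed ball, which has infinite volume but finite perimeter. *)

theory Defs
  imports "HOL-Analysis.Analysis"
begin

section \<open>Smooth 3-manifolds\<close>

text \<open>The set \<open>S\<close> is open in all uses below.\<close>

primrec Ck_on :: "nat \<Rightarrow> 'a::real_normed_vector set \<Rightarrow> ('a \<Rightarrow> 'b::real_normed_vector) \<Rightarrow> bool" where
  "Ck_on 0 S f \<longleftrightarrow> continuous_on S f"
| "Ck_on (Suc k) S f \<longleftrightarrow> (\<forall>x\<in>S. f differentiable (at x)) \<and>
     (\<forall>v. Ck_on k S (\<lambda>x. frechet_derivative f (at x) v))"

definition smooth_on :: "'a::real_normed_vector set \<Rightarrow> ('a \<Rightarrow> 'b::real_normed_vector) \<Rightarrow> bool" where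
  "smooth_on S f \<longleftrightarrow> (\<forall>k. Ck_on k S f)"

text \<open>A chart is a pair of its domain and its coordinate map; the manifold is the whole type
  \<^typ>\<open>'g\<close>, with Hausdorff and second countable topology given by its type class.\<close>

type_synonym 'g chart = "'g set \<times> ('g \<Rightarrow> real^3)"

definition chart_inv :: "'g chart \<Rightarrow> real^3 \<Rightarrow> 'g" where
  "chart_inv c = inv_into (fst c) (snd c)"

definition smooth_atlas :: "'g::{t2_space,second_countable_topology} chart set \<Rightarrow> bool" where
  "smooth_atlas A \<longleftrightarrow>
     (\<Union>c\<in>A. fst c) = UNIV \<and>
     (\<forall>c\<in>A. open (fst c) \<and> open (snd c ` fst c) \<and>
        homeomorphism (fst c) (snd c ` fst c) (snd c) (chart_inv c)) \<and>
     (\<forall>c\<in>A. \<forall>d\<in>A. smooth_on (snd c ` (fst c \<inter> fst d)) (snd d \<circ> chart_inv c))"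

definition Ck_fun_on ::
  "'g::topological_space chart set \<Rightarrow> nat \<Rightarrow> 'g set \<Rightarrow> ('g \<Rightarrow> real) \<Rightarrow> bool" where
  "Ck_fun_on A k W f \<longleftrightarrow> (\<forall>c\<in>A. Ck_on k (snd c ` (fst c \<inter> W)) (f \<circ> chart_inv c))"

definition smooth_near :: "'g::topological_space chart set \<Rightarrow> ('g \<Rightarrow> real) \<Rightarrow> 'g \<Rightarrow> bool" where
  "smooth_near A f p \<longleftrightarrow> (\<exists>W. open W \<and> p \<in> W \<and> (\<forall>k. Ck_fun_on A k W f))"

definition mdiff :: "'g::topological_space chart set \<Rightarrow> ('g \<Rightarrow> real) \<Rightarrow> 'g \<Rightarrow> bool" where
  "mdiff A f p \<longleftrightarrow> (\<exists>c\<in>A. p \<in> fst c \<and> (f \<circ> chart_inv c) differentiable (at (snd c p)))"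

section \<open>Tangent vectors, vector fields, Lie bracket\<close>

text \<open>A tangent vector at \<open>p\<close> is identified with the directional derivative it induces on the
  functions that are differentiable at \<open>p\<close> (so that it also acts on \<open>C\<^sup>1\<close> functions);
  on all other functions it is set to \<open>0\<close>, so that equal vectors are equal operators.
  \<open>pushvec A \<sigma> x v\<close> is the image \<open>d\<sigma>\<^sub>x(v)\<close> of \<open>v\<close> under the differential at \<open>x\<close> of a map \<open>\<sigma>\<close>
  into the manifold.\<close>

type_synonym 'g tvec = "('g \<Rightarrow> real) \<Rightarrow> real"
type_synonym 'g vfield = "'g \<Rightarrow> 'g tvec"

definition pushvec ::
  "'g::topological_space chart set \<Rightarrow> ('e::real_normed_vector \<Rightarrow> 'g) \<Rightarrow> 'e \<Rightarrow> 'e \<Rightarrow> 'g tvec" where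
  "pushvec A \<sigma> x v = (\<lambda>f. if mdiff A f (\<sigma> x) then frechet_derivative (f \<circ> \<sigma>) (at x) v else 0)"

definition tangent_space :: "'g::topological_space chart set \<Rightarrow> 'g \<Rightarrow> 'g tvec set" where
  "tangent_space A p = {pushvec A (chart_inv c) (snd c p) v | c v. c \<in> A \<and> p \<in> fst c}"

text \<open>Smoothness \<^emph>\<open>near\<close> \<open>p\<close> suffices here because tangent vectors only see germs.\<close>

definition lie_bracket ::
  "'g::topological_space chart set \<Rightarrow> 'g vfield \<Rightarrow> 'g vfield \<Rightarrow> 'g vfield" where
  "lie_bracket A V W p = (THE v. v \<in> tangent_space A p \<and>
     (\<forall>f. smooth_near A f p \<longrightarrow> v f = V p (\<lambda>q. W q f) - W p (\<lambda>q. V q f)))"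

section \<open>Lie groups of dimension 3\<close>

locale lie_group3 = group mul unit iv
  for mul :: "'g::{t2_space,second_countable_topology} \<Rightarrow> 'g \<Rightarrow> 'g" and unit iv +
  fixes A :: "'g chart set"
  assumes atlas: "smooth_atlas A"
    and mult_continuous: "continuous_on UNIV (\<lambda>(p, q). mul p q)"
    and iv_continuous: "continuous_on UNIV iv"
    and mult_smooth: "\<And>c d e. \<lbrakk>c \<in> A; d \<in> A; e \<in> A\<rbrakk> \<Longrightarrow>
      smooth_on {(x, y). x \<in> snd c ` fst c \<and> y \<in> snd d ` fst d \<and>
                         mul (chart_inv c x) (chart_inv d y) \<in> fst e}
        (\<lambda>(x, y). snd e (mul (chart_inv c x) (chart_inv d y)))"
    and iv_smooth: "\<And>c d. \<lbrakk>c \<in> A; d \<in> A\<rbrakk> \<Longrightarrow>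
      smooth_on {x \<in> snd c ` fst c. iv (chart_inv c x) \<in> fst d}
        (\<lambda>x. snd d (iv (chart_inv c x)))"

text \<open>Differential of the left translation by \<open>h\<close>.\<close>

definition dleft :: "('g \<Rightarrow> 'g \<Rightarrow> 'g) \<Rightarrow> 'g \<Rightarrow> 'g tvec \<Rightarrow> 'g tvec" where
  "dleft mul h v = (\<lambda>f. v (\<lambda>q. f (mul h q)))"

text \<open>The Lie algebra. Smoothness of the fields is automatic from left invariance.\<close>

definition lie_algebra ::
  "'g::topological_space chart set \<Rightarrow> ('g \<Rightarrow> 'g \<Rightarrow> 'g) \<Rightarrow> 'g vfield set" where
  "lie_algebra A mul = {Z. (\<forall>p. Z p \<in> tangent_space A p) \<and>
     (\<forall>h p. Z (mul h p) = dleft mul h (Z p))}"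

definition lie_basis ::
  "'g::topological_space chart set \<Rightarrow> ('g \<Rightarrow> 'g \<Rightarrow> 'g) \<Rightarrow> (3 \<Rightarrow> 'g vfield) \<Rightarrow> bool" where
  "lie_basis A mul E \<longleftrightarrow> (\<forall>i. E i \<in> lie_algebra A mul) \<and>
     (\<forall>Z\<in>lie_algebra A mul. \<exists>!a::real^3. Z = (\<lambda>p f. \<Sum>i\<in>UNIV. a $ i * E i p f))"

definition lie_coords :: "(3 \<Rightarrow> 'g vfield) \<Rightarrow> 'g vfield \<Rightarrow> real^3" where
  "lie_coords E Z = (THE a. Z = (\<lambda>p f. \<Sum>i\<in>UNIV. a $ i * E i p f))"

definition ad_matrix ::
  "'g::topological_space chart set \<Rightarrow> (3 \<Rightarrow> 'g vfield) \<Rightarrow> 'g vfield \<Rightarrow> real^3^3" where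
  "ad_matrix A E Z = (\<chi> i j. lie_coords E (lie_bracket A Z (E j)) $ i)"

text \<open>The trace does not depend on the basis.\<close>

definition unimodular :: "'g::topological_space chart set \<Rightarrow> ('g \<Rightarrow> 'g \<Rightarrow> 'g) \<Rightarrow> bool" where
  "unimodular A mul \<longleftrightarrow>
     (\<forall>Z\<in>lie_algebra A mul. \<forall>E. lie_basis A mul E \<longrightarrow> trace (ad_matrix A E Z) = 0)"

section \<open>Left-invariant contact forms\<close>

type_synonym 'g form1 = "'g \<Rightarrow> 'g tvec \<Rightarrow> real"

definition left_inv_form ::
  "'g::topological_space chart set \<Rightarrow> ('g \<Rightarrow> 'g \<Rightarrow> 'g) \<Rightarrow> 'g form1 \<Rightarrow> bool" where
  "left_inv_form A mul \<theta> \<longleftrightarrow>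
     (\<forall>p. \<forall>v\<in>tangent_space A p. \<forall>w\<in>tangent_space A p. \<forall>a b.
        \<theta> p (\<lambda>f. a * v f + b * w f) = a * \<theta> p v + b * \<theta> p w) \<and>
     (\<forall>h p. \<forall>v\<in>tangent_space A p. \<theta> (mul h p) (dleft mul h v) = \<theta> p v)"

text \<open>The exterior derivative at \<open>p\<close> is given by the invariant formula
  \<open>d\<theta>(V,W) = V(\<theta>(W)) - W(\<theta>(V)) - \<theta>([V,W])\<close>. Its value at \<open>p\<close> only depends on \<open>V p\<close>
  and \<open>W p\<close>, so two tangent vectors may be extended by left translation.\<close>

definition ext_deriv_fields ::
  "'g::topological_space chart set \<Rightarrow> 'g form1 \<Rightarrow> 'g vfield \<Rightarrow> 'g vfield \<Rightarrow> 'g \<Rightarrow> real" where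
  "ext_deriv_fields A \<theta> V W p =
     V p (\<lambda>q. \<theta> q (W q)) - W p (\<lambda>q. \<theta> q (V q)) - \<theta> p (lie_bracket A V W p)"

definition left_ext :: "('g \<Rightarrow> 'g \<Rightarrow> 'g) \<Rightarrow> ('g \<Rightarrow> 'g) \<Rightarrow> 'g \<Rightarrow> 'g tvec \<Rightarrow> 'g vfield" where
  "left_ext mul iv p v = (\<lambda>q. dleft mul (mul q (iv p)) v)"

definition ext_deriv ::
  "'g::topological_space chart set \<Rightarrow> ('g \<Rightarrow> 'g \<Rightarrow> 'g) \<Rightarrow> ('g \<Rightarrow> 'g) \<Rightarrow> 'g form1 \<Rightarrow>
   'g \<Rightarrow> 'g tvec \<Rightarrow> 'g tvec \<Rightarrow> real" where
  "ext_deriv A mul iv \<theta> p v w =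
     ext_deriv_fields A \<theta> (left_ext mul iv p v) (left_ext mul iv p w) p"

text \<open>The 3-form \<open>\<theta> \<and> d\<theta>\<close>.\<close>

definition contact_volume ::
  "'g::topological_space chart set \<Rightarrow> ('g \<Rightarrow> 'g \<Rightarrow> 'g) \<Rightarrow> ('g \<Rightarrow> 'g) \<Rightarrow> 'g form1 \<Rightarrow>
   'g \<Rightarrow> 'g tvec \<Rightarrow> 'g tvec \<Rightarrow> 'g tvec \<Rightarrow> real" where
  "contact_volume A mul iv \<theta> p u v w =
     \<theta> p u * ext_deriv A mul iv \<theta> p v w
   + \<theta> p v * ext_deriv A mul iv \<theta> p w u
   + \<theta> p w * ext_deriv A mul iv \<theta> p u v"

definition horizontal ::
  "'g::topological_space chart set \<Rightarrow> 'g form1 \<Rightarrow> 'g \<Rightarrow> 'g tvec set" where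
  "horizontal A \<theta> p = {v \<in> tangent_space A p. \<theta> p v = 0}"

type_synonym 'g hmetric = "'g \<Rightarrow> 'g tvec \<Rightarrow> 'g tvec \<Rightarrow> real"

definition left_inv_subriem_metric ::
  "'g::topological_space chart set \<Rightarrow> ('g \<Rightarrow> 'g \<Rightarrow> 'g) \<Rightarrow> 'g form1 \<Rightarrow> 'g hmetric \<Rightarrow> bool" where
  "left_inv_subriem_metric A mul \<theta> g \<longleftrightarrow>
     (\<forall>p. \<forall>u\<in>horizontal A \<theta> p. \<forall>v\<in>horizontal A \<theta> p. \<forall>w\<in>horizontal A \<theta> p. \<forall>a b.
        g p (\<lambda>f. a * u f + b * v f) w = a * g p u w + b * g p v w) \<and>
     (\<forall>p. \<forall>v\<in>horizontal A \<theta> p. \<forall>w\<in>horizontal A \<theta> p. g p v w = g p w v) \<and>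
     (\<forall>p. \<forall>v\<in>horizontal A \<theta> p. v \<noteq> (\<lambda>f. 0) \<longrightarrow> g p v v > 0) \<and>
     (\<forall>h p. \<forall>v\<in>horizontal A \<theta> p. \<forall>w\<in>horizontal A \<theta> p.
        g (mul h p) (dleft mul h v) (dleft mul h w) = g p v w)"

text \<open>The sign \<open>c < 0\<close> says that \<open>\<theta> \<and> d\<theta>\<close>, whose value on \<open>(X, Y, T)\<close> is \<open>-c\<close>, is positive for
  the orientation given by the frame.\<close>

locale contact_lie_group3 = lie_group3 mul unit iv A
  for mul :: "'g::{t2_space,second_countable_topology} \<Rightarrow> 'g \<Rightarrow> 'g" and unit iv
    and A :: "'g chart set" +
  fixes \<theta> :: "'g form1" and g :: "'g hmetric" and X Y T :: "'g vfield" and a3 b3 c :: real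
  assumes form: "left_inv_form A mul \<theta>"
    and contact: "\<And>p. \<exists>u\<in>tangent_space A p. \<exists>v\<in>tangent_space A p. \<exists>w\<in>tangent_space A p.
                    contact_volume A mul iv \<theta> p u v w \<noteq> 0"
    and fields: "X \<in> lie_algebra A mul" "Y \<in> lie_algebra A mul" "T \<in> lie_algebra A mul"
    and span: "\<And>p. horizontal A \<theta> p = {\<lambda>f. a * X p f + b * Y p f | a b. True}"
    and metric: "left_inv_subriem_metric A mul \<theta> g"
    and orthonormal: "\<And>p. g p (X p) (X p) = 1" "\<And>p. g p (Y p) (Y p) = 1"
                     "\<And>p. g p (X p) (Y p) = 0"
    and reeb: "\<And>p. \<theta> p (T p) = 1"
              "\<And>p v. v \<in> tangent_space A p \<Longrightarrow> ext_deriv A mul iv \<theta> p (T p) v = 0"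
    and bracket: "lie_bracket A X Y = (\<lambda>p f. a3 * X p f + b3 * Y p f + c * T p f)"
    and c_neg: "c < 0"

text \<open>\<open>\<mu>\<close> is the Borel measure with \<open>d\<mu> = \<theta> \<and> d\<theta>\<close>: in each chart it has density
  \<open>|(\<theta> \<and> d\<theta>)(\<partial>\<^sub>1, \<partial>\<^sub>2, \<partial>\<^sub>3)|\<close> with respect to Lebesgue measure.
  This determines \<open>\<mu>\<close> uniquely, since countably many charts cover the group.\<close>

definition contact_haar ::
  "'g::topological_space chart set \<Rightarrow> ('g \<Rightarrow> 'g \<Rightarrow> 'g) \<Rightarrow> ('g \<Rightarrow> 'g) \<Rightarrow> 'g form1 \<Rightarrow>
   'g measure \<Rightarrow> bool" where
  "contact_haar A mul iv \<theta> \<mu> \<longleftrightarrow> sets \<mu> = sets borel \<and>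
     (\<forall>c\<in>A. \<forall>B\<in>sets borel. B \<subseteq> fst c \<longrightarrow>
        emeasure \<mu> B = (\<integral>\<^sup>+ x \<in> snd c ` B.
          ennreal \<bar>contact_volume A mul iv \<theta> (chart_inv c x)
             (pushvec A (chart_inv c) x (axis 1 1))
             (pushvec A (chart_inv c) x (axis 2 1))
             (pushvec A (chart_inv c) x (axis 3 1))\<bar> \<partial>lborel))"

section \<open>Surfaces and horizontal perimeter\<close>

definition defining_function ::
  "'g::topological_space chart set \<Rightarrow> 'g set \<Rightarrow> 'g set \<Rightarrow> ('g \<Rightarrow> real) \<Rightarrow> bool" where
  "defining_function A \<Sigma> W u \<longleftrightarrow> open W \<and> Ck_fun_on A 1 W u \<and>
     \<Sigma> \<inter> W = {q \<in> W. u q = 0} \<and>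
     (\<forall>q\<in>\<Sigma> \<inter> W. \<exists>v\<in>tangent_space A q. v u \<noteq> 0)"

definition C1_surface :: "'g::topological_space chart set \<Rightarrow> 'g set \<Rightarrow> bool" where
  "C1_surface A \<Sigma> \<longleftrightarrow> (\<forall>p\<in>\<Sigma>. \<exists>W u. p \<in> W \<and> defining_function A \<Sigma> W u)"

definition hor_grad :: "'g vfield \<Rightarrow> 'g vfield \<Rightarrow> ('g \<Rightarrow> real) \<Rightarrow> 'g vfield" where
  "hor_grad X Y u p = (\<lambda>f. X p u * X p f + Y p u * Y p f)"

text \<open>Horizontal unit normal; at characteristic points division by zero makes it the zero
  vector, so that these points do not contribute to the perimeter.\<close>

definition hor_normal ::
  "'g hmetric \<Rightarrow> 'g vfield \<Rightarrow> 'g vfield \<Rightarrow> ('g \<Rightarrow> real) \<Rightarrow> 'g vfield" where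
  "hor_normal g X Y u p =
     (\<lambda>f. hor_grad X Y u p f / sqrt (g p (hor_grad X Y u p) (hor_grad X Y u p)))"

definition regular_param ::
  "'g::topological_space chart set \<Rightarrow> (real^2) set \<Rightarrow> (real^2 \<Rightarrow> 'g) \<Rightarrow> bool" where
  "regular_param A D \<sigma> \<longleftrightarrow> open D \<and> inj_on \<sigma> D \<and> continuous_on D \<sigma> \<and>
     (\<forall>c\<in>A. Ck_on 1 (D \<inter> \<sigma> -` fst c) (snd c \<circ> \<sigma>) \<and>
        (\<forall>x \<in> D \<inter> \<sigma> -` fst c. inj (frechet_derivative (snd c \<circ> \<sigma>) (at x))))"

text \<open>A piece of \<open>\<Sigma>\<close> is \<open>\<sigma> ` B\<close>, where \<open>\<sigma>\<close> is a \<open>C\<^sup>1\<close> parametrization of part of \<open>\<Sigma>\<close> on the domain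
  of a defining function \<open>u\<close>, and \<open>B\<close> is a Borel set. On it, the nonnegative 2-form
  \<open>i_\<nu> (\<theta> \<and> d\<theta>)\<close> restricted to \<open>\<Sigma>\<close> (oriented by \<open>u\<close>) is integrated; with the absolute value
  neither the sign of \<open>u\<close> nor the orientation of \<open>\<sigma>\<close> matters.\<close>

type_synonym 'g piece = "('g \<Rightarrow> real) \<times> (real^2 \<Rightarrow> 'g) \<times> (real^2) set"

definition is_piece :: "'g::topological_space chart set \<Rightarrow> 'g set \<Rightarrow> 'g piece \<Rightarrow> bool" where
  "is_piece A \<Sigma> = (\<lambda>(u, \<sigma>, B). \<exists>W D. defining_function A \<Sigma> W u \<and> regular_param A D \<sigma> \<and>
     \<sigma> ` D \<subseteq> \<Sigma> \<inter> W \<and> B \<in> sets borel \<and> B \<subseteq> D)"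

definition piece_set :: "'g piece \<Rightarrow> 'g set" where
  "piece_set = (\<lambda>(u, \<sigma>, B). \<sigma> ` B)"

definition piece_perimeter ::
  "'g::topological_space chart set \<Rightarrow> ('g \<Rightarrow> 'g \<Rightarrow> 'g) \<Rightarrow> ('g \<Rightarrow> 'g) \<Rightarrow> 'g form1 \<Rightarrow>
   'g hmetric \<Rightarrow> 'g vfield \<Rightarrow> 'g vfield \<Rightarrow> 'g piece \<Rightarrow> ennreal" where
  "piece_perimeter A mul iv \<theta> g X Y = (\<lambda>(u, \<sigma>, B).
     \<integral>\<^sup>+ x \<in> B. ennreal \<bar>contact_volume A mul iv \<theta> (\<sigma> x)
        (hor_normal g X Y u (\<sigma> x))
        (pushvec A \<sigma> x (axis 1 1)) (pushvec A \<sigma> x (axis 2 1))\<bar> \<partial>lborel)"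

text \<open>The integrand being nonnegative, the surface integral is the supremum over finite families
  of disjoint pieces (attained in the limit, as \<open>\<Sigma>\<close> is a countable disjoint union of pieces).\<close>

definition perimeter ::
  "'g::topological_space chart set \<Rightarrow> ('g \<Rightarrow> 'g \<Rightarrow> 'g) \<Rightarrow> ('g \<Rightarrow> 'g) \<Rightarrow> 'g form1 \<Rightarrow>
   'g hmetric \<Rightarrow> 'g vfield \<Rightarrow> 'g vfield \<Rightarrow> 'g set \<Rightarrow> ennreal" where
  "perimeter A mul iv \<theta> g X Y \<Sigma> =
     Sup {\<Sum>i<n. piece_perimeter A mul iv \<theta> g X Y (P i) | (n::nat) P.
            (\<forall>i<n. is_piece A \<Sigma> (P i)) \<and>
            disjoint_family_on (\<lambda>i. piece_set (P i)) {..<n}}"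

end

theory Submission
  imports Defs
begin

text \<open>Let \<open>tau\<close> be the trace of \<open>ad\<close> on the Lie algebra. It vanishes on brackets, hence on the Reeb field
  modulo the horizontal fields, so in the non-unimodular case \<open>tau w \<noteq> 0\<close> for \<open>w\<close> one of \<open>X\<close>, \<open>Y\<close>. Up to
  the sign of \<open>w\<close>, right translation by some \<open>\<gamma>(t)\<close>, with \<open>\<gamma>\<close> the one-parameter group of \<open>w\<close>,
  expands volume by a factor \<open>J > 1\<close>. A point of \<open>\<Omega> \<gamma>(t) - \<Omega>\<close> lies on a path
  \<open>s \<mapsto> p \<gamma>(s)\<close>, \<open>0 \<le> s \<le> t\<close>, starting at a boundary point \<open>p\<close>. Because \<open>w\<close> is fixed by \<open>Ad \<gamma>(s)\<close>, the
  region swept by the boundary has volume at most a constant times the flux of \<open>w\<close>, which is at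
  most the perimeter as \<open>w\<close> is a horizontal unit vector. So \<open>(J - 1) \<mu>(\<Omega>)\<close> is bounded by a multiple
  of the perimeter.\<close>

text \<open>The surface may be unbounded and have characteristic points, and \<Omega> has merely
  finite volume. The boundary is therefore crossed by a connectedness argument instead of a
  divergence theorem, and all volume estimates are one-sided bounds by Borel covers, for which the
  sweeping map may overlap itself. Invariance of w under Ad \<gamma>(s) makes the Jacobian of (x, s)
  -> \<sigma>(x) \<gamma>(s) a product of a factor in x, the flux density of w, and a factor J(s).
  Pointwise, this flux is at most that of the horizontal normal; at characteristic points both
  vanish. With m a bound for |J| on [0, t], the constant becomes m t / (J - 1), and finite volume is
  what permits subtracting \<mu>(\<Omega>). The curve \<gamma> is built only for short times, as an
  integral curve; J > 1 at one small t is enough, but Ad-invariance of w must then come from a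
  differential inequality and not from a group law. Tangent spaces are trivialized by left
  translation throughout, so invariant forms, brackets and Ad become algebra on R^3, and second
  derivatives are taken only at the unit.\<close>

section \<open>Calculus of \<open>Ck_on\<close> maps and symmetry of second derivatives\<close>

lemma Ck_on_Suc_imp: "Ck_on (Suc k) S f \<Longrightarrow> Ck_on k S f"
proof (induction k arbitrary: f)
  case 0
  then show ?case
    by (simp add: differentiable_at_imp_differentiable_on differentiable_imp_continuous_on)
next
  case (Suc k)
  have "Ck_on k S (\<lambda>x. frechet_derivative f (at x) v)" for v
    using Suc.prems by (intro Suc.IH) (metis Ck_on.simps(2))
  with Suc.prems show ?case by auto
qed

lemma Ck_on_mono: "Ck_on k S f \<Longrightarrow> j \<le> k \<Longrightarrow> Ck_on j S f"
  by (induction k) (auto simp del: Ck_on.simps simp: le_Suc_eq dest: Ck_on_Suc_imp)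

lemma Ck_on_imp_continuous: "Ck_on k S f \<Longrightarrow> continuous_on S f"
  using Ck_on_mono[of k S f 0] by simp

lemma Ck_on_imp_differentiable: "Ck_on k S f \<Longrightarrow> k > 0 \<Longrightarrow> x \<in> S \<Longrightarrow> f differentiable (at x)"
  by (cases k) auto

lemma Ck_on_subset: "Ck_on k S f \<Longrightarrow> S' \<subseteq> S \<Longrightarrow> Ck_on k S' f"
  by (induction k arbitrary: f) (auto intro: continuous_on_subset)

text \<open>Holds even where no derivative exists: \<open>frechet_derivative\<close> is a choice
  from the set of derivatives, and both functions have the same set.\<close>

lemma frechet_derivative_cong_open:
  assumes "open S" "x \<in> S" "\<And>y. y \<in> S \<Longrightarrow> f y = g y"
  shows "frechet_derivative f (at x) = frechet_derivative g (at x)"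
proof -
  have "(f has_derivative D) (at x) \<longleftrightarrow> (g has_derivative D) (at x)" for D
    using assms has_derivative_transform_within_open[of f D x UNIV S g]
      has_derivative_transform_within_open[of g D x UNIV S f] by auto
  then show ?thesis by (simp add: frechet_derivative_def)
qed

lemma Ck_on_cong:
  assumes "open S" "\<And>x. x \<in> S \<Longrightarrow> f x = g x"
  shows "Ck_on k S f \<longleftrightarrow> Ck_on k S g"
  using assms(2)
proof (induction k arbitrary: f g)
  case 0
  then show ?case by (simp cong: continuous_on_cong)
next
  case (Suc k)
  have "f differentiable (at x) \<longleftrightarrow> g differentiable (at x)" if "x \<in> S" for x
    using that Suc.prems assms(1) has_derivative_transform_within_open[of f _ x UNIV S g]
      has_derivative_transform_within_open[of g _ x UNIV S f] unfolding differentiable_def by metis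
  moreover have "Ck_on k S (\<lambda>x. frechet_derivative f (at x) v) \<longleftrightarrow>
      Ck_on k S (\<lambda>x. frechet_derivative g (at x) v)" for v
    by (intro Suc.IH) (simp add: frechet_derivative_cong_open[OF assms(1) _ Suc.prems])
  ultimately show ?case by simp
qed

lemma Ck_on_const [simp]: "Ck_on k S (\<lambda>x. c)"
  by (induction k arbitrary: c) auto

lemma Ck_on_linear:
  assumes "bounded_linear L"
  shows "Ck_on k S L"
proof (cases k)
  case 0
  then show ?thesis using assms by (simp add: linear_continuous_on)
next
  case (Suc j)
  have "(L has_derivative L) (at x)" for x
    using assms by (rule bounded_linear_imp_has_derivative)
  then have "frechet_derivative L (at x) = L" for x by (metis frechet_derivative_at)
  then show ?thesis using Suc assms
    by (simp add: bounded_linear_imp_differentiable)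
qed

lemma Ck_on_linear_compose:
  assumes L: "bounded_linear L" and S: "open S" and "Ck_on k S f"
  shows "Ck_on k S (\<lambda>x. L (f x))"
  using assms(3)
proof (induction k arbitrary: f)
  case 0
  then show ?case using L by (simp add: bounded_linear.continuous_on)
next
  case (Suc k)
  have D: "((\<lambda>x. L (f x)) has_derivative (\<lambda>v. L (frechet_derivative f (at x) v))) (at x)"
    if "x \<in> S" for x
    using Suc.prems that
    by (intro bounded_linear.has_derivative[OF L]) (simp add: frechet_derivative_works[symmetric])
  then have "Ck_on k S (\<lambda>x. frechet_derivative (\<lambda>x. L (f x)) (at x) v) \<longleftrightarrow>
     Ck_on k S (\<lambda>x. L (frechet_derivative f (at x) v))" for v
    by (intro Ck_on_cong[OF S] fun_cong[OF frechet_derivative_at[symmetric]])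
  moreover have "\<forall>x\<in>S. (\<lambda>x. L (f x)) differentiable (at x)"
    using D differentiableI by blast
  ultimately show ?case using Suc by simp
qed

lemma Ck_on_add:
  assumes S: "open S" and "Ck_on k S f" "Ck_on k S g"
  shows "Ck_on k S (\<lambda>x. f x + g x)"
  using assms(2,3)
proof (induction k arbitrary: f g)
  case 0
  then show ?case by (simp add: continuous_on_add)
next
  case (Suc k)
  have D: "((\<lambda>x. f x + g x) has_derivative
     (\<lambda>v. frechet_derivative f (at x) v + frechet_derivative g (at x) v)) (at x)"
    if "x \<in> S" for x
    using Suc.prems that by (intro has_derivative_add) (simp_all add: frechet_derivative_works[symmetric])
  then have "Ck_on k S (\<lambda>x. frechet_derivative (\<lambda>x. f x + g x) (at x) v) \<longleftrightarrow>
     Ck_on k S (\<lambda>x. frechet_derivative f (at x) v + frechet_derivative g (at x) v)" for v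
    by (intro Ck_on_cong[OF S] fun_cong[OF frechet_derivative_at[symmetric]])
  moreover have "\<forall>x\<in>S. (\<lambda>x. f x + g x) differentiable (at x)"
    using D differentiableI by blast
  ultimately show ?case using Suc by simp
qed

lemma Ck_on_sum:
  assumes "open S" "\<And>i. i \<in> I \<Longrightarrow> Ck_on k S (f i)"
  shows "Ck_on k S (\<lambda>x. \<Sum>i\<in>I. f i x)"
  using assms by (induction I rule: infinite_finite_induct) (auto intro!: Ck_on_add)

lemma Ck_on_bilinear:
  assumes bi: "bounded_bilinear b" and S: "open S" and "Ck_on k S f" "Ck_on k S g"
  shows "Ck_on k S (\<lambda>x. b (f x) (g x))"
  using assms(3,4)
proof (induction k arbitrary: f g)
  case 0
  then show ?case using bi by (simp add: bounded_bilinear.continuous_on)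
next
  case (Suc k)
  have D: "((\<lambda>x. b (f x) (g x)) has_derivative
     (\<lambda>v. b (f x) (frechet_derivative g (at x) v) + b (frechet_derivative f (at x) v) (g x))) (at x)"
    if "x \<in> S" for x
    using Suc.prems that
    by (intro bounded_bilinear.FDERIV[OF bi]) (simp_all add: frechet_derivative_works[symmetric])
  then have "Ck_on k S (\<lambda>x. frechet_derivative (\<lambda>x. b (f x) (g x)) (at x) v) \<longleftrightarrow>
     Ck_on k S (\<lambda>x. b (f x) (frechet_derivative g (at x) v) + b (frechet_derivative f (at x) v) (g x))" for v
    by (intro Ck_on_cong[OF S] fun_cong[OF frechet_derivative_at[symmetric]])
  moreover have "Ck_on k S f" "Ck_on k S g" using Suc.prems by (blast intro: Ck_on_Suc_imp)+
  moreover have "\<forall>x\<in>S. (\<lambda>x. b (f x) (g x)) differentiable (at x)"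
    using D differentiableI by blast
  ultimately show ?case using Suc by (simp add: Ck_on_add[OF S])
qed

text \<open>\<open>Ck_on\<close> controls derivatives in fixed directions only, whereas the chain
  rule evaluates the derivative of \<open>f\<close> in a moving direction. Expanding that direction
  over \<open>Basis\<close> gives a sum of products whose factors are covered by the induction
  hypothesis and by the regularity of \<open>g\<close>.\<close>

lemma Ck_on_compose:
  fixes f :: "'b::euclidean_space \<Rightarrow> 'c::real_normed_vector"
  assumes S: "open S" and T: "open T" and gS: "g ` S \<subseteq> T"
    and "Ck_on k T f" "Ck_on k S g"
  shows "Ck_on k S (\<lambda>x. f (g x))"
  using assms(4,5)
proof (induction k arbitrary: f)
  case 0
  then show ?case using gS by (simp add: continuous_on_compose2)
next
  case (Suc k)
  have Df: "(f has_derivative frechet_derivative f (at (g x))) (at (g x))" if "x \<in> S" for x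
    using Suc.prems(1) that gS by (auto simp: frechet_derivative_works)
  have Dg: "(g has_derivative frechet_derivative g (at x)) (at x)" if "x \<in> S" for x
    using Suc.prems(2) that by (auto simp: frechet_derivative_works)
  have D: "((\<lambda>x. f (g x)) has_derivative
     (\<lambda>v. frechet_derivative f (at (g x)) (frechet_derivative g (at x) v))) (at x)"
    if "x \<in> S" for x
    using diff_chain_at[OF Dg[OF that] Df[OF that]] by (simp add: o_def)
  have eq: "frechet_derivative (\<lambda>x. f (g x)) (at x) v =
     (\<Sum>i\<in>Basis. (frechet_derivative g (at x) v \<bullet> i) *\<^sub>R frechet_derivative f (at (g x)) i)"
    if "x \<in> S" for x v
  proof -
    interpret linear "frechet_derivative f (at (g x))"
      using Df[OF that] has_derivative_linear by blast
    have "frechet_derivative (\<lambda>x. f (g x)) (at x) v =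
       frechet_derivative f (at (g x)) (\<Sum>i\<in>Basis. (frechet_derivative g (at x) v \<bullet> i) *\<^sub>R i)"
      using frechet_derivative_at[OF D[OF that], symmetric] by (simp add: euclidean_representation)
    then show ?thesis by (simp add: sum scale)
  qed
  have g: "Ck_on k S g" using Suc.prems(2) by (rule Ck_on_Suc_imp)
  have "Ck_on k S (\<lambda>x. (frechet_derivative g (at x) v \<bullet> i) *\<^sub>R frechet_derivative f (at (g x)) i)" for v i
    using Suc.prems g
    by (intro Ck_on_bilinear[OF bounded_bilinear_scaleR S] Suc.IH
        Ck_on_linear_compose[OF bounded_linear_inner_left S]) auto
  then have "Ck_on k S (\<lambda>x. \<Sum>i\<in>Basis. (frechet_derivative g (at x) v \<bullet> i) *\<^sub>R frechet_derivative f (at (g x)) i)" for v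
    by (intro Ck_on_sum[OF S])
  moreover have "Ck_on k S (\<lambda>x. frechet_derivative (\<lambda>x. f (g x)) (at x) v) \<longleftrightarrow>
     Ck_on k S (\<lambda>x. \<Sum>i\<in>Basis. (frechet_derivative g (at x) v \<bullet> i) *\<^sub>R frechet_derivative f (at (g x)) i)" for v
    by (rule Ck_on_cong[OF S]) (rule eq)
  moreover have "\<forall>x\<in>S. (\<lambda>x. f (g x)) differentiable (at x)"
    using D differentiableI by blast
  ultimately show ?case by (simp add: \<open>\<And>v. Ck_on k S (\<lambda>x. \<Sum>i\<in>Basis. (frechet_derivative g (at x) v \<bullet> i) *\<^sub>R frechet_derivative f (at (g x)) i)\<close>)
qed

lemma Ck_on_Pair:
  assumes S: "open S" and "Ck_on k S f" "Ck_on k S g"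
  shows "Ck_on k S (\<lambda>x. (f x, g x))"
proof -
  have "Ck_on k S (\<lambda>x. (f x, 0) + (0, g x))"
    using assms
    by (intro Ck_on_add Ck_on_linear_compose[of "\<lambda>y. (y, 0)"] Ck_on_linear_compose[of "\<lambda>y. (0, y)"])
      (auto intro!: bounded_linear_Pair bounded_linear_ident bounded_linear_zero)
  then show ?thesis by simp
qed

lemma Ck_on_1_iff:
  "Ck_on 1 S f \<longleftrightarrow> (\<forall>x\<in>S. f differentiable (at x)) \<and>
     (\<forall>v. continuous_on S (\<lambda>x. frechet_derivative f (at x) v))"
  unfolding One_nat_def by simp

lemma Ck_on_1_I:
  assumes "\<And>x. x \<in> S \<Longrightarrow> (f has_derivative f' x) (at x)"
    and "\<And>v. continuous_on S (\<lambda>x. f' x v)"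
  shows "Ck_on 1 S f"
proof -
  have "frechet_derivative f (at x) = f' x" if "x \<in> S" for x
    using assms(1)[OF that] by (metis frechet_derivative_at)
  then have "continuous_on S (\<lambda>x. frechet_derivative f (at x) v) \<longleftrightarrow> continuous_on S (\<lambda>x. f' x v)" for v
    by (intro continuous_on_cong) auto
  then show ?thesis using assms unfolding Ck_on_1_iff using differentiableI by blast
qed

lemma Ck_on_has_derivative:
  "Ck_on k S f \<Longrightarrow> k > 0 \<Longrightarrow> x \<in> S \<Longrightarrow> (f has_derivative frechet_derivative f (at x)) (at x)"
  using Ck_on_imp_differentiable frechet_derivative_works by blast

lemma has_real_derivative_along:
  fixes f :: "'a::real_normed_vector \<Rightarrow> real"
  assumes f: "(f has_derivative D) (at y)" and g: "(g has_vector_derivative v) (at s)" "g s = y"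
  shows "((\<lambda>s. f (g s)) has_real_derivative D v) (at s)"
proof -
  interpret linear D using f has_derivative_linear by blast
  have "((\<lambda>s. f (g s)) has_derivative (\<lambda>x. D (x *\<^sub>R v))) (at s)"
    using has_derivative_compose[of g "\<lambda>x. x *\<^sub>R v" s UNIV f D] f g
    by (simp add: has_vector_derivative_def)
  moreover have "(\<lambda>x. D (x *\<^sub>R v)) = (*) (D v)" by (auto simp: scale mult.commute)
  ultimately show ?thesis by (simp add: has_field_derivative_def)
qed

text \<open>Symmetry of second derivatives: by two applications of the mean value theorem, the mixed
  difference quotient tends to either mixed derivative.\<close>

lemma mixed_difference:
  fixes f :: "'a::real_normed_vector \<Rightarrow> real" and h :: real
  assumes h: "h > 0"
    and f: "\<And>s t. 0 \<le> s \<Longrightarrow> s \<le> h \<Longrightarrow> 0 \<le> t \<Longrightarrow> t \<le> h \<Longrightarrow>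
          (f has_derivative f' (z + s *\<^sub>R v + t *\<^sub>R w)) (at (z + s *\<^sub>R v + t *\<^sub>R w))"
    and f': "\<And>s t. 0 \<le> s \<Longrightarrow> s \<le> h \<Longrightarrow> 0 \<le> t \<Longrightarrow> t \<le> h \<Longrightarrow>
          ((\<lambda>y. f' y v) has_derivative f'' (z + s *\<^sub>R v + t *\<^sub>R w)) (at (z + s *\<^sub>R v + t *\<^sub>R w))"
  shows "\<exists>s t. 0 \<le> s \<and> s \<le> h \<and> 0 \<le> t \<and> t \<le> h \<and>
     f (z + h *\<^sub>R v + h *\<^sub>R w) - f (z + h *\<^sub>R v) - f (z + h *\<^sub>R w) + f z =
       h * h * f'' (z + s *\<^sub>R v + t *\<^sub>R w) w"
proof -
  define G where "G = (\<lambda>s. f (z + s *\<^sub>R v + h *\<^sub>R w) - f (z + s *\<^sub>R v))"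
  have d: "((\<lambda>s. f (z + s *\<^sub>R v + t *\<^sub>R w)) has_real_derivative f' (z + s *\<^sub>R v + t *\<^sub>R w) v) (at s)"
    if "0 \<le> s" "s \<le> h" "0 \<le> t" "t \<le> h" for s t
    by (rule has_real_derivative_along[OF f[OF that], of "\<lambda>s. z + s *\<^sub>R v + t *\<^sub>R w"])
      (auto intro!: derivative_eq_intros)
  have "(G has_real_derivative f' (z + s *\<^sub>R v + h *\<^sub>R w) v - f' (z + s *\<^sub>R v) v) (at s)"
    if "0 \<le> s" "s \<le> h" for s
    unfolding G_def using d[OF that, of h] d[OF that, of 0] h by (auto intro!: derivative_intros)
  from MVT2[OF h this] obtain s where s: "0 < s" "s < h"
    and s_eq: "G h - G 0 = h * (f' (z + s *\<^sub>R v + h *\<^sub>R w) v - f' (z + s *\<^sub>R v) v)" by auto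
  have "((\<lambda>t. f' (z + s *\<^sub>R v + t *\<^sub>R w) v) has_real_derivative f'' (z + s *\<^sub>R v + t *\<^sub>R w) w) (at t)"
    if "0 \<le> t" "t \<le> h" for t
    using s that
    by (intro has_real_derivative_along[OF f'[of s t], of "\<lambda>t. z + s *\<^sub>R v + t *\<^sub>R w"])
      (auto intro!: derivative_eq_intros)
  from MVT2[OF h this] obtain t where t: "0 < t" "t < h"
    and t_eq: "f' (z + s *\<^sub>R v + h *\<^sub>R w) v - f' (z + s *\<^sub>R v) v = h * f'' (z + s *\<^sub>R v + t *\<^sub>R w) w"
    by auto
  show ?thesis using s t s_eq t_eq unfolding G_def by (intro exI[of _ s] exI[of _ t]) auto
qed

lemma mixed_difference_limit:
  fixes f :: "'a::real_normed_vector \<Rightarrow> real"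
  assumes S: "open S" "z \<in> S"
    and f: "\<And>y. y \<in> S \<Longrightarrow> (f has_derivative f' y) (at y)"
    and f': "\<And>y. y \<in> S \<Longrightarrow> ((\<lambda>y. f' y v) has_derivative f'' y) (at y)"
    and cont: "isCont (\<lambda>y. f'' y w) z"
  shows "((\<lambda>h. (f (z + h *\<^sub>R v + h *\<^sub>R w) - f (z + h *\<^sub>R v) - f (z + h *\<^sub>R w) + f z) / (h * h))
     \<longlongrightarrow> f'' z w) (at_right 0)"
proof (rule tendstoI)
  fix e :: real assume e: "e > 0"
  obtain d1 where d1: "d1 > 0" "ball z d1 \<subseteq> S" using S open_contains_ball by blast
  obtain d2 where d2: "d2 > 0" "\<And>y. dist y z < d2 \<Longrightarrow> dist (f'' y w) (f'' z w) < e"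
    using cont e unfolding continuous_at_eps_delta by blast
  \<comment> \<open>Scaled so that all z + s v + t w with s, t in [0, d) stay within both radii; the
    summand 1 keeps the denominator positive when v = w = 0.\<close>
  define d where "d = min d1 d2 / (norm v + norm w + 1)"
  have pos: "norm v + norm w + 1 > 0" using norm_ge_zero[of v] norm_ge_zero[of w] by linarith
  have dpos: "d > 0" using d1 d2 pos by (simp add: d_def)
  have near: "dist (z + s *\<^sub>R v + t *\<^sub>R w) z < min d1 d2"
    if "0 \<le> s" "s < d" "0 \<le> t" "t < d" for s t
  proof -
    have "dist (z + s *\<^sub>R v + t *\<^sub>R w) z = norm (s *\<^sub>R v + t *\<^sub>R w)"
      by (simp add: dist_norm algebra_simps)
    also have "\<dots> \<le> s * norm v + t * norm w"
      using norm_triangle_ineq[of "s *\<^sub>R v" "t *\<^sub>R w"] that by simp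
    also have "\<dots> \<le> d * norm v + d * norm w" using that by (intro add_mono mult_right_mono) auto
    also have "\<dots> < d * (norm v + norm w + 1)" using dpos by (simp add: algebra_simps)
    also have "\<dots> = min d1 d2" using pos by (simp add: d_def)
    finally show ?thesis .
  qed
  have "dist ((f (z + h *\<^sub>R v + h *\<^sub>R w) - f (z + h *\<^sub>R v) - f (z + h *\<^sub>R w) + f z) / (h * h)) (f'' z w) < e"
    if h: "0 < h" "h < d" for h
  proof -
    have inS: "z + s *\<^sub>R v + t *\<^sub>R w \<in> S" if "0 \<le> s" "s \<le> h" "0 \<le> t" "t \<le> h" for s t
      using near[of s t] that h d1(2) by (auto simp: subset_iff dist_commute)
    have "\<exists>s t. 0 \<le> s \<and> s \<le> h \<and> 0 \<le> t \<and> t \<le> h \<and> f (z + h *\<^sub>R v + h *\<^sub>R w) -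
        f (z + h *\<^sub>R v) - f (z + h *\<^sub>R w) + f z = h * h * f'' (z + s *\<^sub>R v + t *\<^sub>R w) w"
      by (rule mixed_difference[OF h(1)]) (auto intro!: f f' inS)
    then obtain s t where st: "0 \<le> s" "s \<le> h" "0 \<le> t" "t \<le> h" and eq: "f (z + h *\<^sub>R v + h *\<^sub>R w) -
        f (z + h *\<^sub>R v) - f (z + h *\<^sub>R w) + f z = h * h * f'' (z + s *\<^sub>R v + t *\<^sub>R w) w"
      by blast
    show ?thesis unfolding eq using h d2(2) near[of s t] st by auto
  qed
  then show "\<forall>\<^sub>F h in at_right 0. dist ((f (z + h *\<^sub>R v + h *\<^sub>R w) - f (z + h *\<^sub>R v) - f (z + h *\<^sub>R w) + f z) / (h * h)) (f'' z w) < e"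
    using dpos unfolding eventually_at_right_field by blast
qed

lemma symmetric_second_derivative_real:
  fixes f :: "'a::real_normed_vector \<Rightarrow> real"
  assumes S: "open S" "z \<in> S" and f: "Ck_on 2 S f"
  shows "frechet_derivative (\<lambda>y. frechet_derivative f (at y) v) (at z) w =
         frechet_derivative (\<lambda>y. frechet_derivative f (at y) w) (at z) v"
proof -
  have f1: "Ck_on 1 S f" by (rule Ck_on_mono[OF f]) simp
  have f2: "Ck_on 1 S (\<lambda>y. frechet_derivative f (at y) u)" for u
    using f by (simp add: numeral_2_eq_2)
  have c: "isCont (\<lambda>y. frechet_derivative (\<lambda>y. frechet_derivative f (at y) u) (at y) u') z" for u u'
    using f2[of u] S by (simp add: Ck_on_1_iff continuous_on_eq_continuous_at[OF S(1)])
  note lim = mixed_difference_limit[OF S, of f "\<lambda>y. frechet_derivative f (at y)"]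
  let ?q = "\<lambda>v w h. (f (z + h *\<^sub>R v + h *\<^sub>R w) - f (z + h *\<^sub>R v) - f (z + h *\<^sub>R w) + f z) / (h * h)"
  have l: "(?q v w \<longlongrightarrow> frechet_derivative (\<lambda>y. frechet_derivative f (at y) v) (at z) w) (at_right 0)" for v w
    by (rule lim[OF Ck_on_has_derivative[OF f1] Ck_on_has_derivative[OF f2] c]) auto
  have e: "z + h *\<^sub>R w + h *\<^sub>R v = z + h *\<^sub>R v + h *\<^sub>R w" for h
    by (simp add: add.assoc add.commute[of "h *\<^sub>R w"])
  \<comment> \<open>The quotient is symmetric in v and w, so its limit is both mixed derivatives at
    once.\<close>
  have "?q w v = ?q v w"
  proof
    fix h
    have "f (z + h *\<^sub>R w + h *\<^sub>R v) - f (z + h *\<^sub>R w) - f (z + h *\<^sub>R v) + f z =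
      f (z + h *\<^sub>R v + h *\<^sub>R w) - f (z + h *\<^sub>R v) - f (z + h *\<^sub>R w) + f z"
      unfolding e by linarith
    then show "?q w v h = ?q v w h" by (rule arg_cong)
  qed
  then have "(?q v w \<longlongrightarrow> frechet_derivative (\<lambda>y. frechet_derivative f (at y) w) (at z) v) (at_right 0)"
    using l[of w v] by (simp only:)
  then show ?thesis by (rule tendsto_unique[OF trivial_limit_at_right_real l])
qed

lemma symmetric_second_derivative:
  fixes f :: "'a::real_normed_vector \<Rightarrow> 'b::euclidean_space"
  assumes S: "open S" "z \<in> S" and f: "Ck_on 2 S f"
  shows "frechet_derivative (\<lambda>y. frechet_derivative f (at y) v) (at z) w =
         frechet_derivative (\<lambda>y. frechet_derivative f (at y) w) (at z) v"
proof (rule euclidean_eqI)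
  fix i :: 'b
  have comp: "frechet_derivative (\<lambda>y. g y \<bullet> i) (at y) u = frechet_derivative g (at y) u \<bullet> i"
    if "g differentiable (at y)" for g :: "'a \<Rightarrow> 'b" and y u
  proof -
    have "((\<lambda>y. g y \<bullet> i) has_derivative (\<lambda>u. frechet_derivative g (at y) u \<bullet> i)) (at y)"
      using that by (intro bounded_linear.has_derivative[OF bounded_linear_inner_left])
        (simp add: frechet_derivative_works[symmetric])
    then show ?thesis using frechet_derivative_at by metis
  qed
  have fi: "Ck_on 2 S (\<lambda>x. f x \<bullet> i)" by (intro Ck_on_linear_compose[OF bounded_linear_inner_left S(1) f])
  have d1: "f differentiable (at y)" if "y \<in> S" for y using f that by (simp add: numeral_2_eq_2)
  have d2: "(\<lambda>y. frechet_derivative f (at y) u) differentiable (at z)" for u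
    using f S by (simp add: numeral_2_eq_2)
  have 1: "frechet_derivative (\<lambda>y. frechet_derivative (\<lambda>x. f x \<bullet> i) (at y) u) (at z) =
     frechet_derivative (\<lambda>y. frechet_derivative f (at y) u \<bullet> i) (at z)" for u
    by (rule frechet_derivative_cong_open[OF S]) (simp add: comp d1)
  show "frechet_derivative (\<lambda>y. frechet_derivative f (at y) v) (at z) w \<bullet> i =
         frechet_derivative (\<lambda>y. frechet_derivative f (at y) w) (at z) v \<bullet> i"
    using symmetric_second_derivative_real[OF S fi, of v w] unfolding 1 comp[OF d2] .
qed

section \<open>Group operations and translations read in charts\<close>

lemma (in group) cancel_left [simp]:
  "f (inverse a) (f a b) = b" "f a (f (inverse a) b) = b"
  by (simp_all add: assoc[symmetric])

context lie_group3
begin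

lemma mul_assoc: "mul (mul a b) d = mul a (mul b d)" by (rule assoc)
lemma mul_iv [simp]: "mul a (iv a) = unit" by (rule right_inverse)
lemma iv_mul: "iv (mul a b) = mul (iv b) (iv a)" by (rule inverse_distrib_swap)
lemma cancel_right [simp]: "mul (mul b (iv a)) a = b" "mul (mul b a) (iv a) = b"
  by (simp_all add: mul_assoc)

lemma tendsto_mul:
  assumes "(F \<longlongrightarrow> p) net" "(H \<longlongrightarrow> q) net"
  shows "((\<lambda>x. mul (F x) (H x)) \<longlongrightarrow> mul p q) net"
proof -
  have "isCont (\<lambda>(p, q). mul p q) (p, q)"
    using mult_continuous by (simp add: continuous_on_eq_continuous_at)
  from isCont_tendsto_compose[OF this tendsto_Pair[OF assms]] show ?thesis by simp
qed

lemma tendsto_iv: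
  assumes "(F \<longlongrightarrow> p) net"
  shows "((\<lambda>x. iv (F x)) \<longlongrightarrow> iv p) net"
proof -
  have "isCont iv p" using iv_continuous by (simp add: continuous_on_eq_continuous_at)
  from isCont_tendsto_compose[OF this assms] show ?thesis .
qed

lemma continuous_on_mul:
  assumes "continuous_on S F" "continuous_on S H"
  shows "continuous_on S (\<lambda>x. mul (F x) (H x))"
  using assms by (simp add: continuous_on_def tendsto_mul)

lemma continuous_on_iv: "continuous_on S F \<Longrightarrow> continuous_on S (\<lambda>x. iv (F x))"
  by (simp add: continuous_on_def tendsto_iv)

lemma open_chart: "c \<in> A \<Longrightarrow> open (fst c)"
  and open_chart_image: "c \<in> A \<Longrightarrow> open (snd c ` fst c)"
  and continuous_on_chart: "c \<in> A \<Longrightarrow> continuous_on (fst c) (snd c)"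
  and continuous_on_chart_inv: "c \<in> A \<Longrightarrow> continuous_on (snd c ` fst c) (chart_inv c)"
  and chart_inv_chart: "c \<in> A \<Longrightarrow> p \<in> fst c \<Longrightarrow> chart_inv c (snd c p) = p"
  using atlas by (auto simp: smooth_atlas_def homeomorphism_def)

lemma chart_chart_inv: "c \<in> A \<Longrightarrow> x \<in> snd c ` fst c \<Longrightarrow> snd c (chart_inv c x) = x"
  and chart_inv_mem: "c \<in> A \<Longrightarrow> x \<in> snd c ` fst c \<Longrightarrow> chart_inv c x \<in> fst c"
  by (auto simp: chart_inv_chart)

lemma chart_at: "\<exists>c\<in>A. p \<in> fst c"
  using atlas by (auto simp: smooth_atlas_def)

lemma isCont_chart_inv: "c \<in> A \<Longrightarrow> p \<in> fst c \<Longrightarrow> isCont (chart_inv c) (snd c p)"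
  using continuous_on_chart_inv open_chart_image continuous_on_eq_continuous_at by blast

lemma open_chart_mul:
  assumes "c \<in> A" "d \<in> A" "e \<in> A"
  shows "open {(x, y). x \<in> snd c ` fst c \<and> y \<in> snd d ` fst d \<and>
                         mul (chart_inv c x) (chart_inv d y) \<in> fst e}"
proof -
  let ?S = "(snd c ` fst c) \<times> (snd d ` fst d)"
  have 1: "open ?S" using assms by (intro open_Times open_chart_image)
  have 2: "continuous_on ?S (\<lambda>z. mul (chart_inv c (fst z)) (chart_inv d (snd z)))"
    using assms by (intro continuous_on_mul continuous_on_compose2[OF continuous_on_chart_inv] continuous_intros) auto
  have "open (?S \<inter> (\<lambda>z. mul (chart_inv c (fst z)) (chart_inv d (snd z))) -` fst e)"
    by (rule continuous_open_preimage[OF 2 1 open_chart[OF assms(3)]])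
  also have "?S \<inter> (\<lambda>z. mul (chart_inv c (fst z)) (chart_inv d (snd z))) -` fst e =
     {(x, y). x \<in> snd c ` fst c \<and> y \<in> snd d ` fst d \<and> mul (chart_inv c x) (chart_inv d y) \<in> fst e}"
    by auto
  finally show ?thesis .
qed

lemma open_ltrans:
  assumes "c \<in> A" "e \<in> A"
  shows "open {x \<in> snd c ` fst c. mul h (chart_inv c x) \<in> fst e}"
proof -
  have "continuous_on (snd c ` fst c) (\<lambda>x. mul h (chart_inv c x))"
    using assms by (intro continuous_on_mul continuous_on_chart_inv continuous_intros)
  from continuous_open_preimage[OF this open_chart_image open_chart, OF assms]
  show ?thesis by (simp add: vimage_def Int_def)
qed

lemma open_rtrans:
  assumes "c \<in> A" "e \<in> A"
  shows "open {x \<in> snd c ` fst c. mul (chart_inv c x) h \<in> fst e}"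
proof -
  have "continuous_on (snd c ` fst c) (\<lambda>x. mul (chart_inv c x) h)"
    using assms by (intro continuous_on_mul continuous_on_chart_inv continuous_intros)
  from continuous_open_preimage[OF this open_chart_image open_chart, OF assms]
  show ?thesis by (simp add: vimage_def Int_def)
qed

text \<open>The first argument of the smooth multiplication is frozen at the coordinates of
  \<open>h\<close> in a chart around \<open>h\<close>.\<close>

lemma smooth_ltrans:
  assumes "c \<in> A" "e \<in> A"
  shows "Ck_on k {x \<in> snd c ` fst c. mul h (chart_inv c x) \<in> fst e}
           (\<lambda>x. snd e (mul h (chart_inv c x)))"
proof -
  obtain d where d: "d \<in> A" "h \<in> fst d" using chart_at by blast
  have m: "Ck_on k {(x, y). x \<in> snd d ` fst d \<and> y \<in> snd c ` fst c \<and>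
                         mul (chart_inv d x) (chart_inv c y) \<in> fst e}
        (\<lambda>(x, y). snd e (mul (chart_inv d x) (chart_inv c y)))"
    using mult_smooth[OF d(1) assms] by (simp add: smooth_on_def)
  have g: "Ck_on k S (\<lambda>x. (snd d h, x))" if "open S" for S
    by (rule Ck_on_Pair[OF that Ck_on_const Ck_on_linear[OF bounded_linear_ident]])
  have "Ck_on k {x \<in> snd c ` fst c. mul h (chart_inv c x) \<in> fst e}
      (\<lambda>x. (\<lambda>(x, y). snd e (mul (chart_inv d x) (chart_inv c y))) (snd d h, x))"
  proof (rule Ck_on_compose[OF open_ltrans[OF assms] open_chart_mul[OF d(1) assms] _ m g[OF open_ltrans[OF assms]]])
    show "(\<lambda>x. (snd d h, x)) ` {x \<in> snd c ` fst c. mul h (chart_inv c x) \<in> fst e}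
      \<subseteq> {(x, y). x \<in> snd d ` fst d \<and> y \<in> snd c ` fst c \<and> mul (chart_inv d x) (chart_inv c y) \<in> fst e}"
      using chart_inv_chart[OF d] d by (intro image_subsetI) simp
  qed
  then show ?thesis using d by (simp add: chart_inv_chart)
qed

lemma smooth_rtrans:
  assumes "c \<in> A" "e \<in> A"
  shows "Ck_on k {x \<in> snd c ` fst c. mul (chart_inv c x) h \<in> fst e}
           (\<lambda>x. snd e (mul (chart_inv c x) h))"
proof -
  obtain d where d: "d \<in> A" "h \<in> fst d" using chart_at by blast
  have m: "Ck_on k {(x, y). x \<in> snd c ` fst c \<and> y \<in> snd d ` fst d \<and>
                         mul (chart_inv c x) (chart_inv d y) \<in> fst e}
        (\<lambda>(x, y). snd e (mul (chart_inv c x) (chart_inv d y)))"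
    using mult_smooth[OF assms(1) d(1) assms(2)] by (simp add: smooth_on_def)
  have g: "Ck_on k S (\<lambda>x. (x, snd d h))" if "open S" for S
    by (rule Ck_on_Pair[OF that Ck_on_linear[OF bounded_linear_ident] Ck_on_const])
  have "Ck_on k {x \<in> snd c ` fst c. mul (chart_inv c x) h \<in> fst e}
      (\<lambda>x. (\<lambda>(x, y). snd e (mul (chart_inv c x) (chart_inv d y))) (x, snd d h))"
  proof (rule Ck_on_compose[OF open_rtrans[OF assms] open_chart_mul[OF assms(1) d(1) assms(2)] _ m g[OF open_rtrans[OF assms]]])
    show "(\<lambda>x. (x, snd d h)) ` {x \<in> snd c ` fst c. mul (chart_inv c x) h \<in> fst e}
      \<subseteq> {(x, y). x \<in> snd c ` fst c \<and> y \<in> snd d ` fst d \<and> mul (chart_inv c x) (chart_inv d y) \<in> fst e}"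
      using chart_inv_chart[OF d] d by (intro image_subsetI) simp
  qed
  then show ?thesis using d by (simp add: chart_inv_chart)
qed

subsection \<open>Differentials trivialized by left translation\<close>

definition e0 :: "'g chart" where "e0 = (SOME c. c \<in> A \<and> unit \<in> fst c)"

abbreviation K :: "'g \<Rightarrow> real^3" where "K \<equiv> snd e0"
abbreviation Ki :: "real^3 \<Rightarrow> 'g" where "Ki \<equiv> chart_inv e0"

definition x0 :: "real^3" where "x0 = K unit"

text \<open>The translate by \<open>p\<close> of the chart at the unit, as a parametrization with
  \<open>p\<close> at \<open>x0\<close>. Its differential at \<open>x0\<close> is the identification
  of R^3 with the tangent space at \<open>p\<close> used everywhere below.\<close>

definition lam :: "'g \<Rightarrow> real^3 \<Rightarrow> 'g" where "lam p y = mul p (Ki y)"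

lemma e0 [simp]: "e0 \<in> A" and unit_e0 [simp]: "unit \<in> fst e0"
proof -
  have "e0 \<in> A \<and> unit \<in> fst e0"
    unfolding e0_def by (rule someI_ex) (use chart_at[of unit] in blast)
  then show "e0 \<in> A" "unit \<in> fst e0" by auto
qed

lemma x0_mem [simp]: "x0 \<in> K ` fst e0" by (simp add: x0_def)
lemma Ki_x0 [simp]: "Ki x0 = unit" by (simp add: x0_def chart_inv_chart)
lemma lam_x0 [simp]: "lam p x0 = p" by (simp add: lam_def)
lemma lam_K_unit [simp]: "lam p (K unit) = p" by (simp flip: x0_def)
lemma mul_lam: "mul h (lam p y) = lam (mul h p) y" by (simp add: lam_def mul_assoc)
lemma lam_K: "mul (iv p) q \<in> fst e0 \<Longrightarrow> lam p (K (mul (iv p) q)) = q"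
  by (simp add: lam_def chart_inv_chart)

lemma isCont_lam: "isCont (lam p) x0"
  unfolding lam_def isCont_def
  using isCont_chart_inv[OF e0 unit_e0] by (intro tendsto_mul tendsto_intros) (simp add: isCont_def x0_def)

text \<open>\<open>F'\<close> is the differential of \<open>F\<close> at \<open>z\<close>, with the tangent space at \<open>F z\<close> identified with
  \<^typ>\<open>real^3\<close> by left translation to the unit.\<close>

definition md :: "('e::real_normed_vector \<Rightarrow> 'g) \<Rightarrow> ('e \<Rightarrow> real^3) \<Rightarrow> 'e \<Rightarrow> bool" where
  "md F F' z \<longleftrightarrow> isCont F z \<and> ((\<lambda>z'. K (mul (iv (F z)) (F z'))) has_derivative F') (at z)"

text \<open>\<open>h\<close> cancels in the quotient of nearby values, so left translations have
  trivialized differential the identity.\<close>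

lemma md_ltrans: "md F F' z \<Longrightarrow> md (\<lambda>z. mul h (F z)) F' z"
  by (auto simp: md_def isCont_def iv_mul mul_assoc intro!: tendsto_mul)

lemma md_bounded_linear: "md F F' z \<Longrightarrow> bounded_linear F'"
  by (auto simp: md_def intro: has_derivative_bounded_linear)

lemma md_unique: "md F F' z \<Longrightarrow> md F F'' z \<Longrightarrow> F' = F''"
  by (auto simp: md_def intro: has_derivative_unique)

lemma md_compose:
  assumes "md F F' (f z)" "(f has_derivative f') (at z)"
  shows "md (\<lambda>z. F (f z)) (\<lambda>a. F' (f' a)) z"
  using assms has_derivative_continuous[OF assms(2)] unfolding md_def
  by (auto intro: continuous_within_compose3 has_derivative_compose)

text \<open>\<open>K\<close> is informative only on \<open>fst e0\<close>; this is what allows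
  undoing \<open>K\<close> near \<open>z\<close> whenever a derivative is transferred.\<close>

lemma eventually_near_unit:
  assumes "isCont F z"
  shows "\<forall>\<^sub>F z' in at z. mul (iv (F z)) (F z') \<in> fst e0"
proof -
  have "((\<lambda>z'. mul (iv (F z)) (F z')) \<longlongrightarrow> unit) (at z)"
    using tendsto_mul[OF tendsto_const assms[unfolded isCont_def], of "iv (F z)"] by simp
  then show ?thesis by (rule topological_tendstoD[OF _ open_chart]) auto
qed

lemma md_lam: "md (lam p) (\<lambda>\<xi>. \<xi>) x0"
  unfolding md_def
proof (intro conjI isCont_lam)
  have "((\<lambda>y. y) has_derivative (\<lambda>\<xi>. \<xi>)) (at x0)" by (rule has_derivative_ident)
  then show "((\<lambda>y. K (mul (iv (lam p x0)) (lam p y))) has_derivative (\<lambda>\<xi>. \<xi>)) (at x0)"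
    by (rule has_derivative_transform_within_open[OF _ open_chart_image[OF e0] x0_mem])
      (simp add: lam_def chart_chart_inv)
qed

text \<open>The differential at the unit of the left translation by \<open>p\<close>, read in the chart \<open>c\<close>.\<close>

definition Pm :: "'g chart \<Rightarrow> 'g \<Rightarrow> real^3 \<Rightarrow> real^3" where
  "Pm c p = frechet_derivative (\<lambda>y. snd c (lam p y)) (at x0)"

definition Pinv :: "'g chart \<Rightarrow> 'g \<Rightarrow> real^3 \<Rightarrow> real^3" where
  "Pinv c p = frechet_derivative (\<lambda>x. K (mul (iv p) (chart_inv c x))) (at (snd c p))"

context
  fixes c p assumes c: "c \<in> A" and p: "p \<in> fst c"
begin

lemma has_derivative_Pm: "((\<lambda>y. snd c (lam p y)) has_derivative Pm c p) (at x0)"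
  unfolding Pm_def lam_def
  by (rule Ck_on_has_derivative[OF smooth_ltrans[OF e0 c, of 1]]) (use p in auto)

lemma has_derivative_Pinv: "((\<lambda>x. K (mul (iv p) (chart_inv c x))) has_derivative Pinv c p) (at (snd c p))"
  unfolding Pinv_def
  by (rule Ck_on_has_derivative[OF smooth_ltrans[OF c e0, of 1]]) (use p c in \<open>auto simp: chart_inv_chart\<close>)

lemma md_chart_inv: "md (chart_inv c) (Pinv c p) (snd c p)"
  unfolding md_def using has_derivative_Pinv c p by (simp add: chart_inv_chart isCont_chart_inv)

text \<open>Near \<open>z\<close>, the map factors as
  \<open>F z' = lam p (K (mul (iv p) (F z')))\<close>, and the chain rule applies. With
  \<open>chart_deriv_imp_md\<close> this makes \<open>md\<close> equivalent to differentiability in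
  charts.\<close>

lemma md_imp_chart_deriv:
  assumes F: "md F F' z" and z: "F z = p"
  shows "((\<lambda>z. snd c (F z)) has_derivative (\<lambda>a. Pm c p (F' a))) (at z)"
proof -
  have F': "((\<lambda>z'. K (mul (iv p) (F z'))) has_derivative F') (at z)" using F z by (simp add: md_def)
  have "((\<lambda>z'. snd c (lam p (K (mul (iv p) (F z'))))) has_derivative (\<lambda>a. Pm c p (F' a))) (at z)"
    by (rule has_derivative_compose[OF F']) (use has_derivative_Pm z in \<open>simp add: x0_def\<close>)
  then show ?thesis
  proof (rule has_derivative_transform_eventually)
    show "\<forall>\<^sub>F x' in at z. snd c (lam p (K (mul (iv p) (F x')))) = snd c (F x')"
      using eventually_near_unit[where F=F and z=z] F z unfolding md_def
      by (auto simp: lam_K elim: eventually_mono)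
  qed (use z in \<open>simp_all add: lam_K\<close>)
qed

text \<open>Apply \<open>md_imp_chart_deriv\<close> to \<open>chart_inv c\<close> itself, which is
  the identity in the chart.\<close>

lemma Pm_Pinv: "Pm c p (Pinv c p \<xi>) = \<xi>"
proof -
  have "((\<lambda>x. snd c (chart_inv c x)) has_derivative (\<lambda>a. Pm c p (Pinv c p a))) (at (snd c p))"
    by (rule md_imp_chart_deriv[OF md_chart_inv chart_inv_chart[OF c p]])
  moreover have "((\<lambda>x. snd c (chart_inv c x)) has_derivative (\<lambda>a. a)) (at (snd c p))"
    by (rule has_derivative_transform_within_open[OF has_derivative_ident open_chart_image[OF c]])
      (use p c in \<open>auto simp: chart_inv_chart\<close>)
  ultimately have "(\<lambda>a. Pm c p (Pinv c p a)) = (\<lambda>a. a)" by (rule has_derivative_unique)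
  then show ?thesis by (rule fun_cong)
qed

lemma linear_Pm: "linear (Pm c p)" and linear_Pinv: "linear (Pinv c p)"
  using has_derivative_Pm has_derivative_Pinv has_derivative_linear by blast+

lemma Pinv_Pm: "Pinv c p (Pm c p \<xi>) = \<xi>"
  using linear_inverse_left[OF linear_Pm linear_Pinv] Pm_Pinv unfolding o_def id_def by metis

lemma chart_deriv_imp_md:
  assumes F: "isCont F z" "F z = p" and D: "((\<lambda>z. snd c (F z)) has_derivative D) (at z)"
  shows "md F (\<lambda>a. Pinv c p (D a)) z"
  unfolding md_def
proof (intro conjI F(1))
  have "((\<lambda>z'. K (mul (iv p) (chart_inv c (snd c (F z'))))) has_derivative (\<lambda>a. Pinv c p (D a))) (at z)"
    by (rule has_derivative_compose[OF D]) (use has_derivative_Pinv F in simp)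
  then show "((\<lambda>z'. K (mul (iv (F z)) (F z'))) has_derivative (\<lambda>a. Pinv c p (D a))) (at z)"
  proof (rule has_derivative_transform_eventually)
    have "\<forall>\<^sub>F x' in at z. F x' \<in> fst c"
      using F c p open_chart unfolding isCont_def by (intro topological_tendstoD) auto
    then show "\<forall>\<^sub>F x' in at z. K (mul (iv p) (chart_inv c (snd c (F x')))) = K (mul (iv (F z)) (F x'))"
      by (rule eventually_mono) (simp add: c chart_inv_chart F)
  qed (use F c p in \<open>simp_all add: chart_inv_chart\<close>)
qed

end

subsection \<open>Tangent vectors\<close>

text \<open>Replaces the unspecified chart in \<open>mdiff\<close> by the parametrization
  \<open>lam p\<close>, which makes differentiability visibly left-invariant.\<close>

lemma mdiff_iff: "mdiff A f p \<longleftrightarrow> (\<lambda>y. f (lam p y)) differentiable (at x0)"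
proof
  assume "mdiff A f p"
  then obtain c D where c: "c \<in> A" "p \<in> fst c" and D: "((\<lambda>x. f (chart_inv c x)) has_derivative D) (at (snd c p))"
    by (auto simp: mdiff_def differentiable_def o_def)
  have "((\<lambda>y. f (chart_inv c (snd c (lam p y)))) has_derivative (\<lambda>\<xi>. D (Pm c p \<xi>))) (at x0)"
    by (rule has_derivative_compose[OF has_derivative_Pm[OF c]]) (use D in simp)
  then have "((\<lambda>y. f (lam p y)) has_derivative (\<lambda>\<xi>. D (Pm c p \<xi>))) (at x0)"
  proof (rule has_derivative_transform_within_open[OF _ open_ltrans[OF e0 c(1), of p]])
    show "x0 \<in> {x \<in> K ` fst e0. mul p (Ki x) \<in> fst c}" using c by simp
  qed (use c in \<open>auto simp: lam_def chart_inv_chart\<close>)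
  then show "(\<lambda>y. f (lam p y)) differentiable (at x0)" by (rule differentiableI)
next
  assume "(\<lambda>y. f (lam p y)) differentiable (at x0)"
  then obtain D where D: "((\<lambda>y. f (lam p y)) has_derivative D) (at x0)" by (auto simp: differentiable_def)
  obtain c where c: "c \<in> A" "p \<in> fst c" using chart_at by blast
  have "((\<lambda>x. f (lam p (K (mul (iv p) (chart_inv c x))))) has_derivative (\<lambda>\<xi>. D (Pinv c p \<xi>))) (at (snd c p))"
    by (rule has_derivative_compose[OF has_derivative_Pinv[OF c]]) (use D c in \<open>simp add: chart_inv_chart x0_def\<close>)
  then have "((\<lambda>x. f (chart_inv c x)) has_derivative (\<lambda>\<xi>. D (Pinv c p \<xi>))) (at (snd c p))"
  proof (rule has_derivative_transform_within_open[OF _ open_ltrans[OF c(1) e0, of "iv p"]])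
    show "snd c p \<in> {x \<in> snd c ` fst c. mul (iv p) (chart_inv c x) \<in> fst e0}" using c by (simp add: chart_inv_chart)
  qed (use c in \<open>auto simp: lam_def chart_inv_chart\<close>)
  then show "mdiff A f p" unfolding mdiff_def o_def using c differentiableI by blast
qed

definition tv :: "'g \<Rightarrow> real^3 \<Rightarrow> 'g tvec" where
  "tv p \<xi> = pushvec A (lam p) x0 \<xi>"

lemma tv_apply:
  "tv p \<xi> f = (if mdiff A f p then frechet_derivative (\<lambda>y. f (lam p y)) (at x0) \<xi> else 0)"
  by (simp add: tv_def pushvec_def o_def)

text \<open>On differentiable functions this is the chain rule through \<open>lam (F z)\<close>; on
  all others both operators are 0 by convention.\<close>

lemma pushvec_eq_tv:
  assumes F: "md F F' z"
  shows "pushvec A F z a = tv (F z) (F' a)"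
proof
  fix f
  show "pushvec A F z a f = tv (F z) (F' a) f"
  proof (cases "mdiff A f (F z)")
    case True
    let ?p = "F z"
    have D: "((\<lambda>y. f (lam ?p y)) has_derivative frechet_derivative (\<lambda>y. f (lam ?p y)) (at x0)) (at x0)"
      using True by (simp add: mdiff_iff frechet_derivative_works)
    have F': "((\<lambda>z'. K (mul (iv ?p) (F z'))) has_derivative F') (at z)" using F by (simp add: md_def)
    have "((\<lambda>z'. f (lam ?p (K (mul (iv ?p) (F z'))))) has_derivative
        (\<lambda>a. frechet_derivative (\<lambda>y. f (lam ?p y)) (at x0) (F' a))) (at z)"
      by (rule has_derivative_compose[OF F']) (use D in \<open>simp add: x0_def\<close>)
    then have "((\<lambda>z'. f (F z')) has_derivative
        (\<lambda>a. frechet_derivative (\<lambda>y. f (lam ?p y)) (at x0) (F' a))) (at z)"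
    proof (rule has_derivative_transform_eventually)
      show "\<forall>\<^sub>F x' in at z. f (lam ?p (K (mul (iv ?p) (F x')))) = f (F x')"
        using eventually_near_unit[where F=F and z=z] F unfolding md_def by (auto simp: lam_K elim: eventually_mono)
    qed (simp_all add: lam_K)
    then show ?thesis using True by (simp add: pushvec_def tv_apply o_def frechet_derivative_at[symmetric])
  qed (simp add: pushvec_def tv_apply)
qed

lemma tangent_space_eq: "tangent_space A p = range (tv p)"
proof safe
  fix v assume "v \<in> tangent_space A p"
  then obtain c x where c: "c \<in> A" "p \<in> fst c" and v: "v = pushvec A (chart_inv c) (snd c p) x"
    by (auto simp: tangent_space_def)
  show "v \<in> range (tv p)"
    unfolding v pushvec_eq_tv[OF md_chart_inv[OF c]] using c by (simp add: chart_inv_chart)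
next
  fix \<xi>
  obtain c where c: "c \<in> A" "p \<in> fst c" using chart_at by blast
  have "tv p \<xi> = pushvec A (chart_inv c) (snd c p) (Pm c p \<xi>)"
    using pushvec_eq_tv[OF md_chart_inv[OF c]] Pinv_Pm[OF c] c by (simp add: chart_inv_chart)
  then show "tv p \<xi> \<in> tangent_space A p" using c unfolding tangent_space_def by blast
qed

lemma tv_mem [simp]: "tv p \<xi> \<in> tangent_space A p" by (simp add: tangent_space_eq)

lemma tv_lincomb: "tv p (a *\<^sub>R v + b *\<^sub>R w) = (\<lambda>f. a * tv p v f + b * tv p w f)"
proof
  fix f
  have "linear (frechet_derivative (\<lambda>y. f (lam p y)) (at x0))" if "mdiff A f p"
    using that by (intro linear_frechet_derivative) (simp add: mdiff_iff)
  then show "tv p (a *\<^sub>R v + b *\<^sub>R w) f = a * tv p v f + b * tv p w f"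
    by (simp add: tv_apply linear_add linear_scale)
qed

lemma linear_tv: "linear (\<lambda>\<xi>. tv p \<xi> f)"
  by (rule linearI) (use tv_lincomb[of p 1 _ 1] tv_lincomb[of p _ _ 0] in \<open>auto dest!: fun_cong[of _ _ f]\<close>)

lemma tv_sum: "tv p (\<Sum>i\<in>I. a i *\<^sub>R v i) f = (\<Sum>i\<in>I. a i * tv p (v i) f)"
  using linear_sum[OF linear_tv[of p f], of "\<lambda>i. a i *\<^sub>R v i" I]
  by (simp add: linear_scale[OF linear_tv[of p f]])

lemma dleft_tv: "dleft mul h (tv p \<xi>) = tv (mul h p) \<xi>"
proof -
  have "mdiff A (\<lambda>q. f (mul h q)) p \<longleftrightarrow> mdiff A f (mul h p)" for f by (simp add: mdiff_iff mul_lam)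
  then show ?thesis by (auto simp: dleft_def tv_apply mul_lam)
qed

lemma smooth_near_coord:
  assumes c: "c \<in> A" "p \<in> fst c"
  shows "smooth_near A (\<lambda>q. snd c q $ i) p"
  unfolding smooth_near_def
proof (intro exI conjI allI)
  show "Ck_fun_on A k (fst c) (\<lambda>q. snd c q $ i)" for k
    unfolding Ck_fun_on_def o_def
  proof
    fix d assume d: "d \<in> A"
    have o: "open (snd d ` (fst d \<inter> fst c))"
    proof -
      have "snd d ` (fst d \<inter> fst c) = {x \<in> snd d ` fst d. mul unit (chart_inv d x) \<in> fst c}"
        using d by (auto simp: chart_inv_chart)
      then show ?thesis using open_ltrans[OF d c(1), of unit] by simp
    qed
    have "Ck_on k (snd d ` (fst d \<inter> fst c)) (\<lambda>x. snd c (chart_inv d x))"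
      using atlas c d by (simp add: smooth_atlas_def smooth_on_def o_def)
    then show "Ck_on k (snd d ` (fst d \<inter> fst c)) (\<lambda>x. snd c (chart_inv d x) $ i)"
      by (rule Ck_on_linear_compose[OF bounded_linear_vec_nth o])
  qed
qed (use c open_chart in auto)

lemma tv_coord:
  assumes c: "c \<in> A" "p \<in> fst c"
  shows "tv p \<xi> (\<lambda>q. snd c q $ i) = Pm c p \<xi> $ i"
proof -
  have "((\<lambda>y. snd c (lam p y) $ i) has_derivative (\<lambda>\<xi>. Pm c p \<xi> $ i)) (at x0)"
    by (rule bounded_linear.has_derivative[OF bounded_linear_vec_nth has_derivative_Pm[OF c]])
  then show ?thesis by (simp add: tv_apply mdiff_iff frechet_derivative_at[symmetric] differentiableI)
qed

text \<open>The coordinates of one chart are smooth near \<open>p\<close> and already determine the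
  vector through \<open>Pm\<close>. Needed because \<open>lie_bracket\<close> tests vectors on
  smooth germs only.\<close>

lemma tv_separated:
  assumes "\<And>f. smooth_near A f p \<Longrightarrow> tv p v f = tv p w f"
  shows "v = w"
proof -
  obtain c where c: "c \<in> A" "p \<in> fst c" using chart_at by blast
  have "Pm c p v = Pm c p w"
    using assms[OF smooth_near_coord[OF c]] by (simp add: tv_coord[OF c] vec_eq_iff)
  then show ?thesis using Pinv_Pm[OF c] by metis
qed

lemma tv_inject [simp]: "tv p v = tv p w \<longleftrightarrow> v = w"
  using tv_separated[of p v w] by auto

lemma lie_algebra_eq: "lie_algebra A mul = range (\<lambda>v p. tv p v)"
proof safe
  fix Z assume Z: "Z \<in> lie_algebra A mul"
  then have "Z unit \<in> range (tv unit)" by (simp add: lie_algebra_def tangent_space_eq)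
  then obtain v where v: "Z unit = tv unit v" by blast
  have "Z p = tv p v" for p
  proof -
    have "\<forall>h p. Z (mul h p) = dleft mul h (Z p)" using Z by (simp add: lie_algebra_def)
    then have "Z (mul p unit) = dleft mul p (Z unit)" by blast
    then show ?thesis by (simp add: v dleft_tv)
  qed
  then show "Z \<in> range (\<lambda>v p. tv p v)" by blast
next
  fix v show "(\<lambda>p. tv p v) \<in> lie_algebra A mul" by (simp add: lie_algebra_def dleft_tv)
qed

end

section \<open>Implicit differentiation of linear equations near the identity\<close>

lemma linear_near_identity:
  fixes P :: "'a::topological_space \<Rightarrow> 'b::euclidean_space \<Rightarrow> 'b"
  assumes lin: "\<forall>\<^sub>F x in F. linear (P x)"
    and lim: "\<And>i. i \<in> Basis \<Longrightarrow> ((\<lambda>x. P x i) \<longlongrightarrow> i) F" and e: "e > 0"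
  shows "\<forall>\<^sub>F x in F. \<forall>v. norm (P x v - v) \<le> e * norm v"
proof -
  \<comment> \<open>Each basis vector contributes an error of at most d |v|, and there are
    \<open>DIM('b)\<close> of them.\<close>
  define d where "d = e / DIM('b)"
  have d: "d > 0" using e by (simp add: d_def)
  have "\<forall>\<^sub>F x in F. \<forall>i\<in>Basis. dist (P x i) i < d"
    using lim d by (intro eventually_ball_finite) (auto dest: tendstoD)
  with lin show ?thesis
  proof eventually_elim
    case (elim x)
    show ?case
    proof
      fix v :: 'b
      have "P x v - v = (\<Sum>i\<in>Basis. (v \<bullet> i) *\<^sub>R P x i) - (\<Sum>i\<in>Basis. (v \<bullet> i) *\<^sub>R i)"
        using elim(1) by (subst (1 2) euclidean_representation[symmetric, of v])
          (simp add: linear_sum linear_scale)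
      also have "\<dots> = (\<Sum>i\<in>Basis. (v \<bullet> i) *\<^sub>R (P x i - i))"
        by (simp add: sum_subtractf scaleR_diff_right)
      also have "norm \<dots> \<le> (\<Sum>i\<in>(Basis::'b set). norm v * d)"
      proof (rule sum_norm_le)
        fix i :: 'b assume i: "i \<in> Basis"
        have "norm ((v \<bullet> i) *\<^sub>R (P x i - i)) = \<bar>v \<bullet> i\<bar> * norm (P x i - i)" by simp
        also have "\<dots> \<le> norm v * d"
          using elim(2) i Basis_le_norm[OF i, of v] by (intro mult_mono) (auto simp: dist_norm intro: less_imp_le)
        finally show "norm ((v \<bullet> i) *\<^sub>R (P x i - i)) \<le> norm v * d" .
      qed
      also have "\<dots> = e * norm v" by (simp add: d_def)
      finally show "norm (P x v - v) \<le> e * norm v" .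
    qed
  qed
qed

text \<open>Differentiates the solution of P n = R without inverting P or differentiating it: P
  tends to the identity and n = O(|x - x0|), so n - R = (1 - P) n is of smaller order.\<close>

lemma has_derivative_solve:
  fixes P :: "'a::real_normed_vector \<Rightarrow> 'b::euclidean_space \<Rightarrow> 'b"
  assumes lin: "\<forall>\<^sub>F x in at x0. linear (P x)"
    and lim: "\<And>i. i \<in> Basis \<Longrightarrow> ((\<lambda>x. P x i) \<longlongrightarrow> i) (at x0)"
    and R: "(R has_derivative R') (at x0)" "R x0 = 0"
    and n: "\<forall>\<^sub>F x in at x0. P x (n x) = R x" "n x0 = 0"
  shows "(n has_derivative R') (at x0)"
  unfolding has_derivative_at_within
proof (intro conjI)
  have bl: "bounded_linear R'" using R has_derivative_bounded_linear by blast
  then show "bounded_linear R'" .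
  obtain B where B: "B > 0" "\<And>v. norm (R' v) \<le> norm v * B" using bounded_linear.pos_bounded[OF bl] by blast
  have Rlim: "((\<lambda>y. (R y - R' (y - x0)) /\<^sub>R norm (y - x0)) \<longlongrightarrow> 0) (at x0)"
    using R unfolding has_derivative_at_within by simp
  show "((\<lambda>y. (n y - n x0 - R' (y - x0)) /\<^sub>R norm (y - x0)) \<longlongrightarrow> 0) (at x0)"
  proof (rule tendstoI)
    fix e :: real assume e: "e > 0"
    \<comment> \<open>The bound 1/2 absorbs |n| into the left side and yields |n| <= 4 B |y - x0|;
      the bound e / (8 B) then limits |n - R| to e/2 |y - x0|, and R itself contributes another
      e/4.\<close>
    define d where "d = min (min (1/2) (e / 2)) (e / (8 * B))"
    have d: "d > 0" "d \<le> 1/2" "d \<le> e/2" "d * (8 * B) \<le> e"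
      using e B by (auto simp: d_def min_def field_simps)
    have "\<forall>\<^sub>F y in at x0. dist ((R y - R' (y - x0)) /\<^sub>R norm (y - x0)) 0 < min (e/4) B"
      using e B by (intro tendstoD[OF Rlim]) auto
    moreover have "\<forall>\<^sub>F y in at x0. y \<noteq> x0" by (simp add: eventually_at_filter)
    moreover have "\<forall>\<^sub>F y in at x0. \<forall>v. norm (P y v - v) \<le> d * norm v"
      by (rule linear_near_identity[OF lin lim d(1)])
    ultimately show "\<forall>\<^sub>F y in at x0. dist ((n y - n x0 - R' (y - x0)) /\<^sub>R norm (y - x0)) 0 < e"
      using n(1)
    proof eventually_elim
      case (elim y)
      let ?h = "norm (y - x0)"
      have "y \<noteq> x0" by (rule elim(2))
      then have h: "?h > 0" by simp
      have near: "norm (P y v - v) \<le> d * norm v" for v by (rule elim(3)[rule_format])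
      have Pn: "P y (n y) = R y" by (rule elim(4))
      have small: "dist ((R y - R' (y - x0)) /\<^sub>R ?h) 0 < min (e/4) B" by (rule elim(1))
      have r: "norm (R y - R' (y - x0)) < min (e/4) B * ?h"
      proof -
        have "norm (R y - R' (y - x0)) / ?h < min (e/4) B"
          using small unfolding dist_norm diff_0_right norm_scaleR abs_inverse abs_norm_cancel
          by (simp only: mult.commute[of "inverse ?h"] divide_inverse[symmetric])
        then show ?thesis using h by (simp only: pos_divide_less_eq)
      qed
      have "norm (R y) \<le> norm (R y - R' (y - x0)) + norm (R' (y - x0))"
        using norm_triangle_ineq[of "R y - R' (y - x0)" "R' (y - x0)"] by simp
      also have "\<dots> \<le> B * ?h + ?h * B"
      proof (rule add_mono)
        have "min (e/4) B * ?h \<le> B * ?h" using h by (intro mult_right_mono) auto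
        then show "norm (R y - R' (y - x0)) \<le> B * ?h" using r by linarith
      qed (rule B(2))
      finally have Ry: "norm (R y) \<le> 2 * B * ?h" by simp
      have nR: "norm (R y - n y) \<le> d * norm (n y)" using near[of "n y"] by (simp only: Pn)
      have "norm (n y) \<le> norm (R y) + norm (R y - n y)"
        using norm_triangle_ineq4[of "R y" "R y - n y"] by simp
      also have "\<dots> \<le> norm (R y) + 1/2 * norm (n y)"
        using nR mult_right_mono[OF d(2), of "norm (n y)"] by simp
      finally have ny: "norm (n y) \<le> 4 * B * ?h" using Ry by simp
      have "norm (n y - R' (y - x0)) \<le> norm (n y - R y) + norm (R y - R' (y - x0))"
        using norm_triangle_ineq[of "n y - R y" "R y - R' (y - x0)"] by simp
      also have "\<dots> < d * (4 * B * ?h) + e/4 * ?h"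
      proof (rule add_le_less_mono)
        have "d * norm (n y) \<le> d * (4 * B * ?h)" using ny d(1) by (intro mult_left_mono) auto
        then show "norm (n y - R y) \<le> d * (4 * B * ?h)"
          using nR by (simp only: norm_minus_commute[of "n y"])
        have "min (e/4) B * ?h \<le> e/4 * ?h" using h by (intro mult_right_mono) auto
        then show "norm (R y - R' (y - x0)) < e/4 * ?h" using r by linarith
      qed
      also have "\<dots> \<le> e * ?h"
      proof -
        have "d * (8 * B) * ?h \<le> e * ?h" using d(4) h by (intro mult_right_mono) auto
        moreover have "0 < e * ?h" using h e by simp
        ultimately show ?thesis by (simp add: mult.assoc)
      qed
      finally have "norm (n y - R' (y - x0)) / ?h < e" using h by (simp only: pos_divide_less_eq)
      then show ?case
        unfolding dist_norm diff_0_right norm_scaleR abs_inverse abs_norm_cancel n(2)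
        by (simp only: mult.commute[of "inverse ?h"] divide_inverse[symmetric])
    qed
  qed
qed

section \<open>The adjoint representation\<close>

context lie_group3
begin

text \<open>\<open>Ad (h\<^sup>-\<^sup>1)\<close>: the factor by which right translation by \<open>h\<close> changes left-trivialized vectors.\<close>

definition N :: "'g \<Rightarrow> real^3 \<Rightarrow> real^3" where
  "N h = frechet_derivative (\<lambda>y. K (mul (iv h) (mul (Ki y) h))) (at x0)"

lemma md_cong:
  assumes "md F F' z" "\<forall>\<^sub>F z' in at z. F z' = H z'" "F z = H z"
  shows "md H F' z"
  unfolding md_def
proof (intro conjI)
  show "isCont H z" using assms unfolding md_def isCont_def by (metis tendsto_cong)
  have "((\<lambda>z'. K (mul (iv (F z)) (F z'))) has_derivative F') (at z)" using assms(1) by (simp add: md_def)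
  then show "((\<lambda>z'. K (mul (iv (H z)) (H z'))) has_derivative F') (at z)"
    by (rule has_derivative_transform_eventually)
      (use assms(2,3) in \<open>auto elim: eventually_mono\<close>)
qed

lemma isCont_Ki: "isCont Ki x0"
  using isCont_chart_inv[OF e0 unit_e0] by (simp add: x0_def)

lemma md_N: "md (\<lambda>y. mul (Ki y) h) (N h) x0"
proof -
  obtain c where c: "c \<in> A" "h \<in> fst c" using chart_at by blast
  have F: "isCont (\<lambda>y. mul (Ki y) h) x0" "mul (Ki x0) h = h"
    using tendsto_mul[of Ki unit "at x0" "\<lambda>_. h" h] isCont_Ki by (simp_all add: isCont_def)
  have "((\<lambda>y. snd c (mul (Ki y) h)) has_derivative
      frechet_derivative (\<lambda>y. snd c (mul (Ki y) h)) (at x0)) (at x0)"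
    by (rule Ck_on_has_derivative[OF smooth_rtrans[OF e0 c(1), of 1]]) (use c in auto)
  from chart_deriv_imp_md[OF c F this] obtain D where D: "md (\<lambda>y. mul (Ki y) h) D x0" by blast
  then have "N h = D" unfolding N_def md_def by (simp add: frechet_derivative_at[symmetric])
  with D show ?thesis by simp
qed

lemma has_derivative_N: "((\<lambda>y. K (mul (iv h) (mul (Ki y) h))) has_derivative N h) (at x0)"
  using md_N[of h] by (simp add: md_def)

lemma linear_N: "linear (N h)"
  using has_derivative_N has_derivative_linear by blast

text \<open>Write \<open>F z'\<close> as \<open>F z\<close> times a point near the unit; the left
  factor drops out by \<open>md_ltrans\<close>, and the right translation is only differentiated at
  the unit.\<close>

lemma md_rtrans:
  assumes F: "md F F' z"
  shows "md (\<lambda>z. mul (F z) h) (\<lambda>a. N h (F' a)) z"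
proof -
  let ?al = "\<lambda>z'. K (mul (iv (F z)) (F z'))"
  have al: "(?al has_derivative F') (at z)" using F by (simp add: md_def)
  have N: "md (\<lambda>y. mul (Ki y) h) (N h) (?al z)" using md_N by (simp add: x0_def)
  have "md (\<lambda>z'. mul (F z) (mul (Ki (?al z')) h)) (\<lambda>a. N h (F' a)) z"
    by (rule md_ltrans[OF md_compose[OF N al]])
  then show ?thesis
  proof (rule md_cong)
    show "\<forall>\<^sub>F z' in at z. mul (F z) (mul (Ki (?al z')) h) = mul (F z') h"
      using eventually_near_unit[where F=F and z=z] F unfolding md_def
      by (auto simp: chart_inv_chart mul_assoc[symmetric] elim: eventually_mono)
  qed (simp flip: x0_def)
qed

text \<open>The order is reversed because \<open>N h\<close> is Ad of the inverse.\<close>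

lemma N_mul: "N (mul h k) v = N k (N h v)"
proof -
  have "md (\<lambda>y. mul (mul (Ki y) h) k) (\<lambda>a. N k (N h a)) x0" by (rule md_rtrans[OF md_N])
  then have "N (mul h k) = (\<lambda>a. N k (N h a))" using md_N[of "mul h k"] by (simp add: mul_assoc md_unique)
  then show ?thesis by simp
qed

lemma N_unit [simp]: "N unit v = v"
proof -
  have "lam unit = Ki" by (auto simp: lam_def)
  then have "md (\<lambda>y. mul (Ki y) unit) (\<lambda>v. v) x0" using md_lam[of unit] by simp
  then show ?thesis using md_N[of unit] md_unique by (metis (no_types, lifting))
qed

lemma N_iv [simp]: "N (iv h) (N h v) = v" "N h (N (iv h) v) = v"
  by (simp_all flip: N_mul)

subsection \<open>The multiplication in the chart at the unit\<close>

definition M :: "(real^3) \<times> (real^3) \<Rightarrow> real^3" where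
  "M z = K (mul (Ki (fst z)) (Ki (snd z)))"

definition OM :: "((real^3) \<times> (real^3)) set" where
  "OM = {(x, y). x \<in> K ` fst e0 \<and> y \<in> K ` fst e0 \<and> mul (Ki x) (Ki y) \<in> fst e0}"

lemma open_OM: "open OM" unfolding OM_def by (intro open_chart_mul e0)

lemma smooth_M: "Ck_on k OM M"
proof -
  have "(\<lambda>(x, y). K (mul (Ki x) (Ki y))) = M" by (auto simp: M_def)
  then show ?thesis using mult_smooth[OF e0 e0 e0] by (simp add: smooth_on_def OM_def)
qed

lemma OM_mem: "x \<in> K ` fst e0 \<Longrightarrow> (x, x0) \<in> OM" "x \<in> K ` fst e0 \<Longrightarrow> (x0, x) \<in> OM"
  by (auto simp: OM_def chart_inv_chart)

lemma M_x0: "x \<in> K ` fst e0 \<Longrightarrow> M (x, x0) = x" "x \<in> K ` fst e0 \<Longrightarrow> M (x0, x) = x"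
  by (simp_all add: M_def chart_chart_inv)

definition DM :: "(real^3) \<times> (real^3) \<Rightarrow> (real^3) \<times> (real^3) \<Rightarrow> real^3" where
  "DM z = frechet_derivative M (at z)"

lemma has_derivative_M: "z \<in> OM \<Longrightarrow> (M has_derivative DM z) (at z)"
  unfolding DM_def by (rule Ck_on_has_derivative[OF smooth_M[of 1]]) auto

lemma linear_DM: "z \<in> OM \<Longrightarrow> linear (DM z)"
  using has_derivative_M has_derivative_linear by blast

lemma has_derivative_M_left: "(x, y) \<in> OM \<Longrightarrow> ((\<lambda>x. M (x, y)) has_derivative (\<lambda>\<xi>. DM (x, y) (\<xi>, 0))) (at x)"
  by (rule has_derivative_compose[of "\<lambda>x. (x, y)", OF _ has_derivative_M]) (auto intro!: derivative_eq_intros)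

lemma has_derivative_M_right: "(x, y) \<in> OM \<Longrightarrow> ((\<lambda>y. M (x, y)) has_derivative (\<lambda>\<xi>. DM (x, y) (0, \<xi>))) (at y)"
  by (rule has_derivative_compose[of "\<lambda>y. (x, y)", OF _ has_derivative_M]) (auto intro!: derivative_eq_intros)

lemma DM_x0_right: "DM (x0, x0) (0, \<xi>) = \<xi>"
proof -
  have "((\<lambda>y. y) has_derivative (\<lambda>\<xi>. DM (x0, x0) (0, \<xi>))) (at x0)"
    by (rule has_derivative_transform_within_open[OF has_derivative_M_right open_chart_image[OF e0]])
      (auto simp: OM_mem M_x0 chart_chart_inv simp del: image_eqI)
  then have "(\<lambda>\<xi>. DM (x0, x0) (0, \<xi>)) = (\<lambda>\<xi>. \<xi>)" by (rule has_derivative_unique[OF _ has_derivative_ident])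
  then show ?thesis by (rule fun_cong)
qed

lemma DM_x0_left: "DM (x0, x0) (\<xi>, 0) = \<xi>"
proof -
  have "((\<lambda>y. y) has_derivative (\<lambda>\<xi>. DM (x0, x0) (\<xi>, 0))) (at x0)"
    by (rule has_derivative_transform_within_open[OF has_derivative_M_left open_chart_image[OF e0]])
      (auto simp: OM_mem M_x0 chart_chart_inv simp del: image_eqI)
  then have "(\<lambda>\<xi>. DM (x0, x0) (\<xi>, 0)) = (\<lambda>\<xi>. \<xi>)" by (rule has_derivative_unique[OF _ has_derivative_ident])
  then show ?thesis by (rule fun_cong)
qed

lemma DM_x0: "DM (x0, x0) (\<xi>, \<eta>) = \<xi> + \<eta>"
proof -
  have "DM (x0, x0) ((\<xi>, 0) + (0, \<eta>)) = \<xi> + \<eta>"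
    by (simp only: linear_add[OF linear_DM[OF OM_mem(1)[OF x0_mem]]] DM_x0_left DM_x0_right)
  then show ?thesis by simp
qed

text \<open>The quotient of products is H^-1 (F^-1 F') H times H^-1 H'. The first factor is
  conjugated by H, which produces \<open>N (H z)\<close>, and multiplication at the unit
  differentiates to addition (\<open>DM_x0\<close>).\<close>

lemma md_mul:
  assumes F: "md F F' z" and H: "md H H' z"
  shows "md (\<lambda>z. mul (F z) (H z)) (\<lambda>a. N (H z) (F' a) + H' a) z"
  unfolding md_def
proof
  show "isCont (\<lambda>z. mul (F z) (H z)) z"
    using F H by (simp add: md_def isCont_def tendsto_mul)
  have F2: "md (\<lambda>z'. mul (F z') (H z)) (\<lambda>a. N (H z) (F' a)) z" by (rule md_rtrans[OF F])
  let ?al = "\<lambda>z'. K (mul (iv (mul (F z) (H z))) (mul (F z') (H z)))"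
  let ?be = "\<lambda>z'. K (mul (iv (H z)) (H z'))"
  have al: "(?al has_derivative (\<lambda>a. N (H z) (F' a))) (at z)" using F2 by (simp add: md_def)
  have be: "(?be has_derivative H') (at z)" using H by (simp add: md_def)
  have "((\<lambda>z'. M (?al z', ?be z')) has_derivative (\<lambda>a. DM (x0, x0) (N (H z) (F' a), H' a))) (at z)"
    by (rule has_derivative_compose[OF has_derivative_Pair[OF al be]])
      (use has_derivative_M[OF OM_mem(1)[OF x0_mem]] in \<open>simp flip: x0_def\<close>)
  then have "((\<lambda>z'. M (?al z', ?be z')) has_derivative (\<lambda>a. N (H z) (F' a) + H' a)) (at z)"
    by (simp add: DM_x0)
  then show "((\<lambda>z'. K (mul (iv (mul (F z) (H z))) (mul (F z') (H z')))) has_derivative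
      (\<lambda>a. N (H z) (F' a) + H' a)) (at z)"
  proof (rule has_derivative_transform_eventually)
    have "\<forall>\<^sub>F z' in at z. mul (iv (mul (F z) (H z))) (mul (F z') (H z)) \<in> fst e0"
      by (rule eventually_near_unit) (use F2 in \<open>simp add: md_def\<close>)
    moreover have "\<forall>\<^sub>F z' in at z. mul (iv (H z)) (H z') \<in> fst e0"
      by (rule eventually_near_unit) (use H in \<open>simp add: md_def\<close>)
    ultimately show "\<forall>\<^sub>F z' in at z. M (?al z', ?be z') = K (mul (iv (mul (F z) (H z))) (mul (F z') (H z')))"
      by eventually_elim (simp add: M_def chart_inv_chart mul_assoc)
  qed (simp_all add: M_def x0_def[symmetric])
qed

text \<open>In the chart at the unit, \<open>Pd x\<close> and \<open>Qd x\<close> are the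
  differentials at the unit of left and of right translation by \<open>Ki x\<close>.\<close>

definition Pd :: "real^3 \<Rightarrow> real^3 \<Rightarrow> real^3" where "Pd x \<eta> = DM (x, x0) (0, \<eta>)"
definition Qd :: "real^3 \<Rightarrow> real^3 \<Rightarrow> real^3" where "Qd x \<eta> = DM (x0, x) (\<eta>, 0)"

lemma linear_Pd: "x \<in> K ` fst e0 \<Longrightarrow> linear (Pd x)"
  using linear_DM[OF OM_mem(1), of x] unfolding Pd_def
  by (intro linear_compose[of "\<lambda>\<eta>. (0, \<eta>)" "DM (x, x0)", unfolded o_def]) (auto intro!: linearI)

lemma Pd_x0 [simp]: "Pd x0 \<eta> = \<eta>" and Qd_x0 [simp]: "Qd x0 \<eta> = \<eta>"
  by (simp_all add: Pd_def Qd_def DM_x0)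

text \<open>Differentiate y h = h (h^-1 y h): right translation is conjugation followed by left
  translation.\<close>

lemma Pd_N:
  assumes x: "x \<in> K ` fst e0"
  shows "Pd x (N (Ki x) \<eta>) = Qd x \<eta>"
proof -
  let ?h = "Ki x"
  have "((\<lambda>y. M (x, K (mul (iv ?h) (mul (Ki y) ?h)))) has_derivative
      (\<lambda>\<eta>. DM (x, x0) (0, N ?h \<eta>))) (at x0)"
    by (rule has_derivative_compose[OF has_derivative_N])
      (use has_derivative_M_right[OF OM_mem(1)[OF x]] in \<open>simp flip: x0_def\<close>)
  then have "((\<lambda>y. M (y, x)) has_derivative (\<lambda>\<eta>. DM (x, x0) (0, N ?h \<eta>))) (at x0)"
  proof (rule has_derivative_transform_eventually)
    have "\<forall>\<^sub>F y in at x0. mul (iv (mul (Ki x0) ?h)) (mul (Ki y) ?h) \<in> fst e0"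
      by (rule eventually_near_unit) (use md_N in \<open>simp add: md_def\<close>)
    then show "\<forall>\<^sub>F y in at x0. M (x, K (mul (iv ?h) (mul (Ki y) ?h))) = M (y, x)"
      by eventually_elim (simp add: M_def chart_inv_chart)
  qed (use x in \<open>simp_all add: M_def x0_def[symmetric]\<close>)
  from has_derivative_unique[OF this has_derivative_M_left[OF OM_mem(2)[OF x]]]
  show ?thesis by (simp add: Pd_def Qd_def) metis
qed

text \<open>The mixed second derivative of the multiplication at the unit; its antisymmetric part is the
  Lie bracket.\<close>

definition Bm :: "real^3 \<Rightarrow> real^3 \<Rightarrow> real^3" where
  "Bm \<xi> \<eta> = frechet_derivative (\<lambda>z. DM z (0, \<eta>)) (at (x0, x0)) (\<xi>, 0)"

definition brk :: "real^3 \<Rightarrow> real^3 \<Rightarrow> real^3" where "brk v w = Bm v w - Bm w v"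

lemma has_derivative_DM:
  "((\<lambda>z. DM z u) has_derivative frechet_derivative (\<lambda>z. DM z u) (at (x0, x0))) (at (x0, x0))"
proof -
  have "Ck_on 1 OM (\<lambda>z. DM z u)"
    using smooth_M[of "Suc 1"] unfolding Ck_on.simps(2) DM_def by blast
  then show ?thesis by (rule Ck_on_has_derivative) (auto simp: OM_mem)
qed

lemma has_derivative_Pd: "((\<lambda>x. Pd x \<eta>) has_derivative (\<lambda>\<xi>. Bm \<xi> \<eta>)) (at x0)"
  unfolding Pd_def Bm_def
  by (rule has_derivative_compose[of "\<lambda>x. (x, x0)", OF _ has_derivative_DM]) (auto intro!: derivative_eq_intros)

text \<open>\<open>Bm\<close> differentiates in the second factor first, \<open>Qd\<close> in the
  first; the symmetry of second derivatives identifies the two orders.\<close>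

lemma has_derivative_Qd: "((\<lambda>x. Qd x \<eta>) has_derivative (\<lambda>\<xi>. Bm \<eta> \<xi>)) (at x0)"
proof -
  have "Bm \<eta> \<xi> = frechet_derivative (\<lambda>z. DM z (\<eta>, 0)) (at (x0, x0)) (0, \<xi>)" for \<xi>
    unfolding Bm_def DM_def
    by (rule symmetric_second_derivative[OF open_OM OM_mem(1)[OF x0_mem] smooth_M])
  then have e: "Bm \<eta> = (\<lambda>\<xi>. frechet_derivative (\<lambda>z. DM z (\<eta>, 0)) (at (x0, x0)) (0, \<xi>))" by blast
  show ?thesis unfolding Qd_def e
    by (rule has_derivative_compose[of "\<lambda>x. (x0, x)", OF _ has_derivative_DM]) (auto intro!: derivative_eq_intros)
qed

lemma linear_Bm1: "linear (\<lambda>\<xi>. Bm \<xi> \<eta>)" and linear_Bm2: "linear (Bm \<eta>)"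
  using has_derivative_linear[OF has_derivative_Pd] has_derivative_linear[OF has_derivative_Qd] by simp_all

lemma linear_brk1: "linear (\<lambda>\<xi>. brk \<xi> \<eta>)" and linear_brk2: "linear (brk \<eta>)"
  unfolding brk_def using linear_compose_sub[OF linear_Bm1 linear_Bm2] linear_compose_sub[OF linear_Bm2 linear_Bm1]
  by auto

lemma brk_self [simp]: "brk v v = 0" by (simp add: brk_def)

lemma brk_commute: "brk v w = - brk w v" by (simp add: brk_def)

text \<open>Since \<open>N h\<close> is \<open>Ad (h\<^sup>-\<^sup>1)\<close>, its derivative at the unit is \<open>-ad\<close>.\<close>

lemma has_derivative_N_Ki: "((\<lambda>x. N (Ki x) \<eta>) has_derivative (\<lambda>\<xi>. brk \<eta> \<xi>)) (at x0)"
proof -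
  have ev: "\<forall>\<^sub>F x in at x0. x \<in> K ` fst e0"
    using eventually_at_topological open_chart_image[OF e0] x0_mem by blast
  have "((\<lambda>x. N (Ki x) \<eta> - \<eta>) has_derivative (\<lambda>\<xi>. Bm \<eta> \<xi> - Bm \<xi> \<eta>)) (at x0)"
  \<comment> \<open>By \<open>Pd_N\<close>, \<open>N (Ki x) \<eta>\<close> solves a linear equation
    with matrix \<open>Pd x\<close>. Subtracting \<eta> makes the unknown vanish at
    \<open>x0\<close>, as the rule requires.\<close>
  proof (rule has_derivative_solve[of Pd])
    show "\<forall>\<^sub>F x in at x0. linear (Pd x)" using ev by eventually_elim (rule linear_Pd)
    show "((\<lambda>x. Pd x i) \<longlongrightarrow> i) (at x0)" for i
      using has_derivative_continuous[OF has_derivative_Pd[of i]] by (simp add: isCont_def)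
    show "((\<lambda>x. Qd x \<eta> - Pd x \<eta>) has_derivative (\<lambda>\<xi>. Bm \<eta> \<xi> - Bm \<xi> \<eta>)) (at x0)"
      by (intro has_derivative_diff has_derivative_Qd has_derivative_Pd)
    show "\<forall>\<^sub>F x in at x0. Pd x (N (Ki x) \<eta> - \<eta>) = Qd x \<eta> - Pd x \<eta>"
      using ev by eventually_elim (simp add: linear_diff[OF linear_Pd] Pd_N)
  qed simp_all
  from has_derivative_add[OF this has_derivative_const[of \<eta>]] show ?thesis by (simp add: brk_def)
qed

text \<open>\<open>N_mul\<close> moves the base point from \<open>F z\<close> to the unit, where the
  derivative is known.\<close>

lemma has_derivative_N_along:
  assumes F: "md F F' z"
  shows "((\<lambda>z'. N (F z') v) has_derivative (\<lambda>a. brk (N (F z) v) (F' a))) (at z)"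
proof -
  let ?al = "\<lambda>z'. K (mul (iv (F z)) (F z'))"
  have al: "(?al has_derivative F') (at z)" using F by (simp add: md_def)
  have "((\<lambda>z'. N (Ki (?al z')) (N (F z) v)) has_derivative (\<lambda>a. brk (N (F z) v) (F' a))) (at z)"
    by (rule has_derivative_compose[OF al]) (use has_derivative_N_Ki in \<open>simp flip: x0_def\<close>)
  then show ?thesis
  proof (rule has_derivative_transform_eventually)
    show "\<forall>\<^sub>F z' in at z. N (Ki (?al z')) (N (F z) v) = N (F z') v"
      using eventually_near_unit[where F=F and z=z] F unfolding md_def
      by (auto simp: chart_inv_chart N_mul[symmetric] elim: eventually_mono)
  qed (simp_all flip: x0_def)
qed

text \<open>Ad acts by Lie algebra automorphisms: differentiate N(h^-1 y h) N(h) v = N(h) N(y) v at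
  y = unit, once on each side.\<close>

lemma N_brk: "N h (brk v w) = brk (N h v) (N h w)"
proof -
  have md1: "md (\<lambda>y. mul (iv h) (mul (Ki y) h)) (N h) x0" by (rule md_ltrans[OF md_N])
  have 1: "((\<lambda>y. N (mul (iv h) (mul (Ki y) h)) (N h v)) has_derivative (\<lambda>a. brk (N h v) (N h a))) (at x0)"
    using has_derivative_N_along[OF md1] by simp
  have "((\<lambda>y. N h (N (Ki y) v)) has_derivative (\<lambda>a. N h (brk v a))) (at x0)"
    by (rule bounded_linear.has_derivative[OF linear_conv_bounded_linear[THEN iffD1, OF linear_N] has_derivative_N_Ki])
  then have "((\<lambda>y. N (mul (iv h) (mul (Ki y) h)) (N h v)) has_derivative (\<lambda>a. N h (brk v a))) (at x0)"
    by (simp add: N_mul)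
  from has_derivative_unique[OF this 1] show ?thesis by metis
qed

definition tau :: "real^3 \<Rightarrow> real" where "tau v = trace (matrix (brk v))"

lemma linear_tau: "linear tau"
  by (rule linearI)
    (simp_all add: tau_def trace_def matrix_def linear_add[OF linear_brk1] linear_scale[OF linear_brk1]
      sum.distrib sum_distrib_left)

text \<open>\<open>tau\<close>, the trace of \<open>ad\<close>, is invariant under \<open>Ad\<close>; differentiating, it vanishes on brackets.\<close>

lemma tau_N: "tau (N h v) = tau v"
proof -
  let ?N = "matrix (N h)" and ?N' = "matrix (N (iv h))" and ?B = "matrix (brk v)"
  have inv: "?N' ** ?N = mat 1"
  proof -
    have "N (iv h) \<circ> N h = (\<lambda>v. v)" by (rule ext) (simp only: o_def N_iv)
    then have "matrix (N (iv h) \<circ> N h) = mat 1" by (simp only: matrix_id_mat_1[unfolded id_def])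
    then show ?thesis by (simp only: matrix_compose[OF linear_N linear_N])
  qed
  have "brk (N h v) = N h \<circ> (brk v \<circ> N (iv h))"
    by (rule ext) (simp only: o_def N_brk N_iv)
  then have "matrix (brk (N h v)) = ?N ** (?B ** ?N')"
    by (simp only: matrix_compose[OF linear_N linear_brk2]
        matrix_compose[OF linear_compose[OF linear_N linear_brk2] linear_N])
  then have "tau (N h v) = trace ((?B ** ?N') ** ?N)"
    by (simp only: tau_def trace_mul_sym[of ?N])
  also have "\<dots> = trace ?B" by (simp only: matrix_mul_assoc[symmetric] inv matrix_mul_rid)
  finally show ?thesis by (simp only: tau_def)
qed

lemma tau_brk [simp]: "tau (brk v w) = 0"
proof -
  have "((\<lambda>x. tau (N (Ki x) v)) has_derivative (\<lambda>\<xi>. tau (brk v \<xi>))) (at x0)"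
    by (rule bounded_linear.has_derivative[OF linear_conv_bounded_linear[THEN iffD1, OF linear_tau] has_derivative_N_Ki])
  then have "((\<lambda>x. tau v) has_derivative (\<lambda>\<xi>. tau (brk v \<xi>))) (at x0)" by (simp add: tau_N)
  from has_derivative_unique[OF this has_derivative_const] show ?thesis by metis
qed

subsection \<open>The Lie bracket of left-invariant fields\<close>

lemma open_chart_image_Int:
  assumes "c \<in> A" "open W"
  shows "open (snd c ` (fst c \<inter> W))"
proof -
  have "snd c ` (fst c \<inter> W) = snd c ` fst c \<inter> chart_inv c -` W"
    using assms by (auto simp: chart_inv_chart)
  then show ?thesis
    using continuous_open_preimage[OF continuous_on_chart_inv open_chart_image] assms by simp
qed

lemma Ck_lam:
  assumes W: "open W" "p \<in> W" and f: "Ck_fun_on A k W f"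
  obtains S where "open S" "x0 \<in> S" "S \<subseteq> K ` fst e0" "Ck_on k S (\<lambda>y. f (lam p y))"
proof -
  obtain c where c: "c \<in> A" "p \<in> fst c" using chart_at by blast
  define S where "S = {y \<in> K ` fst e0. mul p (Ki y) \<in> fst c} \<inter> {y \<in> K ` fst e0. mul p (Ki y) \<in> W}"
  have "continuous_on (K ` fst e0) (\<lambda>x. mul p (Ki x))"
    by (intro continuous_on_mul continuous_on_chart_inv continuous_intros e0)
  from continuous_open_preimage[OF this open_chart_image W(1)]
  have "open {y \<in> K ` fst e0. mul p (Ki y) \<in> W}" by (simp add: vimage_def Int_def)
  then have oS: "open S" unfolding S_def by (intro open_Int open_ltrans e0 c(1))
  have fc: "Ck_on k (snd c ` (fst c \<inter> W)) (f \<circ> chart_inv c)" using f c by (simp add: Ck_fun_on_def)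
  have g: "Ck_on k S (\<lambda>y. snd c (mul p (Ki y)))"
    by (rule Ck_on_subset[OF smooth_ltrans[OF e0 c(1)]]) (auto simp: S_def)
  have "Ck_on k S (\<lambda>y. (f \<circ> chart_inv c) (snd c (mul p (Ki y))))"
    by (rule Ck_on_compose[OF oS open_chart_image_Int[OF c(1) W(1)] _ fc g]) (auto simp: S_def)
  then have "Ck_on k S (\<lambda>y. f (lam p y))"
    by (subst Ck_on_cong[OF oS, where g="\<lambda>y. (f \<circ> chart_inv c) (snd c (mul p (Ki y)))"])
      (auto simp: S_def lam_def chart_inv_chart[OF c(1)])
  then show ?thesis using that[of S] oS W c by (auto simp: S_def)
qed

text \<open>The last term is a Hessian, symmetric in \<open>v\<close> and \<open>w\<close>; in a
  commutator it cancels and only the antisymmetric part of \<open>Bm\<close> survives.\<close>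

lemma tv_tv:
  assumes f: "smooth_near A f p"
  shows "tv p v (\<lambda>q. tv q w f) = tv p (Bm v w) f +
     frechet_derivative (\<lambda>x. frechet_derivative (\<lambda>y. f (lam p y)) (at x) w) (at x0) v"
proof -
  define \<phi> where "\<phi> = (\<lambda>y. f (lam p y))"
  define D where "D = (\<lambda>x. frechet_derivative \<phi> (at x))"
  obtain W where W: "open W" "p \<in> W" "Ck_fun_on A 2 W f" using f by (auto simp: smooth_near_def)
  obtain S where S: "open S" "x0 \<in> S" "S \<subseteq> K ` fst e0" "Ck_on 2 S \<phi>"
    using Ck_lam[OF W] unfolding \<phi>_def by blast
  have D: "(\<phi> has_derivative D x) (at x)" if "x \<in> S" for x
    unfolding D_def by (rule Ck_on_has_derivative[OF S(4) _ that]) simp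
  have linD: "linear (D x)" if "x \<in> S" for x using D[OF that] has_derivative_linear by blast
  have "Ck_on 1 S (\<lambda>x. D x u)" for u
    using S(4) unfolding D_def numeral_2_eq_2 Ck_on.simps(2) One_nat_def by blast
  then have DD: "((\<lambda>x. D x u) has_derivative frechet_derivative (\<lambda>x. D x u) (at x0)) (at x0)" for u
    by (rule Ck_on_has_derivative) (use S in auto)
  \<comment> \<open>Since \<open>lam (lam p x) y = lam p (M (x, y))\<close>, the field of
    \<open>w\<close> at \<open>lam p x\<close> has the components \<open>Pd x w\<close> in the
    coordinates centred at \<open>p\<close>.\<close>
  have val: "tv (lam p x) w f = D x (Pd x w)" if x: "x \<in> S" for x
  proof -
    have xU: "x \<in> K ` fst e0" using x S by auto
    have "((\<lambda>y. \<phi> (M (x, y))) has_derivative (\<lambda>\<xi>. D x (Pd x \<xi>))) (at x0)"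
      unfolding Pd_def
      by (rule has_derivative_compose[OF has_derivative_M_right[OF OM_mem(1)[OF xU]]])
        (use D[OF x] M_x0[OF xU] in simp)
    then have "((\<lambda>y. f (lam (lam p x) y)) has_derivative (\<lambda>\<xi>. D x (Pd x \<xi>))) (at x0)"
    proof (rule has_derivative_transform_within_open[OF _ open_ltrans[OF e0 e0, of "Ki x"]])
      show "x0 \<in> {xa \<in> K ` fst e0. mul (Ki x) (Ki xa) \<in> fst e0}" using xU by (auto simp: chart_inv_chart)
    qed (auto simp: \<phi>_def lam_def M_def chart_inv_chart mul_assoc)
    then show ?thesis by (simp add: tv_apply mdiff_iff differentiableI frechet_derivative_at[symmetric])
  qed
  have sp: "D x u = (\<Sum>i\<in>Basis. (u \<bullet> i) * D x i)" if "x \<in> S" for x u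
    by (subst euclidean_representation[symmetric, of u])
      (simp add: linear_sum[OF linD[OF that]] linear_scale[OF linD[OF that]])
  let ?D2 = "frechet_derivative (\<lambda>x. D x w) (at x0)"
  \<comment> \<open>\<open>Pd x w\<close> is split as w plus a remainder that vanishes at
    \<open>x0\<close>. In the product rule the derivatives of the \<open>D x i\<close> are then
    multiplied by 0 and drop out.\<close>
  have "((\<lambda>x. D x w + (\<Sum>i\<in>Basis. ((Pd x w - w) \<bullet> i) * D x i)) has_derivative
     (\<lambda>\<xi>. ?D2 \<xi> + (\<Sum>i\<in>Basis. (Bm \<xi> w \<bullet> i) * D x0 i))) (at x0)"
    by (rule has_derivative_eq_rhs)
      (auto intro!: derivative_eq_intros DD has_derivative_Pd)
  then have "((\<lambda>x. tv (lam p x) w f) has_derivative (\<lambda>\<xi>. ?D2 \<xi> + D x0 (Bm \<xi> w))) (at x0)"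
  proof (rule has_derivative_transform_within_open[OF _ S(1,2), THEN has_derivative_eq_rhs])
    fix x assume x: "x \<in> S"
    have "D x w + D x (Pd x w - w) = D x (Pd x w)" by (simp add: linear_diff[OF linD[OF x]])
    then show "D x w + (\<Sum>i\<in>Basis. ((Pd x w - w) \<bullet> i) * D x i) = tv (lam p x) w f"
      by (simp only: val[OF x] sp[OF x, of "Pd x w - w", symmetric])
  qed (simp only: sp[OF S(2), symmetric])
  then have "tv p v (\<lambda>q. tv q w f) = ?D2 v + D x0 (Bm v w)"
    by (simp add: tv_apply[of p v] mdiff_iff differentiableI frechet_derivative_at[symmetric])
  moreover have "tv p (Bm v w) f = D x0 (Bm v w)"
    using D[OF S(2)] by (simp add: tv_apply mdiff_iff \<phi>_def D_def differentiableI)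
  ultimately show ?thesis by (simp add: D_def \<phi>_def)
qed

lemma lie_bracket_tv: "lie_bracket A (\<lambda>p. tv p v) (\<lambda>p. tv p w) = (\<lambda>p. tv p (brk v w))"
proof
  fix p
  have key: "tv p (brk v w) f = tv p v (\<lambda>q. tv q w f) - tv p w (\<lambda>q. tv q v f)"
    if f: "smooth_near A f p" for f
  proof -
    obtain W where W: "open W" "p \<in> W" "Ck_fun_on A 2 W f" using f by (auto simp: smooth_near_def)
    obtain S where S: "open S" "x0 \<in> S" "Ck_on 2 S (\<lambda>y. f (lam p y))"
      by (rule Ck_lam[OF W])
    have "tv p (brk v w) f = tv p (Bm v w) f - tv p (Bm w v) f"
      unfolding brk_def by (rule linear_diff[OF linear_tv])
    also have "\<dots> = tv p v (\<lambda>q. tv q w f) - tv p w (\<lambda>q. tv q v f)"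
      using tv_tv[OF f, of v w] tv_tv[OF f, of w v] symmetric_second_derivative_real[OF S, of v w]
      by linarith
    finally show ?thesis .
  qed
  show "lie_bracket A (\<lambda>p. tv p v) (\<lambda>p. tv p w) p = tv p (brk v w)"
    unfolding lie_bracket_def
  proof (rule the_equality)
    fix u assume u: "u \<in> tangent_space A p \<and>
      (\<forall>f. smooth_near A f p \<longrightarrow> u f = tv p v (\<lambda>q. tv q w f) - tv p w (\<lambda>q. tv q v f))"
    then obtain \<xi> where \<xi>: "u = tv p \<xi>" unfolding tangent_space_eq by blast
    have "\<xi> = brk v w"
    proof (rule tv_separated)
      fix f assume f: "smooth_near A f p"
      then have "tv p \<xi> f = tv p v (\<lambda>q. tv q w f) - tv p w (\<lambda>q. tv q v f)" using u \<xi> by blast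
      then show "tv p \<xi> f = tv p (brk v w) f" by (rule trans[OF _ key[OF f, symmetric]])
    qed
    then show "u = tv p (brk v w)" by (simp only: \<xi>)
  qed (use key tv_mem in blast)
qed

text \<open>\<open>unimodular\<close> ranges over all bases. The matrix of ad Z in a basis is the
  conjugate of \<open>matrix (brk z)\<close> by the matrix \<open>?E\<close> with the basis vectors
  as columns, so its trace is \<open>tau z\<close>; invertibility of \<open>?E\<close> comes from
  the existence of coordinates.\<close>

lemma unimodularI:
  assumes "\<And>v. tau v = 0"
  shows "unimodular A mul"
  unfolding unimodular_def
proof (intro ballI allI impI)
  fix Z E assume Z: "Z \<in> lie_algebra A mul" and E: "lie_basis A mul E"
  obtain z where z: "Z = (\<lambda>p. tv p z)" using Z by (auto simp: lie_algebra_eq)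
  have "\<forall>i. \<exists>v. E i = (\<lambda>p. tv p v)" using E by (auto simp: lie_basis_def lie_algebra_eq)
  then obtain e where e: "\<And>i. E i = (\<lambda>p. tv p (e i))" by metis
  let ?E = "\<chi> i j. e j $ i"
  have comb: "(\<lambda>p f. \<Sum>i\<in>UNIV. a $ i * E i p f) = (\<lambda>p. tv p (?E *v a))" for a
  proof -
    have "?E *v a = (\<Sum>i\<in>UNIV. a $ i *\<^sub>R e i)"
      by (simp add: vec_eq_iff matrix_vector_mult_def mult.commute)
    then show ?thesis by (intro ext) (simp add: e tv_sum)
  qed
  have ex1: "\<exists>!a. ?E *v a = v" for v
  proof -
    have "(\<lambda>p. tv p v) \<in> lie_algebra A mul" by (auto simp: lie_algebra_eq)
    then have "\<exists>!a. (\<lambda>p. tv p v) = (\<lambda>p. tv p (?E *v a))" using E by (simp add: lie_basis_def comb)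
    moreover have "(\<lambda>p. tv p v) = (\<lambda>p. tv p (?E *v a)) \<longleftrightarrow> ?E *v a = v" for a
      by (auto simp: fun_eq_iff[of "\<lambda>p. tv p v"])
    ultimately show ?thesis by simp
  qed
  have coords: "?E *v lie_coords E (\<lambda>p. tv p v) = v" for v
  proof -
    have "(\<lambda>p. tv p v) = (\<lambda>p. tv p (?E *v a)) \<longleftrightarrow> ?E *v a = v" for a
      by (auto simp: fun_eq_iff[of "\<lambda>p. tv p v"])
    then show ?thesis unfolding lie_coords_def comb using theI'[OF ex1[of v]] by simp
  qed
  have "surj ((*v) ?E)" by (rule surjI[of _ "\<lambda>v. lie_coords E (\<lambda>p. tv p v)"]) (rule coords)
  then obtain B where B: "?E ** B = mat 1"
    unfolding matrix_right_invertible_surjective[symmetric] by blast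
  have col: "?E *v axis j 1 = e j" for j
    by (simp add: matrix_vector_mult_basis column_def vec_eq_iff)
  let ?a = "ad_matrix A E Z"
  have "(?E ** ?a) *v axis j 1 = (matrix (brk z) ** ?E) *v axis j 1" for j
  proof -
    have "?a *v axis j 1 = lie_coords E (\<lambda>p. tv p (brk z (e j)))"
      by (simp add: matrix_vector_mult_basis column_def vec_eq_iff ad_matrix_def z e lie_bracket_tv)
    then show ?thesis
      by (simp add: coords col matrix_works[OF linear_matrix_vector_mul_eq[THEN iffD2, OF linear_brk2]] flip: matrix_vector_mul_assoc)
  qed
  then have "column j (?E ** ?a) = column j (matrix (brk z) ** ?E)" for j
    by (simp add: matrix_vector_mult_basis)
  then have eq: "?E ** ?a = matrix (brk z) ** ?E" by (simp add: vec_eq_iff column_def)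
  have B': "B ** ?E = mat 1" by (rule matrix_left_right_inverse[THEN iffD1, OF B])
  have "trace ?a = trace (B ** (?E ** ?a))" by (simp add: matrix_mul_assoc B')
  also have "\<dots> = trace ((matrix (brk z) ** ?E) ** B)" by (simp only: eq trace_mul_sym[of B])
  also have "\<dots> = tau z" by (simp add: B tau_def flip: matrix_mul_assoc)
  finally show "trace ?a = 0" by (simp add: assms)
qed

end

subsection \<open>Determinants of triples\<close>

definition det3 :: "real^3 \<Rightarrow> real^3 \<Rightarrow> real^3 \<Rightarrow> real" where
  "det3 u v w = u$1 * (v$2 * w$3 - v$3 * w$2) + u$2 * (v$3 * w$1 - v$1 * w$3)
     + u$3 * (v$1 * w$2 - v$2 * w$1)"

lemma real3_expand: "v = v$1 *\<^sub>R axis 1 1 + v$2 *\<^sub>R axis 2 1 + v$3 *\<^sub>R axis 3 1" for v :: "real^3"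
  by (simp add: vec_eq_iff forall_3 axis_def)

lemma linear_real3:
  fixes f :: "real^3 \<Rightarrow> 'a::real_vector"
  assumes "linear f"
  shows "f v = v$1 *\<^sub>R f (axis 1 1) + v$2 *\<^sub>R f (axis 2 1) + v$3 *\<^sub>R f (axis 3 1)"
  by (subst real3_expand[of v]) (simp only: linear_add[OF assms] linear_scale[OF assms])

lemma det_matrix3: "det (matrix L) = det3 (L (axis 1 1)) (L (axis 2 1)) (L (axis 3 1))"
  for L :: "real^3 \<Rightarrow> real^3"
  unfolding det_3 det3_def matrix_def by (simp add: algebra_simps)

lemma det3_linear:
  assumes "linear L"
  shows "det3 (L u) (L v) (L w) = det (matrix L) * det3 u v w"
proof -
  have e: "L v $ i = v$1 * L (axis 1 1) $ i + v$2 * L (axis 2 1) $ i + v$3 * L (axis 3 1) $ i" for v i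
    by (subst linear_real3[OF assms]) simp
  show ?thesis unfolding det_matrix3 det3_def e[of u] e[of v] e[of w] by algebra
qed

lemma det3_minus [simp]: "det3 (- u) v w = - det3 u v w"
  by (simp add: det3_def algebra_simps)

lemma det3_rotate: "det3 u v w = det3 w u v"
  by (simp add: det3_def algebra_simps)

text \<open>Three vectors in a plane are dependent; as polynomials in the entries, each coefficient
  of \<open>l\<close> times the determinant lies in the ideal of the three equations.\<close>

lemma det3_kernel:
  assumes l: "linear l" and nz: "l z \<noteq> (0::real)" and k: "l u = 0" "l v = 0" "l w = 0"
  shows "det3 u v w = 0"
proof -
  let ?a = "l (axis 1 1)" and ?b = "l (axis 2 1)" and ?c = "l (axis 3 1)"
  have e: "l x = x$1 * ?a + x$2 * ?b + x$3 * ?c" for x using linear_real3[OF l, of x] by simp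
  have "?a * det3 u v w = 0" "?b * det3 u v w = 0" "?c * det3 u v w = 0"
    using k unfolding e[of u] e[of v] e[of w] det3_def by algebra+
  moreover have "?a \<noteq> 0 \<or> ?b \<noteq> 0 \<or> ?c \<noteq> 0" using nz e[of z] by auto
  ultimately show ?thesis by auto
qed

text \<open>Fluxes through a plane are proportional to the normal components:
  \<open>l u *\<^sub>R v - l v *\<^sub>R u\<close> lies in the plane, so its flux is 0.\<close>

lemma det3_kernel2:
  assumes l: "linear l" and nz: "l z \<noteq> (0::real)" and k: "l a = 0" "l b = 0"
  shows "l u * det3 v a b = l v * det3 u a b"
proof -
  have "det3 (l u *\<^sub>R v - l v *\<^sub>R u) a b = 0"
    by (rule det3_kernel[OF l nz]) (simp_all add: k linear_diff[OF l] linear_scale[OF l])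
  then show ?thesis by (simp add: det3_def algebra_simps)
qed

section \<open>The contact structure in the left trivialization\<close>

context contact_lie_group3
begin

definition th :: "real^3 \<Rightarrow> real" where "th v = \<theta> unit (tv unit v)"

lemma theta_tv: "\<theta> p (tv p v) = th v"
proof -
  have "\<forall>h p. \<forall>v\<in>tangent_space A p. \<theta> (mul h p) (dleft mul h v) = \<theta> p v"
    using form by (simp add: left_inv_form_def)
  then have "\<theta> (mul p unit) (dleft mul p (tv unit v)) = \<theta> unit (tv unit v)" using tv_mem by blast
  then show ?thesis by (simp add: dleft_tv th_def)
qed

lemma linear_th: "linear th"
proof -
  have "\<theta> unit (\<lambda>f. a * tv unit v f + b * tv unit w f) = a * \<theta> unit (tv unit v) + b * \<theta> unit (tv unit w)" for a b v w
    using form tv_mem by (simp add: left_inv_form_def)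
  then have l: "th (a *\<^sub>R v + b *\<^sub>R w) = a * th v + b * th w" for a b v w
    by (simp add: th_def tv_lincomb)
  show ?thesis
    by (rule linearI) (use l[of 1 _ 1] l[of _ _ 0] in simp_all)
qed

lemma left_ext_tv: "left_ext mul iv p (tv p v) = (\<lambda>q. tv q v)"
  by (simp add: left_ext_def dleft_tv mul_assoc)

lemma tv_const: "tv p v (\<lambda>q. k) = 0" by (simp add: tv_apply)

text \<open>Maurer-Cartan: \<theta> is constant on left-invariant fields, so only the bracket term
  of the invariant formula remains.\<close>

lemma ext_deriv_tv: "ext_deriv A mul iv \<theta> p (tv p v) (tv p w) = - th (brk v w)"
  by (simp add: ext_deriv_def ext_deriv_fields_def left_ext_tv theta_tv tv_const lie_bracket_tv)

text \<open>The value of the 3-form \<open>\<theta> \<and> d\<theta>\<close> on the left translates of the coordinate frame at the unit.\<close>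

definition vol0 :: real where
  "vol0 = - (th (axis 1 1) * th (brk (axis 2 1) (axis 3 1)) +
             th (axis 2 1) * th (brk (axis 3 1) (axis 1 1)) +
             th (axis 3 1) * th (brk (axis 1 1) (axis 2 1)))"

lemma contact_volume_tv:
  "contact_volume A mul iv \<theta> p (tv p u) (tv p v) (tv p w) = vol0 * det3 u v w"
proof -
  let ?e = "\<lambda>i. axis i 1 :: real^3"
  let ?b = "\<lambda>i j. th (brk (?e i) (?e j))"
  have t: "th v = v$1 * th (?e 1) + v$2 * th (?e 2) + v$3 * th (?e 3)" for v
    using linear_real3[OF linear_th, of v] by simp
  have l1: "linear (\<lambda>v. th (brk v w))" for w
    using linear_compose[OF linear_brk1 linear_th] by (simp add: o_def)
  have l2: "linear (\<lambda>w. th (brk v w))" for v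
    using linear_compose[OF linear_brk2 linear_th] by (simp add: o_def)
  have e1: "th (brk v w) = v$1 * th (brk (?e 1) w) + v$2 * th (brk (?e 2) w) + v$3 * th (brk (?e 3) w)" for v w
    using linear_real3[OF l1, of v w] by simp
  have e2: "th (brk v w) = w$1 * th (brk v (?e 1)) + w$2 * th (brk v (?e 2)) + w$3 * th (brk v (?e 3))" for v w
    using linear_real3[OF l2, of v w] by simp
  have a: "th (brk v w) = - th (brk w v)" for v w
    using brk_commute[of v w] linear_neg[OF linear_th] by simp
  have d: "th (brk v v) = 0" for v by (simp add: linear_0[OF linear_th])
  \<comment> \<open>Antisymmetry reduces the nine structure coefficients to the three that occur in
    \<open>vol0\<close>.\<close>
  have b: "th (brk v w) = (v$2 * w$3 - v$3 * w$2) * ?b 2 3 + (v$3 * w$1 - v$1 * w$3) * ?b 3 1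
     + (v$1 * w$2 - v$2 * w$1) * ?b 1 2" for v w
    unfolding e1[of v w] e2[of "?e 1" w] e2[of "?e 2" w] e2[of "?e 3" w] d
      a[of "?e 2" "?e 1"] a[of "?e 3" "?e 2"] a[of "?e 1" "?e 3"] by algebra
  show ?thesis
    unfolding contact_volume_def theta_tv ext_deriv_tv t[of u] t[of v] t[of w] b[of v w] b[of w u] b[of u v]
      det3_def vol0_def by algebra
qed

lemma frame_coordinates:
  obtains x y t where "X = (\<lambda>p. tv p x)" "Y = (\<lambda>p. tv p y)" "T = (\<lambda>p. tv p t)"
    "brk x y = a3 *\<^sub>R x + b3 *\<^sub>R y + c *\<^sub>R t" "\<And>v. \<exists>a b d. v = a *\<^sub>R x + b *\<^sub>R y + d *\<^sub>R t"
proof -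
  obtain x where x: "X = (\<lambda>p. tv p x)" using fields(1) by (auto simp: lie_algebra_eq)
  obtain y where y: "Y = (\<lambda>p. tv p y)" using fields(2) by (auto simp: lie_algebra_eq)
  obtain t where t: "T = (\<lambda>p. tv p t)" using fields(3) by (auto simp: lie_algebra_eq)
  have "tv p (brk x y) = tv p (a3 *\<^sub>R x + b3 *\<^sub>R y + c *\<^sub>R t)" for p
  proof -
    have "tv p (a3 *\<^sub>R x + b3 *\<^sub>R y + c *\<^sub>R t) f = a3 * tv p x f + b3 * tv p y f + c * tv p t f" for f
      by (simp add: linear_add[OF linear_tv] linear_scale[OF linear_tv])
    moreover have "lie_bracket A X Y p = (\<lambda>f. a3 * X p f + b3 * Y p f + c * T p f)"
      using bracket by simp
    ultimately show ?thesis by (simp add: x y t lie_bracket_tv fun_eq_iff)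
  qed
  then have br: "brk x y = a3 *\<^sub>R x + b3 *\<^sub>R y + c *\<^sub>R t" by simp
  have tht: "th t = 1" using reeb(1)[of unit] by (simp add: t th_def)
  have sp: "\<exists>a b d. v = a *\<^sub>R x + b *\<^sub>R y + d *\<^sub>R t" for v
  proof -
    \<comment> \<open>Without its Reeb component \<open>v\<close> is horizontal, and
      \<open>span\<close> supplies the remaining coefficients.\<close>
    have "th (v - th v *\<^sub>R t) = 0" by (simp add: linear_diff[OF linear_th] linear_scale[OF linear_th] tht)
    then have "tv unit (v - th v *\<^sub>R t) \<in> horizontal A \<theta> unit" by (simp add: horizontal_def theta_tv)
    then obtain a b where "tv unit (v - th v *\<^sub>R t) = (\<lambda>f. a * tv unit x f + b * tv unit y f)"
      unfolding span x y by blast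
    then have "tv unit (v - th v *\<^sub>R t) = tv unit (a *\<^sub>R x + b *\<^sub>R y)" by (simp only: tv_lincomb)
    then have "v - th v *\<^sub>R t = a *\<^sub>R x + b *\<^sub>R y" by simp
    then have "v = a *\<^sub>R x + b *\<^sub>R y + th v *\<^sub>R t" by (simp add: algebra_simps)
    then show ?thesis by blast
  qed
  show ?thesis using that[OF x y t br sp] .
qed

lemma nonunimodular_imp_tau:
  assumes "\<not> unimodular A mul" and X: "X = (\<lambda>p. tv p x)" and Y: "Y = (\<lambda>p. tv p y)"
  shows "tau x \<noteq> 0 \<or> tau y \<noteq> 0"
proof (rule ccontr)
  assume "\<not> ?thesis"
  then have z: "tau x = 0" "tau y = 0" by auto
  obtain x' y' t where f: "X = (\<lambda>p. tv p x')" "Y = (\<lambda>p. tv p y')"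
    "brk x' y' = a3 *\<^sub>R x' + b3 *\<^sub>R y' + c *\<^sub>R t" and sp: "\<And>v. \<exists>a b d. v = a *\<^sub>R x' + b *\<^sub>R y' + d *\<^sub>R t"
    by (rule frame_coordinates) blast
  have xy: "x' = x" "y' = y" using f(1,2) X Y by (metis tv_inject)+
  have "tau (brk x y) = a3 * tau x + b3 * tau y + c * tau t"
    unfolding f(3)[unfolded xy] by (simp add: linear_add[OF linear_tau] linear_scale[OF linear_tau])
  then have "c * tau t = 0" using z by simp
  then have "tau t = 0" using c_neg by simp
  then have "tau v = 0" for v
    using sp[of v] z unfolding xy by (auto simp: linear_add[OF linear_tau] linear_scale[OF linear_tau])
  then show False using unimodularI assms(1) by blast
qed

text \<open>The vectors \<open>a\<close>, \<open>b\<close> span the tangent plane, the kernel of du.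
  There the flux of w is du(w)/du(\<nu>) times that of the horizontal normal \<nu>. Here du(\<nu>)
  is the norm of the horizontal gradient, and du(w) is one of its two components, hence no
  larger.\<close>

lemma hor_normal_bound:
  assumes X: "X = (\<lambda>p. tv p x)" and Y: "Y = (\<lambda>p. tv p y)"
    and w: "w = x \<or> w = y" and a: "tv p a u = 0" and b: "tv p b u = 0" and nz: "tv p z u \<noteq> 0"
  shows "\<bar>vol0 * det3 w a b\<bar> \<le>
    \<bar>contact_volume A mul iv \<theta> p (hor_normal g X Y u p) (tv p a) (tv p b)\<bar>"
proof -
  define \<alpha> where "\<alpha> = tv p x u"
  define \<beta> where "\<beta> = tv p y u"
  have grad: "hor_grad X Y u p = tv p (\<alpha> *\<^sub>R x + \<beta> *\<^sub>R y)"
    by (simp add: hor_grad_def X Y \<alpha>_def \<beta>_def tv_lincomb)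
  have hor: "tv p (s *\<^sub>R x + t *\<^sub>R y) \<in> horizontal A \<theta> p" for s t
    unfolding span X Y tv_lincomb by blast
  have hx: "tv p x \<in> horizontal A \<theta> p" using hor[of 1 0] by simp
  have hy: "tv p y \<in> horizontal A \<theta> p" using hor[of 0 1] by simp
  have gl: "g p (tv p (s *\<^sub>R x + t *\<^sub>R y)) v = s * g p (tv p x) v + t * g p (tv p y) v"
    if "v \<in> horizontal A \<theta> p" for s t v
    using metric hx hy that unfolding left_inv_subriem_metric_def tv_lincomb by blast
  have gs: "g p v w = g p w v" if "v \<in> horizontal A \<theta> p" "w \<in> horizontal A \<theta> p" for v w
    using metric that unfolding left_inv_subriem_metric_def by blast
  have on: "g p (tv p x) (tv p x) = 1" "g p (tv p y) (tv p y) = 1" "g p (tv p x) (tv p y) = 0" "g p (tv p y) (tv p x) = 0"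
    using orthonormal[of p] gs[OF hy hx] by (simp_all add: X Y)
  let ?n = "tv p (\<alpha> *\<^sub>R x + \<beta> *\<^sub>R y)"
  have "g p ?n ?n = \<alpha> * g p ?n (tv p x) + \<beta> * g p ?n (tv p y)"
    by (simp only: gl[OF hor] gs[OF hx hor] gs[OF hy hor])
  then have gg: "g p ?n ?n = \<alpha>\<^sup>2 + \<beta>\<^sup>2" by (simp add: gl[OF hx] gl[OF hy] on power2_eq_square)
  define r where "r = sqrt (\<alpha>\<^sup>2 + \<beta>\<^sup>2)"
  let ?nu = "(1 / r) *\<^sub>R (\<alpha> *\<^sub>R x + \<beta> *\<^sub>R y)"
  have nu: "hor_normal g X Y u p = tv p ?nu"
    unfolding hor_normal_def grad gg r_def[symmetric] by (rule ext) (subst linear_scale[OF linear_tv], simp)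
  have lin: "linear (\<lambda>v. tv p v u)" by (rule linear_tv)
  have wu: "\<bar>tv p w u\<bar> \<le> r" using w unfolding r_def \<alpha>_def \<beta>_def by auto
  have "\<bar>det3 w a b\<bar> \<le> \<bar>det3 ?nu a b\<bar>"
  \<comment> \<open>At a characteristic point the normal is 0 by convention, so the left side must
    vanish too: w is then itself tangent to the surface.\<close>
  proof (cases "r = 0")
    case True
    then have "tv p w u = 0" using wu by simp
    then have "det3 w a b = 0" by (rule det3_kernel[OF lin nz _ a b])
    then show ?thesis by simp
  next
    case False
    have r2: "\<alpha> * \<alpha> + \<beta> * \<beta> = r * r" unfolding r_def by (simp add: power2_eq_square)
    have "tv p ?nu u = r"
      using False r2 by (simp add: linear_scale[OF lin] linear_add[OF lin] \<alpha>_def[symmetric] \<beta>_def[symmetric])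
    then have "r * det3 w a b = tv p w u * det3 ?nu a b"
      using det3_kernel2[OF lin nz a b, of ?nu w] by simp
    then have "r * \<bar>det3 w a b\<bar> = \<bar>tv p w u\<bar> * \<bar>det3 ?nu a b\<bar>"
      using r2 by (metis abs_mult abs_of_nonneg r_def real_sqrt_ge_zero sum_power2_ge_zero)
    also have "\<dots> \<le> r * \<bar>det3 ?nu a b\<bar>" using wu by (intro mult_right_mono) auto
    finally show ?thesis using False wu by (simp add: mult_le_cancel_left)
  qed
  then show ?thesis unfolding nu contact_volume_tv abs_mult by (intro mult_left_mono) auto
qed

end

section \<open>Local solutions of autonomous differential equations\<close>

text \<open>Freezing \<open>h\<close> beyond the ends of the interval places it in the complete
  space of bounded continuous functions on the line, where Banach's fixed point theorem is
  available.\<close>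

lemma clamped_bcontfun:
  fixes h :: "real \<Rightarrow> 'a::metric_space"
  assumes "continuous_on {-a..a} h"
  shows "\<exists>g::real \<Rightarrow>\<^sub>C 'a. \<forall>s. apply_bcontfun g s = h (clamp (-a) a s)"
proof -
  have "continuous_on UNIV (\<lambda>s. h (clamp (-a) a s))"
    by (rule clamp_continuous_on) (use assms in simp)
  moreover have "bounded (range (\<lambda>s. h (clamp (-a) a s)))"
    by (rule clamp_bounded) (use assms in \<open>simp add: compact_imp_bounded compact_continuous_image\<close>)
  ultimately have "(\<lambda>s. h (clamp (-a) a s)) \<in> bcontfun" by (simp add: bcontfun_def)
  then show ?thesis by (metis bcontfunE)
qed

lemma clamp_real: "a \<ge> 0 \<Longrightarrow> \<bar>s\<bar> \<le> a \<Longrightarrow> clamp (-a) a s = s" for s :: real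
  by (rule clamp_cancel_cbox) auto

lemma clamp_real_mem: "a \<ge> 0 \<Longrightarrow> clamp (-a) a s \<in> {-a..a}" for s :: real
  using clamp_in_interval[of "-a" a s] by simp

text \<open>The fixed point of the Picard operator on clamped curves. It is constant beyond
  \<open>a\<close> in both directions, so the equation is asserted only in the open
  interval.\<close>

lemma picard_global:
  fixes G :: "'a::euclidean_space \<Rightarrow> 'a"
  assumes G: "\<And>x y. norm (G x - G y) \<le> L * norm (x - y)" and a: "a > 0" "L * (2 * a) \<le> 1/2" and L: "L \<ge> 0"
  shows "\<exists>y. y 0 = p \<and> (\<forall>s. \<bar>s\<bar> < a \<longrightarrow> (y has_vector_derivative G (y s)) (at s))"
proof -
  have contG: "continuous_on UNIV G"
    by (rule lipschitz_on_continuous_on[of L]) (use G L in \<open>auto simp: lipschitz_on_def dist_norm\<close>)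
  have cont: "continuous_on S (\<lambda>r. G (apply_bcontfun g r))" for S and g :: "real \<Rightarrow>\<^sub>C 'a"
    by (rule continuous_on_compose2[OF contG apply_bcontfun[THEN bcontfun_def[THEN eqset_imp_iff, THEN iffD1, THEN CollectD, THEN conjunct1], THEN continuous_on_subset]]) auto
  \<comment> \<open>One primitive from -a serves both signs of s; subtracting its value at 0
    restores the initial condition at 0.\<close>
  define I where "I = (\<lambda>(g::real \<Rightarrow>\<^sub>C 'a) s. integral {-a..s} (\<lambda>r. G (apply_bcontfun g r)))"
  have dI: "(I g has_vector_derivative G (apply_bcontfun g s)) (at s within {-a..a})" if "s \<in> {-a..a}" for g s
    unfolding I_def by (rule integral_has_vector_derivative[OF cont that])
  have "\<exists>h::real \<Rightarrow>\<^sub>C 'a. \<forall>s. apply_bcontfun h s = p + (I g (clamp (-a) a s) - I g 0)" for g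
  proof (rule clamped_bcontfun[of a "\<lambda>s. p + (I g s - I g 0)"])
    have "continuous_on {-a..a} (I g)"
      unfolding continuous_on_eq_continuous_within
      by (intro ballI has_vector_derivative_continuous[OF dI])
    then show "continuous_on {-a..a} (\<lambda>s. p + (I g s - I g 0))" by (intro continuous_intros)
  qed
  then obtain \<Phi> where \<Phi>: "apply_bcontfun (\<Phi> g) s = p + (I g (clamp (-a) a s) - I g 0)" for g s by metis
  have diff: "norm ((I g s - I g 0) - (I h s - I h 0)) \<le> 1/2 * dist g h" if s: "s \<in> {-a..a}" for g h s
  proof -
    let ?d = "\<lambda>r. G (apply_bcontfun g r) - G (apply_bcontfun h r)"
    have int: "(\<lambda>r. G (apply_bcontfun g r)) integrable_on {u..v}" for g :: "real \<Rightarrow>\<^sub>C 'a" and u v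
      by (rule integrable_continuous_real[OF cont])
    have b: "norm (?d r) \<le> L * dist g h" for r
      using G[of "apply_bcontfun g r" "apply_bcontfun h r"] mult_left_mono[OF dist_bounded[of g r h] L]
      by (simp add: dist_norm)
    have id: "?d integrable_on {u..v}" for u v by (rule integrable_diff[OF int int])
    have ib: "norm (integral {u..v} ?d) \<le> L * dist g h * (v - u)" if "u \<le> v" for u v
    proof -
      have "(?d has_integral integral {u..v} ?d) (cbox u v)"
        using integrable_diff[OF int[of g u v] int[of h u v]] by (simp add: integrable_integral)
      from has_integral_bound[OF _ this b] show ?thesis using L that by simp
    qed
    have e: "I g s - I h s = integral {-a..s} ?d" "I g 0 - I h 0 = integral {-a..0} ?d"
      unfolding I_def by (simp_all add: integral_diff int)
    have "norm ((I g s - I g 0) - (I h s - I h 0)) = norm (integral {-a..s} ?d - integral {-a..0} ?d)"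
      unfolding e[symmetric] by (simp add: algebra_simps)
    also have "\<dots> \<le> L * dist g h * a"
    proof (cases "0 \<le> s")
      case True
      have "integral {-a..0} ?d + integral {0..s} ?d = integral {-a..s} ?d"
        using True a by (intro Henstock_Kurzweil_Integration.integral_combine[OF _ _ id]) auto
      then have "integral {-a..s} ?d - integral {-a..0} ?d = integral {0..s} ?d" by (simp add: algebra_simps)
      moreover have "L * dist g h * (s - 0) \<le> L * dist g h * a" using s L by (intro mult_left_mono) auto
      ultimately show ?thesis using ib[of 0 s] True by simp
    next
      case False
      have "integral {-a..s} ?d + integral {s..0} ?d = integral {-a..0} ?d"
        using False s by (intro Henstock_Kurzweil_Integration.integral_combine[OF _ _ id]) auto
      then have "integral {-a..s} ?d - integral {-a..0} ?d = - integral {s..0} ?d" by (simp add: algebra_simps)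
      moreover have "L * dist g h * (0 - s) \<le> L * dist g h * a" using s L by (intro mult_left_mono) auto
      ultimately show ?thesis using ib[of s 0] False by simp
    qed
    also have "\<dots> \<le> 1/2 * dist g h"
    proof -
      have "L * a \<le> 1/2" using a L mult_nonneg_nonneg[of L a] by linarith
      from mult_right_mono[OF this zero_le_dist[of g h]] show ?thesis by (simp add: mult.assoc mult.commute mult.left_commute)
    qed
    finally show ?thesis .
  qed
  have "\<exists>!g. \<Phi> g = g"
  proof (rule banach_fix_type[of "1/2"])
    show "\<forall>g h. dist (\<Phi> g) (\<Phi> h) \<le> 1/2 * dist g h"
    proof (intro allI)
      fix g h
      show "dist (\<Phi> g) (\<Phi> h) \<le> 1/2 * dist g h"
      proof (rule dist_bound)
        fix s
        show "dist (apply_bcontfun (\<Phi> g) s) (apply_bcontfun (\<Phi> h) s) \<le> 1/2 * dist g h"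
          using diff[OF clamp_real_mem[OF less_imp_le[OF a(1)]], of g s h] by (simp add: \<Phi> dist_norm)
      qed
    qed
  qed auto
  then obtain g where g: "\<Phi> g = g" by blast
  have gs: "apply_bcontfun g s = p + (I g s - I g 0)" if "s \<in> {-a..a}" for s
    using \<Phi>[of g s] that a by (simp add: g clamp_real abs_le_iff)
  show ?thesis
  proof (intro exI[of _ "apply_bcontfun g"] conjI allI impI)
    show "apply_bcontfun g 0 = p" using gs[of 0] a by simp
    fix s :: real assume s: "\<bar>s\<bar> < a"
    have "(I g has_vector_derivative G (apply_bcontfun g s)) (at s within {-a..a})" using s by (intro dI) auto
    then have "((\<lambda>s. p + (I g s - I g 0)) has_vector_derivative G (apply_bcontfun g s)) (at s within {-a..a})"
      by (auto intro!: derivative_eq_intros)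
    then have "(apply_bcontfun g has_vector_derivative G (apply_bcontfun g s)) (at s within {-a..a})"
      by (rule has_vector_derivative_transform[rotated 2]) (use s gs in auto)
    moreover have "at s within {-a..a} = at s"
      using s by (intro at_within_interior) auto
    ultimately show "(apply_bcontfun g has_vector_derivative G (apply_bcontfun g s)) (at s)" by simp
  qed
qed

text \<open>\<open>G\<close> is precomposed with the closest-point projection onto a ball around
  \<open>p\<close>, which is 1-Lipschitz and so yields a globally Lipschitz field. For short times
  the solution stays in the ball, where the field is unchanged.\<close>

lemma picard_local:
  fixes G :: "'a::euclidean_space \<Rightarrow> 'a"
  assumes S: "open S" "p \<in> S" and G: "Ck_on 1 S G"
  obtains a y where "a > 0" "y 0 = p" "\<And>s. \<bar>s\<bar> < a \<Longrightarrow> y s \<in> S"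
    "\<And>s. \<bar>s\<bar> < a \<Longrightarrow> (y has_vector_derivative G (y s)) (at s)"
proof -
  obtain r where r: "r > 0" "cball p r \<subseteq> S" using S open_contains_cball by blast
  let ?D = "\<lambda>x. frechet_derivative G (at x)"
  have D: "(G has_derivative ?D x) (at x)" if "x \<in> S" for x by (rule Ck_on_has_derivative[OF G _ that]) simp
  \<comment> \<open>\<open>Ck_on\<close> gives continuity of the derivative only direction by
    direction; the sum over \<open>Basis\<close> dominates the operator norm and is
    continuous.\<close>
  have c: "continuous_on (cball p r) (\<lambda>x. \<Sum>i\<in>Basis. norm (?D x i))"
    using G r by (intro continuous_intros) (auto simp: Ck_on_1_iff intro: continuous_on_subset)
  then have "bounded ((\<lambda>x. \<Sum>i\<in>Basis. norm (?D x i)) ` cball p r)"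
    by (intro compact_imp_bounded compact_continuous_image) auto
  then obtain L where L: "L > 0" "\<And>x. x \<in> cball p r \<Longrightarrow> \<bar>\<Sum>i\<in>Basis. norm (?D x i)\<bar> \<le> L"
    unfolding bounded_pos by auto
  have on: "onorm (?D x) \<le> L" if x: "x \<in> cball p r" for x
  proof (rule onorm_le)
    fix v
    have lin: "linear (?D x)" using D[of x] x r has_derivative_linear by blast
    have "?D x v = (\<Sum>i\<in>Basis. (v \<bullet> i) *\<^sub>R ?D x i)"
      by (subst euclidean_representation[symmetric, of v]) (simp add: linear_sum[OF lin] linear_scale[OF lin])
    then have "norm (?D x v) \<le> (\<Sum>i\<in>Basis. norm v * norm (?D x i))"
      by (auto intro!: sum_norm_le mult_right_mono Basis_le_norm)
    also have "\<dots> = (\<Sum>i\<in>Basis. norm (?D x i)) * norm v" by (simp add: sum_distrib_left mult.commute)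
    also have "\<dots> \<le> L * norm v" using L(2)[OF x] by (intro mult_right_mono) auto
    finally show "norm (?D x v) \<le> L * norm v" .
  qed
  have lip: "norm (G x - G y) \<le> L * norm (x - y)" if "x \<in> cball p r" "y \<in> cball p r" for x y
    by (rule differentiable_bound[OF convex_cball has_derivative_at_withinI[OF D] on that]) (use r in auto)
  let ?P = "closest_point (cball p r)"
  have P: "?P x \<in> cball p r" for x using r by (intro closest_point_in_set) auto
  have lip2: "norm (G (?P x) - G (?P y)) \<le> L * norm (x - y)" for x y
  proof -
    have "norm (?P x - ?P y) \<le> norm (x - y)"
      using closest_point_lipschitz[of "cball p r" x y] r by (simp add: dist_norm)
    then have "L * norm (?P x - ?P y) \<le> L * norm (x - y)" using L by (intro mult_left_mono) auto
    with lip[OF P[of x] P[of y]] show ?thesis by linarith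
  qed
  \<comment> \<open>The length 1 / (4 L) makes L * (2 * a) equal to 1/2.\<close>
  obtain y where y: "y 0 = p" "\<And>s. \<bar>s\<bar> < 1 / (4 * L) \<Longrightarrow> (y has_vector_derivative G (?P (y s))) (at s)"
    using picard_global[where G="\<lambda>x. G (?P x)" and L=L and a="1 / (4 * L)" and p=p] lip2 L by auto
  have "isCont y 0" using y(2)[of 0] L has_vector_derivative_continuous by auto
  then obtain d where d: "d > 0" "\<And>s. \<bar>s\<bar> < d \<Longrightarrow> dist (y s) p < r"
    using r(1) unfolding continuous_at_eps_delta by (auto simp: y(1))
  have in_ball: "y s \<in> cball p r" if "\<bar>s\<bar> < d" for s using d(2)[OF that] by (simp add: dist_commute)
  show ?thesis
  proof (rule that[of "min d (1 / (4 * L))" y])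
    show "min d (1 / (4 * L)) > 0" using d L by simp
    show "y 0 = p" by (rule y)
    fix s assume s: "\<bar>s\<bar> < min d (1 / (4 * L))"
    then have b: "y s \<in> cball p r" using in_ball by simp
    then show "y s \<in> S" using r by auto
    show "(y has_vector_derivative G (y s)) (at s)"
      using y(2)[of s] s closest_point_self[OF b] by simp
  qed
qed

lemma DERIV_mult3:
  fixes f g h :: "real \<Rightarrow> real"
  assumes "(f has_real_derivative f') (at x)" "(g has_real_derivative g') (at x)"
    "(h has_real_derivative h') (at x)"
  shows "((\<lambda>x. f x * g x * h x) has_real_derivative f' * g x * h x + f x * g' * h x + f x * g x * h') (at x)"
  by (rule DERIV_cong[OF DERIV_mult[OF DERIV_mult[OF assms(1,2)] assms(3)]]) (simp add: algebra_simps)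

section \<open>Integral curves of left-invariant fields and the modular factor\<close>

context lie_group3
begin

text \<open>In the chart at the unit the left-invariant field of \<open>w\<close> reads x ->
  \<open>Pd x w\<close>, which is C^1 as a partial derivative of the smooth multiplication, so
  \<open>picard_local\<close> applies.\<close>

lemma integral_curve:
  obtains a \<gamma> where "a > 0" "\<gamma> 0 = unit" "\<And>s. \<bar>s\<bar> < a \<Longrightarrow> md \<gamma> (\<lambda>r. r *\<^sub>R w) s"
proof -
  have "Ck_on 1 (K ` fst e0) (\<lambda>x. DM (x, x0) (0, w))"
  proof (rule Ck_on_compose[OF open_chart_image[OF e0] open_OM])
    show "Ck_on 1 OM (\<lambda>z. DM z (0, w))"
      using smooth_M[of "Suc 1"] unfolding Ck_on.simps(2) DM_def by blast
    show "Ck_on 1 (K ` fst e0) (\<lambda>x. (x, x0))"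
      by (rule Ck_on_Pair[OF open_chart_image[OF e0] Ck_on_linear[OF bounded_linear_ident] Ck_on_const])
  qed (auto simp: OM_mem)
  then have "Ck_on 1 (K ` fst e0) (\<lambda>x. Pd x w)" by (simp add: Pd_def)
  then obtain a y where a: "a > 0" and y: "y 0 = x0" "\<And>s. \<bar>s\<bar> < a \<Longrightarrow> y s \<in> K ` fst e0"
    "\<And>s. \<bar>s\<bar> < a \<Longrightarrow> (y has_vector_derivative Pd (y s) w) (at s)"
    using picard_local[OF open_chart_image[OF e0] x0_mem] by metis
  define \<gamma> where "\<gamma> = (\<lambda>s. Ki (y s))"
  show ?thesis
  proof (rule that[of a \<gamma>])
    show "\<gamma> 0 = unit" by (simp add: \<gamma>_def y)
    fix s :: real assume s: "\<bar>s\<bar> < a"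
    let ?p = "\<gamma> s"
    have p: "?p \<in> fst e0" and Kp: "K ?p = y s"
      using y(2)[OF s] by (auto simp: \<gamma>_def chart_inv_chart)
    have "isCont y s" using y(3)[OF s] by (rule has_vector_derivative_continuous)
    moreover have "isCont Ki (y s)" using isCont_chart_inv[OF e0 p] by (simp add: Kp)
    ultimately have cont: "isCont \<gamma> s" unfolding \<gamma>_def by (rule continuous_within_compose3[rotated])
    have "open {-a<..<a}" "s \<in> {-a<..<a}" using s by auto
    have "((\<lambda>s. K (\<gamma> s)) has_derivative (\<lambda>r. r *\<^sub>R Pd (y s) w)) (at s)"
    proof (rule has_derivative_transform_within_open[OF _ \<open>open {-a<..<a}\<close> \<open>s \<in> {-a<..<a}\<close>])
      show "(y has_derivative (\<lambda>r. r *\<^sub>R Pd (y s) w)) (at s)"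
        using y(3)[OF s] by (simp add: has_vector_derivative_def)
      fix r assume "r \<in> {-a<..<a}"
      then have "y r \<in> K ` fst e0" by (intro y(2)) auto
      then show "y r = K (\<gamma> r)" by (simp add: \<gamma>_def chart_chart_inv)
    qed
    from chart_deriv_imp_md[OF e0 p cont refl this]
    have "md \<gamma> (\<lambda>r. Pinv e0 ?p (r *\<^sub>R Pd (y s) w)) s" .
    \<comment> \<open>In the chart, \<open>lam ?p\<close> is the map x -> \<open>M (y s, x)\<close>;
      therefore \<open>Pinv\<close> turns the chart velocity back into \<open>w\<close>.\<close>
    moreover have "Pm e0 ?p = Pd (y s)"
    proof -
      have "((\<lambda>x. M (y s, x)) has_derivative Pd (y s)) (at x0)"
        unfolding Pd_def by (rule has_derivative_M_right[OF OM_mem(1)[OF y(2)[OF s]]])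
      then have "((\<lambda>x. K (lam ?p x)) has_derivative Pd (y s)) (at x0)" by (simp add: M_def lam_def \<gamma>_def)
      then show ?thesis by (rule has_derivative_unique[OF has_derivative_Pm[OF e0 p]])
    qed
    ultimately show "md \<gamma> (\<lambda>r. r *\<^sub>R w) s"
      using Pinv_Pm[OF e0 p, of w] by (simp add: linear_scale[OF linear_Pinv[OF e0 p]])
  qed (rule a)
qed

text \<open>For the second claim no group law of \<gamma> is available. Instead u = N(\<gamma>(s)) w
  - w starts at 0 and, as [w, w] = 0, satisfies the linear equation u' = [u, w]; Gronwall's argument
  gives u = 0.\<close>

lemma N_integral_curve:
  assumes a: "a > 0" and \<gamma>: "\<gamma> 0 = unit" "\<And>s. \<bar>s\<bar> < a \<Longrightarrow> md \<gamma> (\<lambda>r. r *\<^sub>R w) s"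
  shows "\<bar>s\<bar> < a \<Longrightarrow> ((\<lambda>s. N (\<gamma> s) v) has_vector_derivative brk (N (\<gamma> s) v) w) (at s)"
    and "0 \<le> s \<Longrightarrow> s < a \<Longrightarrow> N (\<gamma> s) w = w"
proof -
  have D: "((\<lambda>s. N (\<gamma> s) v) has_vector_derivative brk (N (\<gamma> s) v) w) (at s)" if "\<bar>s\<bar> < a" for s v
    using has_derivative_N_along[OF \<gamma>(2)[OF that], of v]
    by (simp add: has_vector_derivative_def linear_scale[OF linear_brk2])
  then show "\<bar>s\<bar> < a \<Longrightarrow> ((\<lambda>s. N (\<gamma> s) v) has_vector_derivative brk (N (\<gamma> s) v) w) (at s)" .
  assume s: "0 \<le> s" "s < a"
  have "bounded_linear (\<lambda>v. brk v w)" using linear_brk1 linear_conv_bounded_linear by blast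
  then obtain B where B: "B > 0" "\<And>v. norm (brk v w) \<le> norm v * B"
    using bounded_linear.pos_bounded by blast
  define u where "u = (\<lambda>s. N (\<gamma> s) w - w)"
  \<comment> \<open>The derivative of |u|^2 is at most 2 B |u|^2, so this weight makes h
    nonincreasing.\<close>
  define h where "h = (\<lambda>s. exp (- (2 * B * s)) * (u s \<bullet> u s))"
  have du: "(u has_vector_derivative brk (u s) w) (at s)" if "\<bar>s\<bar> < a" for s
  proof -
    have "brk (u s) w = brk (N (\<gamma> s) w) w - brk w w" unfolding u_def by (rule linear_diff[OF linear_brk1])
    then show ?thesis unfolding u_def using D[OF that, of w] by (auto intro!: derivative_eq_intros)
  qed
  have dh: "(h has_real_derivative exp (- (2 * B * s)) * (2 * (u s \<bullet> brk (u s) w) - 2 * B * (u s \<bullet> u s))) (at s)"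
    if "\<bar>s\<bar> < a" for s
  proof -
    have "((\<lambda>s. u s \<bullet> u s) has_vector_derivative 2 * (u s \<bullet> brk (u s) w)) (at s)"
      using bounded_bilinear.has_vector_derivative[OF bounded_bilinear_inner du[OF that] du[OF that]]
      by (simp add: inner_commute)
    then have d: "((\<lambda>s. u s \<bullet> u s) has_real_derivative 2 * (u s \<bullet> brk (u s) w)) (at s)"
      by (simp add: has_real_derivative_iff_has_vector_derivative)
    show ?thesis unfolding h_def
      by (rule derivative_eq_intros d refl | simp)+ (simp add: algebra_simps)
  qed
  have "h s \<le> h 0"
  proof (rule DERIV_nonpos_imp_nonincreasing[OF s(1)])
    fix r assume r: "0 \<le> r" "r \<le> s"
    have "u r \<bullet> brk (u r) w \<le> norm (u r) * (norm (u r) * B)"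
      using norm_cauchy_schwarz[of "u r" "brk (u r) w"] mult_left_mono[OF B(2)[of "u r"] norm_ge_zero[of "u r"]] by linarith
    also have "\<dots> = B * (u r \<bullet> u r)" by (simp add: dot_square_norm power2_eq_square)
    finally have "2 * (u r \<bullet> brk (u r) w) - 2 * B * (u r \<bullet> u r) \<le> 0" by simp
    then have "exp (- (2 * B * r)) * (2 * (u r \<bullet> brk (u r) w) - 2 * B * (u r \<bullet> u r)) \<le> 0"
      by (simp only: mult_le_0_iff) simp
    with dh[of r] r s show "\<exists>y. (h has_real_derivative y) (at r) \<and> y \<le> 0" by force
  qed
  moreover have "h 0 = 0" by (simp add: h_def u_def \<gamma>)
  ultimately have "exp (- (2 * B * s)) * (u s \<bullet> u s) \<le> 0" by (simp add: h_def)
  then have "u s \<bullet> u s \<le> 0" by (simp add: mult_le_0_iff)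
  then have "u s \<bullet> u s = 0" using inner_ge_zero[of "u s"] by linarith
  then have "u s = 0" by simp
  then show "N (\<gamma> s) w = w" by (simp add: u_def)
qed

text \<open>The determinant of Ad (h^-1): up to sign, the modular factor by which right translation
  by \<open>h\<close> scales left-invariant volume.\<close>

definition Jac :: "'g \<Rightarrow> real" where "Jac h = det (matrix (N h))"

lemma Jac_mul: "Jac (mul h k) = Jac h * Jac k"
proof -
  have "N (mul h k) = N k \<circ> N h" by (rule ext) (simp only: o_def N_mul)
  then show ?thesis unfolding Jac_def
    by (simp only: matrix_compose[OF linear_N linear_N] det_mul mult.commute)
qed

lemma Jac_unit: "Jac unit = 1"
proof -
  have "N unit = (\<lambda>v. v)" by (rule ext) (rule N_unit)
  then show ?thesis by (simp only: Jac_def matrix_id_mat_1[unfolded id_def] det_I)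
qed

text \<open>At the identity the determinant differentiates to the trace, and the derivative of N
  along \<gamma> at 0 is v -> [v, w] = - ad w (v), whence the minus sign. The determinant is
  expanded into its six products to differentiate entrywise.\<close>

lemma Jac_integral_curve:
  assumes a: "a > 0" and \<gamma>: "\<gamma> 0 = unit" "\<And>s. \<bar>s\<bar> < a \<Longrightarrow> md \<gamma> (\<lambda>r. r *\<^sub>R w) s"
  shows "((\<lambda>s. Jac (\<gamma> s)) has_real_derivative - tau w) (at 0)"
    and "\<bar>s\<bar> < a \<Longrightarrow> isCont (\<lambda>s. Jac (\<gamma> s)) s"
proof -
  have D: "((\<lambda>s. N (\<gamma> s) v $ i) has_real_derivative brk (N (\<gamma> s) v) w $ i) (at s)" if "\<bar>s\<bar> < a" for s v i
    using bounded_linear.has_vector_derivative[OF bounded_linear_vec_nth N_integral_curve(1)[OF a \<gamma> that]]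
    by (simp add: has_real_derivative_iff_has_vector_derivative)
  have J: "Jac h = N h (axis 1 1) $ 1 * N h (axis 2 1) $ 2 * N h (axis 3 1) $ 3 +
      N h (axis 2 1) $ 1 * N h (axis 3 1) $ 2 * N h (axis 1 1) $ 3 +
      N h (axis 3 1) $ 1 * N h (axis 1 1) $ 2 * N h (axis 2 1) $ 3 -
      N h (axis 1 1) $ 1 * N h (axis 3 1) $ 2 * N h (axis 2 1) $ 3 -
      N h (axis 2 1) $ 1 * N h (axis 1 1) $ 2 * N h (axis 3 1) $ 3 -
      N h (axis 3 1) $ 1 * N h (axis 2 1) $ 2 * N h (axis 1 1) $ 3" for h
    unfolding Jac_def det_3 matrix_def by simp
  have D0: "((\<lambda>s. N (\<gamma> s) v $ i) has_real_derivative brk v w $ i) (at 0)" for v i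
    using D[of 0 v i] a by (simp add: \<gamma>)
  have t: "tau w = - (brk (axis 1 1) w $ 1 + brk (axis 2 1) w $ 2 + brk (axis 3 1) w $ 3)"
    unfolding tau_def trace_def matrix_def by (simp add: sum_3 brk_commute[of w])
  show "((\<lambda>s. Jac (\<gamma> s)) has_real_derivative - tau w) (at 0)"
    unfolding J t
    by (rule DERIV_cong, rule DERIV_diff, rule DERIV_diff, rule DERIV_diff, rule DERIV_add, rule DERIV_add,
        (rule DERIV_mult3[OF D0 D0 D0])+) (simp add: \<gamma> axis_def)
  assume s: "\<bar>s\<bar> < a"
  have c: "isCont (\<lambda>s. N (\<gamma> s) v $ i) s" for v i by (rule DERIV_isCont[OF D[OF s]])
  show "isCont (\<lambda>s. Jac (\<gamma> s)) s"
    unfolding J by (rule isCont_diff isCont_add isCont_mult c)+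
qed

text \<open>\<open>Jac\<close> starts at 1 with slope \<open>- tau w\<close> > 0, so every small t >
  0 works and the short curve suffices.\<close>

lemma expanding_curve:
  assumes "tau w < 0"
  obtains t \<gamma> where "t > 0" "\<gamma> 0 = unit" "\<And>s. 0 \<le> s \<Longrightarrow> s \<le> t \<Longrightarrow> md \<gamma> (\<lambda>r. r *\<^sub>R w) s"
    "\<And>s. 0 \<le> s \<Longrightarrow> s \<le> t \<Longrightarrow> N (\<gamma> s) w = w" "continuous_on {0..t} (\<lambda>s. Jac (\<gamma> s))" "Jac (\<gamma> t) > 1"
proof -
  obtain a \<gamma> where a: "a > 0" and \<gamma>: "\<gamma> 0 = unit" "\<And>s. \<bar>s\<bar> < a \<Longrightarrow> md \<gamma> (\<lambda>r. r *\<^sub>R w) s"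
    using integral_curve[where w=w] by metis
  have "((\<lambda>s. Jac (\<gamma> s)) has_real_derivative - tau w) (at 0)" by (rule Jac_integral_curve(1)[OF a \<gamma>])
  then obtain d where d: "d > 0" "\<And>h. h > 0 \<Longrightarrow> h < d \<Longrightarrow> Jac (\<gamma> 0) < Jac (\<gamma> (0 + h))"
    using DERIV_pos_inc_right[of "\<lambda>s. Jac (\<gamma> s)" "- tau w" 0] assms by auto
  define t where "t = min a d / 2"
  have t: "0 < t" "t < a" "t < d" using a d by (auto simp: t_def min_def)
  show ?thesis
  proof (rule that[of t \<gamma>])
    show "Jac (\<gamma> t) > 1" using d(2)[of t] t by (simp add: \<gamma> Jac_unit)
    show "continuous_on {0..t} (\<lambda>s. Jac (\<gamma> s))"
      using Jac_integral_curve(2)[OF a \<gamma>] t by (intro continuous_at_imp_continuous_on) auto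
    show "md \<gamma> (\<lambda>r. r *\<^sub>R w) s" if "0 \<le> s" "s \<le> t" for s using \<gamma>(2)[of s] that t by auto
    show "N (\<gamma> s) w = w" if "0 \<le> s" "s \<le> t" for s
      using that t by (intro N_integral_curve(2)[OF a \<gamma>]) auto
  qed (use t \<gamma> in auto)
qed

end

section \<open>One-sided change of variables in Euclidean space\<close>

lemma borel_measurable_ennreal_indicator:
  fixes f :: "'a::euclidean_space \<Rightarrow> real"
  assumes "S \<in> sets borel" "continuous_on S f"
  shows "(\<lambda>x. ennreal (f x) * indicator S x) \<in> borel_measurable lborel"
proof -
  have "(\<lambda>x. indicator S x *\<^sub>R f x) \<in> borel_measurable borel"
    by (rule borel_measurable_continuous_on_indicator[OF assms])
  then have m: "(\<lambda>x. ennreal (indicator S x *\<^sub>R f x)) \<in> borel_measurable lborel" by simp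
  have eq: "(\<lambda>x. ennreal (f x) * indicator S x) = (\<lambda>x. ennreal (indicator S x *\<^sub>R f x))"
    by (rule ext) (simp split: split_indicator)
  show ?thesis unfolding eq by (rule m)
qed

text \<open>Only an upper bound is claimed, so overlaps in the image do no harm. If the integral is
  infinite the bound is trivial; otherwise the determinant is integrable on \<open>S\<close> and the
  volume estimate for differentiable images applies.\<close>

lemma emeasure_image_le:
  fixes G :: "real^'n::{finite,wellorder} \<Rightarrow> real^'n::_"
  assumes S: "S \<in> sets borel" and G: "\<And>x. x \<in> S \<Longrightarrow> (G has_derivative G' x) (at x)"
    and j: "continuous_on S (\<lambda>x. det (matrix (G' x)))"
  shows "G ` S \<in> sets lebesgue"
    and "emeasure lebesgue (G ` S) \<le> (\<integral>\<^sup>+x\<in>S. ennreal \<bar>det (matrix (G' x))\<bar> \<partial>lborel)"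
proof -
  let ?j = "\<lambda>x. \<bar>det (matrix (G' x))\<bar>"
  have SL: "S \<in> sets lebesgue" using S by simp
  have Gw: "(G has_derivative G' x) (at x within S)" if "x \<in> S" for x
    using G[OF that] by (rule has_derivative_at_withinI)
  have "G differentiable_on S" unfolding differentiable_on_def using Gw differentiableI by blast
  then show "G ` S \<in> sets lebesgue" by (intro differentiable_image_in_sets_lebesgue SL) auto
  let ?I = "\<integral>\<^sup>+x\<in>S. ennreal (?j x) \<partial>lborel"
  show "emeasure lebesgue (G ` S) \<le> ?I"
  proof (cases "?I = \<infinity>")
    case False
    then obtain r where r: "?I = ennreal r" "r \<ge> 0" by (cases ?I) auto
    have m: "(\<lambda>x. indicator S x *\<^sub>R ?j x) \<in> borel_measurable borel"
      using j by (intro borel_measurable_continuous_on_indicator S continuous_intros)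
    have "(\<integral>\<^sup>+x. ennreal (indicator S x *\<^sub>R ?j x) \<partial>lborel) = ennreal r"
      unfolding r(1)[symmetric] by (intro nn_integral_cong) (simp split: split_indicator)
    then have "((\<lambda>x. indicator S x *\<^sub>R ?j x) has_integral r) UNIV"
      using m r by (intro nn_integral_has_integral) auto
    moreover have "(\<lambda>x. indicator S x *\<^sub>R ?j x) = (\<lambda>x. if x \<in> S then ?j x else 0)" by auto
    ultimately have I: "(?j has_integral r) S" by (simp add: has_integral_restrict_UNIV)
    then have i: "?j integrable_on S" by blast
    have "G ` S \<in> lmeasurable" by (rule measurable_differentiable_image[OF SL Gw i])
    then have "emeasure lebesgue (G ` S) = ennreal (measure lebesgue (G ` S))"
      by (simp add: emeasure_eq_measure2)
    also have "\<dots> \<le> ennreal r"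
      using measure_differentiable_image[OF SL Gw i] integral_unique[OF I] by (intro ennreal_leI) simp
    finally show ?thesis by (simp add: r)
  qed simp
qed

text \<open>The image is merely Lebesgue measurable, so it is enlarged by a null set to a Borel set.
  The weight enters by comparing two measures, Lebesgue measure on that set and the push-forward of
  |det| on \<open>S\<close>: an inequality on Borel sets passes to integrals.\<close>

lemma weighted_image_le:
  fixes G :: "real^'n::{finite,wellorder} \<Rightarrow> real^'n::_"
  assumes S: "S \<in> sets borel" and G: "\<And>x. x \<in> S \<Longrightarrow> (G has_derivative G' x) (at x)"
    and j: "continuous_on S (\<lambda>x. det (matrix (G' x)))"
    and V: "open V" "G ` S \<subseteq> V" and r: "continuous_on V r" "\<And>x. x \<in> V \<Longrightarrow> 0 \<le> r x"
  obtains N where "N \<in> sets borel" "G ` S \<subseteq> N" "N \<subseteq> V"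
    "(\<integral>\<^sup>+x\<in>N. ennreal (r x) \<partial>lborel) \<le> (\<integral>\<^sup>+x\<in>S. ennreal (r (G x) * \<bar>det (matrix (G' x))\<bar>) \<partial>lborel)"
proof -
  let ?j = "\<lambda>x. \<bar>det (matrix (G' x))\<bar>"
  obtain N0 where N0: "G ` S \<subseteq> N0" "N0 \<in> sets lborel" "N0 - G ` S \<in> null_sets lebesgue"
    using Lebesgue_Measure.completion_upper[OF emeasure_image_le(1)[OF S G j]] by metis
  define N where "N = N0 \<inter> V"
  have N: "N \<in> sets borel" "G ` S \<subseteq> N" "N \<subseteq> V" using N0 V by (auto simp: N_def)
  have null: "N - G ` S \<in> null_sets lebesgue"
    by (rule null_sets_completion_subset[OF _ N0(3)]) (auto simp: N_def)
  \<comment> \<open>Extension by 0 makes the map Borel on the whole space; the value is harmless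
    because the density \<open>jt\<close> vanishes off \<open>S\<close>.\<close>
  define Gt where "Gt = (\<lambda>x. indicator S x *\<^sub>R G x)"
  have contG: "continuous_on S G"
    using G has_derivative_continuous continuous_at_imp_continuous_on by blast
  have Gt[measurable]: "Gt \<in> borel_measurable borel"
    unfolding Gt_def by (rule borel_measurable_continuous_on_indicator[OF S contG])
  define jt where "jt = (\<lambda>x. ennreal (indicator S x *\<^sub>R ?j x))"
  have [measurable]: "(\<lambda>x. indicator S x *\<^sub>R ?j x) \<in> borel_measurable borel"
    using j by (intro borel_measurable_continuous_on_indicator S continuous_intros)
  have jt[measurable]: "jt \<in> borel_measurable borel" unfolding jt_def by measurable
  have Nm[measurable]: "N \<in> sets borel" by (rule N)
  define \<mu>1 where "\<mu>1 = density lborel (indicator N)"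
  define \<mu>2 where "\<mu>2 = distr (density lborel jt) borel Gt"
  \<comment> \<open>Up to a null set, the points of N in U are images of the part of
    \<open>S\<close> that lands in U, to which \<open>emeasure_image_le\<close> applies.\<close>
  have le: "emeasure \<mu>1 U \<le> emeasure \<mu>2 U" if U: "U \<in> sets borel" for U
  proof -
    have [measurable]: "U \<in> sets borel" by (rule U)
    let ?S = "S \<inter> Gt -` U"
    have GU: "Gt -` U \<in> sets borel" by (rule measurable_sets_borel[OF Gt U])
    have SU: "?S \<in> sets borel" by (rule sets.Int[OF S GU])
    have jS: "continuous_on ?S (\<lambda>x. det (matrix (G' x)))" by (rule continuous_on_subset[OF j]) simp
    have GS: "(G has_derivative G' x) (at x)" if "x \<in> ?S" for x using that by (intro G) simp
    note im = emeasure_image_le[OF SU GS jS]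
    have nullE: "N - G ` S \<in> sets lebesgue" "emeasure lebesgue (N - G ` S) = 0"
      using null by (auto simp only: null_sets_def mem_Collect_eq)
    have "emeasure \<mu>1 U = emeasure lborel (N \<inter> U)"
      unfolding \<mu>1_def by (simp add: emeasure_density indicator_inter_arith[symmetric])
    also have "\<dots> = emeasure lebesgue (N \<inter> U)" by simp
    also have "\<dots> \<le> emeasure lebesgue (G ` ?S \<union> (N - G ` S))"
    proof (rule emeasure_mono)
      show "N \<inter> U \<subseteq> G ` ?S \<union> (N - G ` S)" by (auto simp: Gt_def)
      show "G ` ?S \<union> (N - G ` S) \<in> sets lebesgue"
        by (rule sets.Un[OF im(1) nullE(1)])
    qed
    also have "\<dots> \<le> emeasure lebesgue (G ` ?S) + emeasure lebesgue (N - G ` S)"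
      by (rule emeasure_subadditive[OF im(1) nullE(1)])
    also note nullE(2)
    also have "emeasure lebesgue (G ` ?S) + 0 \<le> (\<integral>\<^sup>+x\<in>?S. ennreal (?j x) \<partial>lborel)"
      using im(2) by simp
    also have "\<dots> = (\<integral>\<^sup>+x\<in>Gt -` U. jt x \<partial>lborel)"
      unfolding jt_def by (intro nn_integral_cong) (simp split: split_indicator)
    also have "\<dots> = emeasure \<mu>2 U"
      unfolding \<mu>2_def using GU by (simp add: emeasure_distr emeasure_density)
    finally show ?thesis .
  qed
  define \<rho> where "\<rho> = (\<lambda>x. ennreal (indicator V x *\<^sub>R r x))"
  have [measurable]: "(\<lambda>x. indicator V x *\<^sub>R r x) \<in> borel_measurable borel"
    using r V by (intro borel_measurable_continuous_on_indicator) auto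
  have \<rho>[measurable]: "\<rho> \<in> borel_measurable borel" unfolding \<rho>_def by measurable
  have s12: "sets \<mu>1 = sets \<mu>2" by (simp add: \<mu>1_def \<mu>2_def)
  have "\<mu>1 \<le> \<mu>2"
    unfolding le_measure_iff
  proof (simp add: s12 sets_eq_imp_space_eq[OF s12], rule le_funI)
    fix U
    show "emeasure \<mu>1 U \<le> emeasure \<mu>2 U"
    proof (cases "U \<in> sets \<mu>1")
      case True
      then show ?thesis by (intro le) (simp add: \<mu>1_def)
    qed (simp add: emeasure_notin_sets)
  qed
  then have m: "(\<integral>\<^sup>+x. \<rho> x \<partial>\<mu>1) \<le> (\<integral>\<^sup>+x. \<rho> x \<partial>\<mu>2)" by (rule nn_integral_mono_measure[OF s12])
  have "(\<integral>\<^sup>+x\<in>N. ennreal (r x) \<partial>lborel) = (\<integral>\<^sup>+x. indicator N x * \<rho> x \<partial>lborel)"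
    using N(3) unfolding \<rho>_def by (intro nn_integral_cong) (auto split: split_indicator)
  also have "\<dots> = (\<integral>\<^sup>+x. \<rho> x \<partial>\<mu>1)"
    unfolding \<mu>1_def by (subst nn_integral_density) auto
  also note m
  also have "(\<integral>\<^sup>+x. \<rho> x \<partial>\<mu>2) = (\<integral>\<^sup>+x. jt x * \<rho> (Gt x) \<partial>lborel)"
    unfolding \<mu>2_def by (subst nn_integral_distr) (auto simp: nn_integral_density)
  also have "\<dots> = (\<integral>\<^sup>+x\<in>S. ennreal (r (G x) * ?j x) \<partial>lborel)"
    unfolding jt_def \<rho>_def Gt_def using V r(2)
    by (intro nn_integral_cong) (auto split: split_indicator simp: ennreal_mult'' mult.commute)
  finally show ?thesis using that[OF N] by blast
qed

text \<open>Countable subadditivity of outer measure, phrased with measurable covers because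
  measurability of the images themselves is never established.\<close>

lemma outer_measure_UN:
  assumes "\<And>n::nat. \<exists>Q. Q \<in> sets M \<and> T n \<subseteq> Q \<and> emeasure M Q \<le> a n"
  obtains Q where "Q \<in> sets M" "(\<Union>n. T n) \<subseteq> Q" "emeasure M Q \<le> (\<Sum>n. a n)"
proof -
  have "\<exists>Q. \<forall>n. Q n \<in> sets M \<and> T n \<subseteq> Q n \<and> emeasure M (Q n) \<le> a n"
    by (rule choice) (intro allI assms)
  then obtain Q where Q: "\<And>n. Q n \<in> sets M" "\<And>n. T n \<subseteq> Q n" "\<And>n. emeasure M (Q n) \<le> a n"
    by blast
  have "emeasure M (\<Union>n. Q n) \<le> (\<Sum>n. emeasure M (Q n))"
    using Q(1) by (intro emeasure_subadditive_countably) auto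
  also have "\<dots> \<le> (\<Sum>n. a n)" using Q(3) by (intro suminf_le) auto
  finally have le: "emeasure M (\<Union>n. Q n) \<le> (\<Sum>n. a n)" .
  show ?thesis
  proof (rule that[OF _ _ le])
    show "(\<Union>n. Q n) \<in> sets M" using Q(1) by (intro sets.countable_UN) auto
    show "(\<Union>n. T n) \<subseteq> (\<Union>n. Q n)" by (rule UN_mono[OF subset_refl Q(2)])
  qed
qed

section \<open>Haar measure in charts\<close>

context lie_group3
begin

text \<open>\<open>Pm\<close> is a partial derivative of the multiplication in charts, evaluated at
  (x, x0), hence continuous in x.\<close>

lemma continuous_on_Pm:
  assumes c: "c \<in> A"
  shows "continuous_on (snd c ` fst c) (\<lambda>x. Pm c (chart_inv c x) \<eta>)"
proof -
  let ?f = "\<lambda>(x, y). snd c (mul (chart_inv c x) (Ki y))"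
  let ?O = "{(x, y). x \<in> snd c ` fst c \<and> y \<in> K ` fst e0 \<and> mul (chart_inv c x) (Ki y) \<in> fst c}"
  have f: "Ck_on 1 ?O ?f" using mult_smooth[OF c e0 c] by (simp add: smooth_on_def)
  have mem: "(x, x0) \<in> ?O" if "x \<in> snd c ` fst c" for x
    using that c by (auto simp: chart_inv_chart)
  have eq: "Pm c (chart_inv c x) \<eta> = frechet_derivative ?f (at (x, x0)) (0, \<eta>)"
    if x: "x \<in> snd c ` fst c" for x
  proof -
    have D: "(?f has_derivative frechet_derivative ?f (at (x, x0))) (at (x, x0))"
      by (rule Ck_on_has_derivative[OF f _ mem[OF x]]) simp
    have "((\<lambda>y. ?f (x, y)) has_derivative (\<lambda>\<eta>. frechet_derivative ?f (at (x, x0)) (0, \<eta>))) (at x0)"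
      by (rule has_derivative_compose[of "\<lambda>y. (x, y)", OF _ D]) (auto intro!: derivative_eq_intros)
    then have "((\<lambda>y. snd c (lam (chart_inv c x) y)) has_derivative
        (\<lambda>\<eta>. frechet_derivative ?f (at (x, x0)) (0, \<eta>))) (at x0)" by (simp add: lam_def)
    from has_derivative_unique[OF has_derivative_Pm[OF c chart_inv_mem[OF c x]] this]
    show ?thesis by (rule fun_cong)
  qed
  have "continuous_on ?O (\<lambda>z. frechet_derivative ?f (at z) (0, \<eta>))"
    using f unfolding Ck_on_1_iff by blast
  then have "continuous_on (snd c ` fst c) (\<lambda>x. frechet_derivative ?f (at (x, x0)) (0, \<eta>))"
    by (rule continuous_on_compose2[of _ _ _ "\<lambda>x. (x, x0)"])
      (use mem in \<open>auto intro!: continuous_intros\<close>)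
  then show ?thesis using eq by (simp cong: continuous_on_cong)
qed

text \<open>The Jacobian of left translation at the unit, read in the chart; the Haar density there
  is |vol0 / Pdet|.\<close>

definition Pdet :: "'g chart \<Rightarrow> real^3 \<Rightarrow> real" where
  "Pdet c x = det (matrix (Pm c (chart_inv c x)))"

lemma continuous_on_Pdet:
  assumes c: "c \<in> A"
  shows "continuous_on (snd c ` fst c) (Pdet c)"
  unfolding Pdet_def det_matrix3 det3_def by (intro continuous_intros continuous_on_Pm[OF c])

lemma det_Pinv:
  assumes c: "c \<in> A" "p \<in> fst c"
  shows "det (matrix (Pm c p)) * det (matrix (Pinv c p)) = 1"
proof -
  have "Pm c p \<circ> Pinv c p = (\<lambda>v. v)" by (rule ext) (simp only: o_def Pm_Pinv[OF c])
  then have "matrix (Pm c p \<circ> Pinv c p) = mat 1" by (simp only: matrix_id_mat_1[unfolded id_def])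
  then have "matrix (Pm c p) ** matrix (Pinv c p) = mat 1"
    by (simp only: matrix_compose[OF linear_Pinv[OF c] linear_Pm[OF c]])
  then show ?thesis by (metis det_mul det_I)
qed

lemma countable_charts:
  obtains c :: "nat \<Rightarrow> 'g chart" where "\<And>n. c n \<in> A" "(\<Union>n. fst (c n)) = UNIV"
proof -
  obtain F where F: "F \<subseteq> fst ` A" "countable F" "\<Union>F = \<Union>(fst ` A)"
    using Lindelof[of "fst ` A"] open_chart by (metis imageE)
  have U: "\<Union>F = UNIV" using F(3) chart_at by auto
  then have "F \<noteq> {}" by auto
  define h where "h = from_nat_into F"
  have h: "range h = F" unfolding h_def by (rule range_from_nat_into[OF \<open>F \<noteq> {}\<close> F(2)])
  then have "\<forall>n. \<exists>c\<in>A. h n = fst c" using F(1) by blast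
  then obtain c where c: "\<And>n. c n \<in> A" "\<And>n. h n = fst (c n)" by metis
  have "(\<Union>n. fst (c n)) = UNIV" using U h c(2) by (metis (mono_tags, lifting) SUP_cong)
  with c(1) that show ?thesis by blast
qed

text \<open>\<open>contact_haar\<close> evaluates \<mu> only inside a single chart. A Borel
  partition of the group into subsets of charts lets such values be added.\<close>

lemma disjoint_charts:
  obtains c :: "nat \<Rightarrow> 'g chart" and V where "\<And>n. c n \<in> A" "\<And>n. V n \<in> sets borel" "\<And>n. V n \<subseteq> fst (c n)"
    "disjoint_family V" "(\<Union>n. V n) = UNIV"
proof -
  obtain c :: "nat \<Rightarrow> 'g chart" where c: "\<And>n. c n \<in> A" and cov: "(\<Union>n. fst (c n)) = UNIV"
    by (rule countable_charts) blast
  define V where "V = disjointed (\<lambda>n. fst (c n))"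
  have "range V \<subseteq> sets borel"
    unfolding V_def by (rule sets.range_disjointed_sets) (use borel_open[OF open_chart[OF c]] in blast)
  then have "V n \<in> sets borel" for n by auto
  moreover have "V n \<subseteq> fst (c n)" for n unfolding V_def by (rule disjointed_subset)
  moreover have "disjoint_family V" unfolding V_def by (rule disjoint_family_disjointed)
  moreover have "(\<Union>n. V n) = UNIV" unfolding V_def UN_disjointed_eq by (rule cov)
  ultimately show ?thesis using that c by blast
qed

text \<open>The image equals a preimage under the inverse chart, which becomes a Borel function on
  all of R^3 when extended by the unit.\<close>

lemma chart_image_borel:
  assumes c: "c \<in> A" and B: "B \<in> sets borel" "B \<subseteq> fst c"
  shows "snd c ` B \<in> sets borel"
proof -
  let ?f = "\<lambda>x. if x \<in> snd c ` fst c then chart_inv c x else unit"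
  have U: "snd c ` fst c \<in> sets borel" by (rule borel_open[OF open_chart_image[OF c]])
  have "?f \<in> borel_measurable borel"
    by (rule borel_measurable_continuous_on_if[OF U continuous_on_chart_inv[OF c] continuous_on_const])
  then have "?f -` B \<in> sets borel" using B(1) by (rule measurable_sets_borel)
  then have "snd c ` fst c \<inter> ?f -` B \<in> sets borel" using U by (rule sets.Int[rotated])
  moreover have "snd c ` fst c \<inter> ?f -` B = snd c ` B"
    using B(2) by (auto simp: chart_inv_chart[OF c])
  ultimately show ?thesis by simp
qed

end

context contact_lie_group3
begin

lemma haar_chart:
  assumes \<mu>: "contact_haar A mul iv \<theta> \<mu>" and ch: "ch \<in> A" and B: "B \<in> sets borel" "B \<subseteq> fst ch"
  shows "emeasure \<mu> B = (\<integral>\<^sup>+ x \<in> snd ch ` B. ennreal \<bar>vol0 / Pdet ch x\<bar> \<partial>lborel)"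
proof -
  have "contact_volume A mul iv \<theta> (chart_inv ch x)
             (pushvec A (chart_inv ch) x (axis 1 1))
             (pushvec A (chart_inv ch) x (axis 2 1))
             (pushvec A (chart_inv ch) x (axis 3 1)) = vol0 / Pdet ch x"
    if x: "x \<in> snd ch ` B" for x
  proof -
    let ?p = "chart_inv ch x"
    have p: "?p \<in> fst ch" "snd ch ?p = x" using x B ch by (auto simp: chart_inv_chart)
    have "pushvec A (chart_inv ch) x v = tv ?p (Pinv ch ?p v)" for v
      using pushvec_eq_tv[OF md_chart_inv[OF ch p(1)]] by (simp add: p(2))
    then have "contact_volume A mul iv \<theta> (chart_inv ch x)
             (pushvec A (chart_inv ch) x (axis 1 1))
             (pushvec A (chart_inv ch) x (axis 2 1))
             (pushvec A (chart_inv ch) x (axis 3 1)) = vol0 * det (matrix (Pinv ch ?p))"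
      by (simp only: contact_volume_tv det_matrix3)
    also have "\<dots> = vol0 / Pdet ch x"
    proof -
      have h: "det (matrix (Pm ch ?p)) * det (matrix (Pinv ch ?p)) = 1" by (rule det_Pinv[OF ch p(1)])
      then have nz: "det (matrix (Pm ch ?p)) \<noteq> 0" by auto
      have "det (matrix (Pinv ch ?p)) = 1 / det (matrix (Pm ch ?p))"
        by (rule nonzero_eq_divide_eq[THEN iffD2, OF nz]) (simp only: mult.commute[of "det (matrix (Pinv ch ?p))"] h)
      then show ?thesis by (simp add: Pdet_def)
    qed
    finally show ?thesis .
  qed
  moreover have "emeasure \<mu> B = (\<integral>\<^sup>+ x \<in> snd ch ` B. ennreal \<bar>contact_volume A mul iv \<theta> (chart_inv ch x)
             (pushvec A (chart_inv ch) x (axis 1 1))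
             (pushvec A (chart_inv ch) x (axis 2 1))
             (pushvec A (chart_inv ch) x (axis 3 1))\<bar> \<partial>lborel)"
    using \<mu> ch B unfolding contact_haar_def by blast
  ultimately show ?thesis by (auto intro!: nn_integral_cong split: split_indicator)
qed

text \<open>In a chart the derivative of \<open>F\<close> is \<open>Pm\<close> after
  \<open>F'\<close> and the density is \<open>vol0 / Pdet\<close>; the determinant of
  \<open>Pm\<close> cancels. The local bounds thus share one chart-free integrand and add up over a
  partition of \<open>S\<close>.\<close>

lemma haar_image_le:
  fixes F :: "real^3 \<Rightarrow> 'g"
  assumes \<mu>: "contact_haar A mul iv \<theta> \<mu>" and S: "S \<in> sets borel"
    and F: "\<And>z. z \<in> S \<Longrightarrow> md F (F' z) z" and j: "continuous_on S (\<lambda>z. det (matrix (F' z)))"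
  obtains N where "N \<in> sets borel" "F ` S \<subseteq> N"
    "emeasure \<mu> N \<le> (\<integral>\<^sup>+z\<in>S. ennreal \<bar>vol0 * det (matrix (F' z))\<bar> \<partial>lborel)"
proof -
  let ?v = "\<lambda>z. ennreal \<bar>vol0 * det (matrix (F' z))\<bar>"
  have sets\<mu>: "sets \<mu> = sets borel" using \<mu> by (simp add: contact_haar_def)
  obtain c V where c: "\<And>n::nat. c n \<in> A" and V: "\<And>n. V n \<in> sets borel" "\<And>n. V n \<subseteq> fst (c n)"
    and Vdisj: "disjoint_family V" and Vcov: "(\<Union>n. V n) = UNIV"
    by (rule disjoint_charts) blast
  have contF: "continuous_on S F"
    using F unfolding md_def by (intro continuous_at_imp_continuous_on) blast
  \<comment> \<open>The constant extension makes preimages of Borel sets Borel in R^3, so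
    \<open>S\<close> can be cut according to the chart that contains the image.\<close>
  define Ft where "Ft = (\<lambda>z. if z \<in> S then F z else unit)"
  have Ft: "Ft \<in> borel_measurable borel"
    unfolding Ft_def by (intro borel_measurable_continuous_on_if S contF continuous_intros)
  define Sn where "Sn = (\<lambda>n. S \<inter> Ft -` V n)"
  have Sn: "Sn n \<in> sets borel" for n
    unfolding Sn_def using S measurable_sets[OF Ft V(1)[of n]] by simp
  have SnS: "Sn n \<subseteq> S" for n by (auto simp: Sn_def)
  have FSn: "F z \<in> fst (c n)" if "z \<in> Sn n" for z n
    using that V(2)[of n] by (auto simp: Sn_def Ft_def)
  let ?r = "\<lambda>n x. \<bar>vol0 / Pdet (c n) x\<bar>"
  let ?G' = "\<lambda>n z a. Pm (c n) (F z) (F' z a)"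
  have linF': "linear (F' z)" if "z \<in> S" for z
    using md_bounded_linear[OF F[OF that]] by (simp add: bounded_linear.linear)
  have detG: "det (matrix (?G' n z)) = det (matrix (Pm (c n) (F z))) * det (matrix (F' z))"
    if z: "z \<in> Sn n" for n z
  proof -
    have "matrix (Pm (c n) (F z) \<circ> F' z) = matrix (Pm (c n) (F z)) ** matrix (F' z)"
      using z SnS[of n] by (intro matrix_compose linF' linear_Pm[OF c FSn[OF z]]) auto
    then show ?thesis by (simp add: o_def det_mul)
  qed
  have Fn: "\<exists>N. N \<in> sets \<mu> \<and> F ` Sn n \<subseteq> N \<and>
      emeasure \<mu> N \<le> (\<integral>\<^sup>+z\<in>Sn n. ?v z \<partial>lborel)" for n
  proof -
    let ?c = "c n"
    let ?U = "snd ?c ` fst ?c"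
    have contn: "continuous_on (Sn n) F" using contF SnS by (rule continuous_on_subset)
    have contc: "continuous_on (Sn n) (\<lambda>z. snd ?c (F z))"
      by (rule continuous_on_compose2[OF continuous_on_chart[OF c] contn]) (use FSn in auto)
    have D: "((\<lambda>z. snd ?c (F z)) has_derivative ?G' n z) (at z)" if z: "z \<in> Sn n" for z
      using md_imp_chart_deriv[OF c FSn[OF z] F refl] z SnS[of n] by auto
    have "continuous_on (Sn n) (\<lambda>z. Pdet ?c (snd ?c (F z)))"
      by (rule continuous_on_compose2[OF continuous_on_Pdet[OF c] contc]) (use FSn in auto)
    then have "continuous_on (Sn n) (\<lambda>z. det (matrix (Pm ?c (F z))))"
      by (rule continuous_on_cong[THEN iffD1, rotated 2]) (simp_all add: chart_inv_chart c FSn Pdet_def)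
    then have "continuous_on (Sn n) (\<lambda>z. det (matrix (Pm ?c (F z))) * det (matrix (F' z)))"
      by (intro continuous_on_mult continuous_on_subset[OF j SnS])
    then have cj: "continuous_on (Sn n) (\<lambda>z. det (matrix (?G' n z)))"
      by (rule continuous_on_cong[THEN iffD1, rotated 2]) (simp_all add: detG)
    have nz: "Pdet ?c x \<noteq> 0" if "x \<in> ?U" for x
      using det_Pinv[OF c chart_inv_mem[OF c that]] by (auto simp: Pdet_def)
    have cr: "continuous_on ?U (?r n)"
      by (intro continuous_intros continuous_on_Pdet[OF c]) (use nz in auto)
    obtain N where N: "N \<in> sets borel" "(\<lambda>z. snd ?c (F z)) ` Sn n \<subseteq> N" "N \<subseteq> ?U"
      and le: "(\<integral>\<^sup>+x\<in>N. ennreal (?r n x) \<partial>lborel) \<le>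
        (\<integral>\<^sup>+z\<in>Sn n. ennreal (?r n (snd ?c (F z)) * \<bar>det (matrix (?G' n z))\<bar>) \<partial>lborel)"
    proof (rule weighted_image_le[OF Sn[of n] D cj open_chart_image[OF c] _ cr])
      show "(\<lambda>z. snd ?c (F z)) ` Sn n \<subseteq> ?U" using FSn by auto
    qed auto
    \<comment> \<open>\<open>N\<close> lies in the image of the chart, so pulling it back loses
      nothing and \<open>haar_chart\<close> evaluates B over exactly \<open>N\<close>.\<close>
    define B where "B = fst ?c \<inter> snd ?c -` N"
    have B: "B \<in> sets borel"
    proof -
      have "(\<lambda>q. if q \<in> fst ?c then snd ?c q else 0) -` N \<inter> space borel \<in> sets (borel :: 'g measure)"
        by (rule measurable_sets[OF _ N(1)], rule borel_measurable_continuous_on_if)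
          (use open_chart[OF c, of n] continuous_on_chart[OF c, of n] in auto)
      then have "fst ?c \<inter> ((\<lambda>q. if q \<in> fst ?c then snd ?c q else 0) -` N) \<in> sets borel"
        using open_chart[OF c, of n] by auto
      moreover have "fst ?c \<inter> ((\<lambda>q. if q \<in> fst ?c then snd ?c q else 0) -` N) = B" by (auto simp: B_def)
      ultimately show ?thesis by simp
    qed
    have img: "snd ?c ` B = N"
      using N(3) by (auto simp: B_def)
    have "F ` Sn n \<subseteq> B" using N(2) FSn by (auto simp: B_def)
    moreover have "emeasure \<mu> B \<le> (\<integral>\<^sup>+z\<in>Sn n. ?v z \<partial>lborel)"
    proof -
      have "emeasure \<mu> B = (\<integral>\<^sup>+x\<in>N. ennreal (?r n x) \<partial>lborel)"
        using haar_chart[OF \<mu> c B, of n] img by (simp add: B_def)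
      also note le
      also have "(\<integral>\<^sup>+z\<in>Sn n. ennreal (?r n (snd ?c (F z)) * \<bar>det (matrix (?G' n z))\<bar>) \<partial>lborel) =
         (\<integral>\<^sup>+z\<in>Sn n. ?v z \<partial>lborel)"
      proof (rule nn_integral_cong)
        fix z
        show "ennreal (?r n (snd ?c (F z)) * \<bar>det (matrix (?G' n z))\<bar>) * indicator (Sn n) z =
          ?v z * indicator (Sn n) z"
        proof (cases "z \<in> Sn n")
          case z: True
          have "det (matrix (Pm ?c (F z))) \<noteq> 0" using det_Pinv[OF c FSn[OF z]] by auto
          then have "?r n (snd ?c (F z)) * \<bar>det (matrix (?G' n z))\<bar> = \<bar>vol0 * det (matrix (F' z))\<bar>"
            unfolding detG[OF z] Pdet_def chart_inv_chart[OF c FSn[OF z]] by (simp add: abs_mult)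
          then show ?thesis by simp
        qed simp
      qed
      finally show ?thesis .
    qed
    ultimately show ?thesis using B unfolding sets\<mu> by blast
  qed
  have "Ft z \<in> (\<Union>n. V n)" for z by (simp add: Vcov)
  then have Scov: "S = (\<Union>n. Sn n)" unfolding Sn_def by blast
  have Sdisj: "disjoint_family Sn" using Vdisj unfolding disjoint_family_on_def Sn_def by blast
  obtain Q where Q: "Q \<in> sets \<mu>" "(\<Union>n. F ` Sn n) \<subseteq> Q"
    "emeasure \<mu> Q \<le> (\<Sum>n. \<integral>\<^sup>+z\<in>Sn n. ?v z \<partial>lborel)"
    by (rule outer_measure_UN[OF Fn])
  have "(\<Sum>n. \<integral>\<^sup>+z\<in>Sn n. ?v z \<partial>lborel) = (\<integral>\<^sup>+z. (\<Sum>n. ?v z * indicator (Sn n) z) \<partial>lborel)"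
  proof (rule nn_integral_suminf[symmetric])
    fix n
    show "(\<lambda>z. ?v z * indicator (Sn n) z) \<in> borel_measurable lborel"
      by (intro borel_measurable_ennreal_indicator Sn continuous_intros continuous_on_subset[OF j SnS])
  qed
  also have "\<dots> = (\<integral>\<^sup>+z\<in>S. ?v z \<partial>lborel)"
  proof (rule nn_integral_cong)
    fix z
    have "(\<Sum>n. indicator (Sn n) z) = (indicator S z :: ennreal)"
      using suminf_indicator[OF Sdisj, of z] by (simp add: Scov[symmetric])
    then show "(\<Sum>n. ?v z * indicator (Sn n) z) =
      ?v z * indicator S z" by (simp add: ennreal_suminf_cmult)
  qed
  finally have "emeasure \<mu> Q \<le> (\<integral>\<^sup>+z\<in>S. ?v z \<partial>lborel)" using Q(3) by simp
  moreover have "F ` S \<subseteq> Q" using Q(2) by (subst Scov) (simp only: image_UN)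
  ultimately show ?thesis using that Q(1) unfolding sets\<mu> by blast
qed

end

section \<open>Identification of R^3 with R^2 x R\<close>

definition pr2 :: "real^3 \<Rightarrow> real^2" where "pr2 z = (\<chi> i. if i = 1 then z$1 else z$2)"

lemma linear_pr2: "linear pr2"
  by (rule linearI) (simp_all add: pr2_def vec_eq_iff)

lemma continuous_on_pr2: "continuous_on S pr2"
  using linear_pr2 linear_continuous_on linear_conv_bounded_linear by blast

lemma pr2_axis: "pr2 (axis 1 1) = axis 1 1" "pr2 (axis 2 1) = axis 2 1" "pr2 (axis 3 1) = 0"
  by (simp_all add: pr2_def vec_eq_iff axis_def forall_2)

text \<open>A swept piece has a surface parameter and a time. Packing them into
  \<open>real^3\<close> makes its Jacobian an ordinary determinant; \<open>distr_emb3\<close> then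
  gives access to Tonelli's theorem.\<close>

definition emb3 :: "(real^2) \<times> real \<Rightarrow> real^3" where
  "emb3 p = (\<chi> i. if i = 1 then fst p $ 1 else if i = 2 then fst p $ 2 else snd p)"

lemma emb3_simps [simp]: "pr2 (emb3 p) = fst p" "emb3 p $ 3 = snd p"
  by (simp_all add: emb3_def pr2_def vec_eq_iff forall_2)

lemma measurable_emb3 [measurable]: "emb3 \<in> borel_measurable (lborel \<Otimes>\<^sub>M lborel)"
proof -
  have "continuous_on UNIV (\<lambda>p. emb3 p $ i)" for i
    unfolding emb3_def by (cases "i = 1"; cases "i = 2") (auto intro!: continuous_intros)
  then have "continuous_on UNIV (\<lambda>p. \<chi> i. emb3 p $ i)" by (rule continuous_on_vec_lambda)
  then have "emb3 \<in> borel_measurable borel" by (intro borel_measurable_continuous_onI) simp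
  then show ?thesis by (simp add: lborel_prod)
qed

lemma prod_Basis_vec: "(\<Prod>b\<in>Basis. v \<bullet> b) = (\<Prod>i\<in>UNIV. v $ i)" for v :: "real^'n::finite"
proof -
  have B: "(Basis :: (real^'n) set) = (\<lambda>i. axis i 1) ` UNIV" by (auto simp: Basis_vec_def)
  have "inj (\<lambda>i::'n. axis i (1::real))" by (auto simp: inj_on_def axis_eq_axis)
  then show ?thesis unfolding B by (subst prod.reindex) (auto simp: inner_axis)
qed

lemma distr_emb3: "distr (lborel \<Otimes>\<^sub>M lborel) borel emb3 = lborel"
proof (rule lborel_eqI[symmetric])
  let ?M = "lborel \<Otimes>\<^sub>M lborel :: ((real^2) \<times> real) measure"
  fix l u :: "real^3" assume le: "\<And>b. b \<in> Basis \<Longrightarrow> l \<bullet> b \<le> u \<bullet> b"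
  have le': "l $ i \<le> u $ i" for i
    using le[of "axis i 1"] by (simp add: inner_axis axis_in_Basis_iff)
  have pre: "emb3 -` box l u \<inter> space ?M = box (pr2 l) (pr2 u) \<times> box (l$3) (u$3)"
    by (auto simp: space_pair_measure mem_box_cart forall_3 forall_2 pr2_def emb3_def)
  have "emeasure (distr ?M borel emb3) (box l u) = emeasure ?M (emb3 -` box l u \<inter> space ?M)"
    by (rule emeasure_distr[OF measurable_emb3]) simp
  also have "\<dots> = emeasure lborel (box (pr2 l) (pr2 u)) * emeasure lborel (box (l$3) (u$3))"
    unfolding pre by (intro lborel.emeasure_pair_measure_Times) auto
  also have "emeasure lborel (box (pr2 l) (pr2 u)) = (\<Prod>b\<in>Basis. (pr2 u - pr2 l) \<bullet> b)"
  proof (rule emeasure_lborel_box)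
    fix b :: "real^2" assume "b \<in> Basis"
    then obtain i where "b = axis i 1" by (auto simp: Basis_vec_def)
    then show "pr2 l \<bullet> b \<le> pr2 u \<bullet> b" using le' by (simp add: inner_axis pr2_def)
  qed
  also have "(\<Prod>b\<in>Basis. (pr2 u - pr2 l) \<bullet> b) = (u$1 - l$1) * (u$2 - l$2)"
    unfolding prod_Basis_vec by (simp add: UNIV_2 pr2_def)
  also have "emeasure lborel (box (l$3) (u$3)) = ennreal (u$3 - l$3)"
    unfolding box_real by (rule emeasure_lborel_Ioo[OF le'])
  also have "ennreal ((u$1 - l$1) * (u$2 - l$2)) * ennreal (u$3 - l$3) =
      ennreal ((u$1 - l$1) * (u$2 - l$2) * (u$3 - l$3))"
    using le'[of 3] by (intro ennreal_mult''[symmetric]) simp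
  also have "(u$1 - l$1) * (u$2 - l$2) * (u$3 - l$3) = (\<Prod>b\<in>Basis. (u - l) \<bullet> b)"
    unfolding prod_Basis_vec UNIV_3 by (simp add: mult.assoc)
  finally show "emeasure (distr ?M borel emb3) (box l u) = ennreal (\<Prod>b\<in>Basis. (u - l) \<bullet> b)" .
qed simp

lemma nn_integral_real3:
  fixes f :: "real^2 \<Rightarrow> ennreal" and h :: "real \<Rightarrow> ennreal"
  assumes [measurable]: "f \<in> borel_measurable borel" "h \<in> borel_measurable borel"
  shows "(\<integral>\<^sup>+z. f (pr2 z) * h (z$3) \<partial>lborel) = (\<integral>\<^sup>+x. f x \<partial>lborel) * (\<integral>\<^sup>+s. h s \<partial>lborel)"
proof -
  have [measurable]: "pr2 \<in> borel_measurable borel"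
    by (rule borel_measurable_continuous_onI[OF continuous_on_pr2])
  have [measurable]: "(\<lambda>z::real^3. z $ 3) \<in> borel_measurable borel"
    by (intro borel_measurable_continuous_onI continuous_intros)
  have m: "(\<lambda>z. f (pr2 z) * h (z$3)) \<in> borel_measurable (distr (lborel \<Otimes>\<^sub>M lborel) borel emb3)"
    by simp
  have "(\<integral>\<^sup>+z. f (pr2 z) * h (z$3) \<partial>lborel) = (\<integral>\<^sup>+p. f (pr2 (emb3 p)) * h (emb3 p $ 3) \<partial>(lborel \<Otimes>\<^sub>M lborel))"
    using nn_integral_distr[OF measurable_emb3 m] by (simp only: distr_emb3)
  also have "\<dots> = (\<integral>\<^sup>+p. f (fst p) * h (snd p) \<partial>(lborel \<Otimes>\<^sub>M lborel))"
    by simp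
  also have "\<dots> = (\<integral>\<^sup>+x. (\<integral>\<^sup>+s. f x * h s \<partial>lborel) \<partial>lborel)"
    by (subst lborel.nn_integral_fst[symmetric]) auto
  also have "\<dots> = (\<integral>\<^sup>+x. f x \<partial>lborel) * (\<integral>\<^sup>+s. h s \<partial>lborel)"
    by (simp add: nn_integral_cmult nn_integral_multc)
  finally show ?thesis .
qed

context contact_lie_group3
begin

text \<open>Right translation has the trivialized differential \<open>N h\<close>, so its Jacobian
  with respect to \<mu> is the constant \<open>Jac h\<close>. Applying the bound to the inverse
  element gives the opposite estimate.\<close>

lemma haar_rtrans_le:
  assumes \<mu>: "contact_haar A mul iv \<theta> \<mu>" and \<Omega>: "\<Omega> \<in> sets borel"
  obtains N where "N \<in> sets borel" "(\<lambda>q. mul q h) ` \<Omega> \<subseteq> N" "emeasure \<mu> N \<le> ennreal \<bar>Jac h\<bar> * emeasure \<mu> \<Omega>"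
proof -
  have sets\<mu>: "sets \<mu> = sets borel" using \<mu> by (simp add: contact_haar_def)
  obtain c V where c: "\<And>n::nat. c n \<in> A" and V: "\<And>n. V n \<in> sets borel" "\<And>n. V n \<subseteq> fst (c n)"
    and Vdisj: "disjoint_family V" and Vcov: "(\<Union>n. V n) = UNIV"
    by (rule disjoint_charts) blast
  define Om where "Om = (\<lambda>n. \<Omega> \<inter> V n)"
  have Om: "Om n \<in> sets borel" "Om n \<subseteq> fst (c n)" for n
    unfolding Om_def using \<Omega> V by auto
  have ex: "\<exists>N. N \<in> sets \<mu> \<and> (\<lambda>q. mul q h) ` Om n \<subseteq> N \<and> emeasure \<mu> N \<le> ennreal \<bar>Jac h\<bar> * emeasure \<mu> (Om n)" for n
  proof -
    let ?c = "c n"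
    let ?S = "snd ?c ` Om n"
    have p: "chart_inv ?c x \<in> fst ?c" "snd ?c (chart_inv ?c x) = x" if "x \<in> ?S" for x
      using that Om(2)[of n] chart_inv_chart[OF c] by auto
    have S: "?S \<in> sets borel" by (rule chart_image_borel[OF c Om])
    have SU: "?S \<subseteq> snd ?c ` fst ?c" using Om(2)[of n] by auto
    have md: "md (\<lambda>x. mul (chart_inv ?c x) h) (\<lambda>a. N h (Pinv ?c (chart_inv ?c x) a)) x" if x: "x \<in> ?S" for x
      using md_rtrans[OF md_chart_inv[OF c p(1)[OF x]]] unfolding p(2)[OF x] .
    have nz: "Pdet ?c x \<noteq> 0" if x: "x \<in> ?S" for x
      using det_Pinv[OF c p(1)[OF x]] by (auto simp: Pdet_def)
    have det: "det (matrix (\<lambda>a. N h (Pinv ?c (chart_inv ?c x) a))) = Jac h / Pdet ?c x"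
      if x: "x \<in> ?S" for x
    proof -
      have "matrix (N h \<circ> Pinv ?c (chart_inv ?c x)) = matrix (N h) ** matrix (Pinv ?c (chart_inv ?c x))"
        by (rule matrix_compose[OF linear_Pinv[OF c p(1)[OF x]] linear_N])
      then have "det (matrix (\<lambda>a. N h (Pinv ?c (chart_inv ?c x) a))) = Jac h * det (matrix (Pinv ?c (chart_inv ?c x)))"
        by (simp add: o_def det_mul Jac_def)
      moreover have "det (matrix (Pinv ?c (chart_inv ?c x))) = 1 / Pdet ?c x"
        by (rule nonzero_eq_divide_eq[THEN iffD2, OF nz[OF x]])
          (simp only: mult.commute[of "det (matrix (Pinv _ _))"] Pdet_def det_Pinv[OF c p(1)[OF x]])
      ultimately show ?thesis by simp
    qed
    have "continuous_on ?S (\<lambda>x. Jac h / Pdet ?c x)"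
      by (intro continuous_intros continuous_on_subset[OF continuous_on_Pdet[OF c] SU]) (use nz in auto)
    then have "continuous_on ?S (\<lambda>x. det (matrix (\<lambda>a. N h (Pinv ?c (chart_inv ?c x) a))))"
      by (rule continuous_on_cong[THEN iffD1, rotated 2]) (simp_all only: det)
    from haar_image_le[OF \<mu> S md this] obtain N' where N': "N' \<in> sets borel"
      "(\<lambda>x. mul (chart_inv ?c x) h) ` ?S \<subseteq> N'"
      "emeasure \<mu> N' \<le> (\<integral>\<^sup>+x\<in>?S. ennreal \<bar>vol0 * det (matrix (\<lambda>a. N h (Pinv ?c (chart_inv ?c x) a)))\<bar> \<partial>lborel)"
      by blast
    have "(\<lambda>x. mul (chart_inv ?c x) h) ` ?S = (\<lambda>q. mul q h) ` Om n"
      using Om(2)[of n] chart_inv_chart[OF c] by (force simp: image_image)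
    moreover have "emeasure \<mu> N' \<le> ennreal \<bar>Jac h\<bar> * emeasure \<mu> (Om n)"
    proof -
      have m: "(\<lambda>x. ennreal \<bar>vol0 / Pdet ?c x\<bar> * indicator ?S x) \<in> borel_measurable lborel"
        by (intro borel_measurable_ennreal_indicator S continuous_intros
            continuous_on_subset[OF continuous_on_Pdet[OF c] SU]) (use nz in auto)
      have "(\<integral>\<^sup>+x\<in>?S. ennreal \<bar>vol0 * det (matrix (\<lambda>a. N h (Pinv ?c (chart_inv ?c x) a)))\<bar> \<partial>lborel) =
        (\<integral>\<^sup>+x. ennreal \<bar>Jac h\<bar> * (ennreal \<bar>vol0 / Pdet ?c x\<bar> * indicator ?S x) \<partial>lborel)"
      proof (rule nn_integral_cong)
        fix x
        show "ennreal \<bar>vol0 * det (matrix (\<lambda>a. N h (Pinv ?c (chart_inv ?c x) a)))\<bar> * indicator ?S x =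
          ennreal \<bar>Jac h\<bar> * (ennreal \<bar>vol0 / Pdet ?c x\<bar> * indicator ?S x)"
        proof (cases "x \<in> ?S")
          case True
          then show ?thesis
            by (simp add: det[OF True] abs_mult abs_divide ennreal_mult''[symmetric] mult.commute)
        qed simp
      qed
      also have "\<dots> = ennreal \<bar>Jac h\<bar> * emeasure \<mu> (Om n)"
        unfolding haar_chart[OF \<mu> c Om] by (rule nn_integral_cmult[OF m])
      finally show ?thesis using N'(3) by simp
    qed
    ultimately show ?thesis using N' unfolding sets\<mu> by metis
  qed
  have Ocov: "\<Omega> = (\<Union>n. Om n)" using Vcov unfolding Om_def by blast
  obtain Q where Q: "Q \<in> sets \<mu>" "(\<Union>n. (\<lambda>q. mul q h) ` Om n) \<subseteq> Q"
    "emeasure \<mu> Q \<le> (\<Sum>n. ennreal \<bar>Jac h\<bar> * emeasure \<mu> (Om n))"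
    by (rule outer_measure_UN[OF ex])
  note Q(3)
  also have "(\<Sum>n. ennreal \<bar>Jac h\<bar> * emeasure \<mu> (Om n)) = ennreal \<bar>Jac h\<bar> * (\<Sum>n. emeasure \<mu> (Om n))"
    by (rule ennreal_suminf_cmult)
  also have "(\<Sum>n. emeasure \<mu> (Om n)) = emeasure \<mu> (\<Union>n. Om n)"
  proof (rule suminf_emeasure)
    show "range Om \<subseteq> sets \<mu>" using Om(1) by (auto simp: sets\<mu>)
    show "disjoint_family Om" using Vdisj unfolding disjoint_family_on_def Om_def by blast
  qed
  finally have "emeasure \<mu> Q \<le> ennreal \<bar>Jac h\<bar> * emeasure \<mu> \<Omega>" by (simp only: Ocov[symmetric])
  moreover have "(\<lambda>q. mul q h) ` \<Omega> \<subseteq> Q" using Q(2) by (subst Ocov) (simp only: image_UN)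
  ultimately show ?thesis using that Q(1) unfolding sets\<mu> by blast
qed

end

section \<open>Flux through surface pieces and swept volume\<close>

context lie_group3
begin

text \<open>Where a trivialized differential exists, \<open>md_unique\<close> makes it the only
  possible choice.\<close>

definition Md :: "('e::real_normed_vector \<Rightarrow> 'g) \<Rightarrow> 'e \<Rightarrow> 'e \<Rightarrow> real^3" where
  "Md F z = (SOME F'. md F F' z)"

lemma md_Md: "md F F' z \<Longrightarrow> md F (Md F z) z"
  unfolding Md_def by (rule someI[of "\<lambda>F'. md F F' z"])

lemma regular_param_md:
  assumes \<sigma>: "regular_param A D \<sigma>" and x: "x \<in> D"
  shows "md \<sigma> (Md \<sigma> x) x"
    and "c \<in> A \<Longrightarrow> \<sigma> x \<in> fst c \<Longrightarrow> frechet_derivative (\<lambda>x. snd c (\<sigma> x)) (at x) a = Pm c (\<sigma> x) (Md \<sigma> x a)"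
proof -
  have D: "open D" "continuous_on D \<sigma>" using \<sigma> by (auto simp: regular_param_def)
  have cont: "isCont \<sigma> x" using D x continuous_on_eq_continuous_at by blast
  have C: "Ck_on 1 (D \<inter> \<sigma> -` fst c) (snd c \<circ> \<sigma>)" if "c \<in> A" for c
    using \<sigma> that unfolding regular_param_def by blast
  have d: "((\<lambda>x. snd c (\<sigma> x)) has_derivative frechet_derivative (\<lambda>x. snd c (\<sigma> x)) (at x)) (at x)"
    if c: "c \<in> A" "\<sigma> x \<in> fst c" for c
    by (rule Ck_on_has_derivative[OF C[OF c(1), unfolded o_def]]) (use x c in auto)
  show m: "md \<sigma> (Md \<sigma> x) x"
  proof -
    obtain c where c: "c \<in> A" "\<sigma> x \<in> fst c" using chart_at by blast
    show ?thesis by (rule md_Md[OF chart_deriv_imp_md[OF c cont refl d[OF c]]])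
  qed
  assume c: "c \<in> A" "\<sigma> x \<in> fst c"
  show "frechet_derivative (\<lambda>x. snd c (\<sigma> x)) (at x) a = Pm c (\<sigma> x) (Md \<sigma> x a)"
    using has_derivative_unique[OF d[OF c] md_imp_chart_deriv[OF c m refl]] by (rule fun_cong)
qed

text \<open>\<open>Md\<close> is the chart derivative of \<sigma> with \<open>Pm\<close> undone.
  Continuity of the inverse is avoided: by \<open>det3_linear\<close>, applying \<open>Pm\<close> to
  all three columns multiplies the determinant by that of \<open>Pm\<close>, which can be divided
  out.\<close>

lemma regular_param_det_continuous:
  assumes \<sigma>: "regular_param A D \<sigma>"
  shows "continuous_on D (\<lambda>x. det3 (Md \<sigma> x a) (Md \<sigma> x b) w)"
proof (rule continuous_at_imp_continuous_on, rule ballI)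
  fix x assume x: "x \<in> D"
  have D: "open D" "continuous_on D \<sigma>" using \<sigma> by (auto simp: regular_param_def)
  obtain c where c: "c \<in> A" "\<sigma> x \<in> fst c" using chart_at by blast
  let ?O = "D \<inter> \<sigma> -` fst c"
  have O: "open ?O" by (rule continuous_open_preimage[OF D(2,1) open_chart[OF c(1)]])
  have C: "Ck_on 1 ?O (\<lambda>x. snd c (\<sigma> x))"
    using \<sigma> c unfolding regular_param_def o_def by blast
  have cd: "continuous_on ?O (\<lambda>x. frechet_derivative (\<lambda>x. snd c (\<sigma> x)) (at x) a)" for a
    using C unfolding Ck_on_1_iff by blast
  have cc: "continuous_on ?O (\<lambda>x. snd c (\<sigma> x))" by (rule Ck_on_imp_continuous[OF C])
  have P: "continuous_on ?O (\<lambda>x. Pm c (\<sigma> x) v)" for v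
  proof -
    have "continuous_on ?O (\<lambda>x. Pm c (chart_inv c (snd c (\<sigma> x))) v)"
      by (rule continuous_on_compose2[OF continuous_on_Pm[OF c(1)] cc]) auto
    then show ?thesis
      by (rule continuous_on_cong[THEN iffD1, rotated 2]) (simp_all add: chart_inv_chart[OF c(1)])
  qed
  have nz: "det (matrix (Pm c (\<sigma> x))) \<noteq> 0" if "x \<in> ?O" for x
    using det_Pinv[OF c(1), of "\<sigma> x"] that by auto
  have "continuous_on ?O (\<lambda>x. det3 (frechet_derivative (\<lambda>x. snd c (\<sigma> x)) (at x) a)
      (frechet_derivative (\<lambda>x. snd c (\<sigma> x)) (at x) b) (Pm c (\<sigma> x) w) / det (matrix (Pm c (\<sigma> x))))"
    unfolding det_matrix3 det3_def
    by (intro continuous_intros cd P) (use nz in \<open>simp add: det_matrix3 det3_def\<close>)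
  then have "continuous_on ?O (\<lambda>x. det3 (Md \<sigma> x a) (Md \<sigma> x b) w)"
  proof (rule continuous_on_cong[THEN iffD1, rotated 2])
    fix x assume x: "x \<in> ?O"
    then have m: "\<sigma> x \<in> fst c" "x \<in> D" by auto
    show "det3 (frechet_derivative (\<lambda>x. snd c (\<sigma> x)) (at x) a) (frechet_derivative (\<lambda>x. snd c (\<sigma> x)) (at x) b)
        (Pm c (\<sigma> x) w) / det (matrix (Pm c (\<sigma> x))) = det3 (Md \<sigma> x a) (Md \<sigma> x b) w"
      unfolding regular_param_md(2)[OF \<sigma> m(2) c(1) m(1)] det3_linear[OF linear_Pm[OF c(1) m(1)]]
      using nz[OF x] by simp
  qed simp
  then show "isCont (\<lambda>x. det3 (Md \<sigma> x a) (Md \<sigma> x b) w) x"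
    using O x c by (simp add: continuous_on_eq_continuous_at)
qed

end

context contact_lie_group3
begin

text \<open>u vanishes along \<sigma>, so the coordinate tangent vectors lie in the kernel of du and
  \<open>hor_normal_bound\<close> compares the integrands pointwise. A sign change of w disappears
  in the absolute value.\<close>

lemma flux_le_piece_perimeter:
  assumes P: "is_piece A \<Sigma> (u, \<sigma>, B)" and X: "X = (\<lambda>p. tv p x)" and Y: "Y = (\<lambda>p. tv p y)"
    and w: "w = x \<or> w = y \<or> w = - x \<or> w = - y"
  shows "(\<integral>\<^sup>+ z \<in> B. ennreal \<bar>vol0 * det3 (Md \<sigma> z (axis 1 1)) (Md \<sigma> z (axis 2 1)) w\<bar> \<partial>lborel)
    \<le> piece_perimeter A mul iv \<theta> g X Y (u, \<sigma>, B)"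
proof -
  obtain W D where W: "defining_function A \<Sigma> W u" and \<sigma>: "regular_param A D \<sigma>"
    and im: "\<sigma> ` D \<subseteq> \<Sigma> \<inter> W" and B: "B \<subseteq> D"
    using P by (auto simp: is_piece_def)
  have D: "open D" using \<sigma> by (simp add: regular_param_def)
  have le: "\<bar>vol0 * det3 (Md \<sigma> z (axis 1 1)) (Md \<sigma> z (axis 2 1)) w\<bar> \<le>
     \<bar>contact_volume A mul iv \<theta> (\<sigma> z) (hor_normal g X Y u (\<sigma> z))
        (pushvec A \<sigma> z (axis 1 1)) (pushvec A \<sigma> z (axis 2 1))\<bar>" if z: "z \<in> B" for z
  proof -
    have zD: "z \<in> D" using z B by auto
    let ?p = "\<sigma> z"
    have p: "?p \<in> \<Sigma> \<inter> W" using im zD by auto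
    have u0: "u (\<sigma> y) = 0" if "y \<in> D" for y
      using im that W unfolding defining_function_def by blast
    have push: "pushvec A \<sigma> z a = tv ?p (Md \<sigma> z a)" for a
      by (rule pushvec_eq_tv[OF regular_param_md(1)[OF \<sigma> zD]])
    have "((\<lambda>y. u (\<sigma> y)) has_derivative (\<lambda>a. 0)) (at z)"
      by (rule has_derivative_transform_within_open[OF has_derivative_const[of 0] D zD]) (simp add: u0)
    then have "frechet_derivative (u \<circ> \<sigma>) (at z) = (\<lambda>a. 0)"
      unfolding o_def by (rule frechet_derivative_at[symmetric])
    then have t0: "tv ?p (Md \<sigma> z a) u = 0" for a
      unfolding push[symmetric] by (simp add: pushvec_def)
    obtain v where v: "v \<in> tangent_space A ?p" "v u \<noteq> 0"
      using W p unfolding defining_function_def by blast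
    then obtain \<xi> where \<xi>: "tv ?p \<xi> u \<noteq> 0" unfolding tangent_space_eq by blast
    obtain w' where w': "w' = x \<or> w' = y" "w = w' \<or> w = - w'" using w by blast
    have "\<bar>vol0 * det3 (Md \<sigma> z (axis 1 1)) (Md \<sigma> z (axis 2 1)) w\<bar> =
      \<bar>vol0 * det3 w' (Md \<sigma> z (axis 1 1)) (Md \<sigma> z (axis 2 1))\<bar>"
      unfolding det3_rotate[of "Md \<sigma> z (axis 1 1)"] using w'(2) by auto
    also have "\<dots> \<le> \<bar>contact_volume A mul iv \<theta> ?p (hor_normal g X Y u ?p)
        (tv ?p (Md \<sigma> z (axis 1 1))) (tv ?p (Md \<sigma> z (axis 2 1)))\<bar>"
      by (rule hor_normal_bound[OF X Y w'(1) t0 t0 \<xi>])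
    finally show ?thesis by (simp only: push)
  qed
  show ?thesis unfolding piece_perimeter_def prod.case
    by (rule nn_integral_mono) (use le in \<open>auto split: split_indicator intro: ennreal_leI\<close>)
qed

text \<open>By \<open>md_mul\<close> the columns of the differential of \<sigma>(x) \<gamma>(s) are
  N(\<gamma>(s)) of the two tangent vectors, and w. Since w = N(\<gamma>(s)) w, the common factor
  comes out as \<open>Jac (\<gamma> s)\<close> and the rest is the flux density of w. Bounding the
  factor by m and integrating over time gives m t times the flux.\<close>

lemma swept_piece:
  assumes \<mu>: "contact_haar A mul iv \<theta> \<mu>"
    and P: "is_piece A \<Sigma> (u, \<sigma>, B)" and X: "X = (\<lambda>p. tv p x)" and Y: "Y = (\<lambda>p. tv p y)"
    and w: "w = x \<or> w = y \<or> w = - x \<or> w = - y"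
    and t: "t > 0" and \<gamma>: "\<And>s. 0 \<le> s \<Longrightarrow> s \<le> t \<Longrightarrow> md \<gamma> (\<lambda>r. r *\<^sub>R w) s"
    and Nw: "\<And>s. 0 \<le> s \<Longrightarrow> s \<le> t \<Longrightarrow> N (\<gamma> s) w = w"
    and J: "continuous_on {0..t} (\<lambda>s. Jac (\<gamma> s))" "\<And>s. 0 \<le> s \<Longrightarrow> s \<le> t \<Longrightarrow> \<bar>Jac (\<gamma> s)\<bar> \<le> m"
  obtains Q where "Q \<in> sets borel" "(\<lambda>(p, s). mul p (\<gamma> s)) ` (\<sigma> ` B \<times> {0..t}) \<subseteq> Q"
    "emeasure \<mu> Q \<le> ennreal (m * t) * piece_perimeter A mul iv \<theta> g X Y (u, \<sigma>, B)"
proof -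
  obtain D where \<sigma>: "regular_param A D \<sigma>" and B: "B \<in> sets borel" "B \<subseteq> D"
    using P by (auto simp: is_piece_def)
  let ?k = "\<lambda>z. det3 (Md \<sigma> z (axis 1 1)) (Md \<sigma> z (axis 2 1)) w"
  define S where "S = pr2 -` B \<inter> {z. z $ 3 \<in> {0..t}}"
  define F where "F = (\<lambda>z::real^3. mul (\<sigma> (pr2 z)) (\<gamma> (z $ 3)))"
  define F' where "F' = (\<lambda>(z::real^3) a. N (\<gamma> (z $ 3)) (Md \<sigma> (pr2 z) (pr2 a)) + (a $ 3) *\<^sub>R w)"
  have pr2m: "pr2 \<in> borel_measurable borel"
    by (rule borel_measurable_continuous_onI[OF continuous_on_pr2])
  have z3m: "(\<lambda>z::real^3. z $ 3) \<in> borel_measurable borel"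
    by (intro borel_measurable_continuous_onI continuous_intros)
  have "(\<lambda>z::real^3. z $ 3) -` {0..t} \<in> sets borel" by (rule measurable_sets_borel[OF z3m]) simp
  then have S: "S \<in> sets borel"
    unfolding S_def vimage_def[of "\<lambda>z. z $ 3"] by (intro sets.Int measurable_sets_borel[OF pr2m B(1)])
  have SD: "pr2 z \<in> B" "pr2 z \<in> D" "0 \<le> z $ 3" "z $ 3 \<le> t" if "z \<in> S" for z
    using that B by (auto simp: S_def)
  have md: "md F (F' z) z" if z: "z \<in> S" for z
  proof -
    have "(pr2 has_derivative pr2) (at z)"
      using linear_pr2 linear_conv_bounded_linear bounded_linear_imp_has_derivative by blast
    then have 1: "md (\<lambda>z. \<sigma> (pr2 z)) (\<lambda>a. Md \<sigma> (pr2 z) (pr2 a)) z"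
      by (rule md_compose[where F=\<sigma> and f=pr2, OF regular_param_md(1)[OF \<sigma> SD(2)[OF z]]])
    have "((\<lambda>z::real^3. z $ 3) has_derivative (\<lambda>a. a $ 3)) (at z)"
      by (rule bounded_linear_imp_has_derivative[OF bounded_linear_vec_nth])
    then have 2: "md (\<lambda>z. \<gamma> (z $ 3)) (\<lambda>a. (a $ 3) *\<^sub>R w) z"
      by (rule md_compose[where F=\<gamma> and f="\<lambda>z. z $ 3", OF \<gamma>[OF SD(3,4)[OF z]]])
    show ?thesis unfolding F_def F'_def by (rule md_mul[OF 1 2])
  qed
  have det: "det (matrix (F' z)) = Jac (\<gamma> (z $ 3)) * ?k (pr2 z)" if z: "z \<in> S" for z
  proof -
    have "linear (Md \<sigma> (pr2 z))"
      using md_bounded_linear[OF regular_param_md(1)[OF \<sigma> SD(2)[OF z]]] by (rule bounded_linear.linear)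
    then have "Md \<sigma> (pr2 z) 0 = 0" by (rule linear_0)
    moreover have ax: "axis 1 (1::real) $ (3::3) = 0" "axis 2 (1::real) $ (3::3) = 0" "axis 3 (1::real) $ (3::3) = 1"
      by (simp_all add: axis_def)
    ultimately have "F' z (axis 1 1) = N (\<gamma> (z $ 3)) (Md \<sigma> (pr2 z) (axis 1 1))"
      "F' z (axis 2 1) = N (\<gamma> (z $ 3)) (Md \<sigma> (pr2 z) (axis 2 1))"
      "F' z (axis 3 1) = N (\<gamma> (z $ 3)) w"
      by (simp_all add: F'_def pr2_axis ax linear_0[OF linear_N] Nw[OF SD(3,4)[OF z]])
    then have "det (matrix (F' z)) = det3 (N (\<gamma> (z $ 3)) (Md \<sigma> (pr2 z) (axis 1 1)))
        (N (\<gamma> (z $ 3)) (Md \<sigma> (pr2 z) (axis 2 1))) (N (\<gamma> (z $ 3)) w)"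
      by (simp only: det_matrix3)
    then show ?thesis by (simp only: det3_linear[OF linear_N] Jac_def)
  qed
  have kB: "continuous_on B ?k"
    by (rule continuous_on_subset[OF regular_param_det_continuous[OF \<sigma>] B(2)])
  have "continuous_on S (\<lambda>z. Jac (\<gamma> (z $ 3)) * ?k (pr2 z))"
  proof (rule continuous_on_mult)
    show "continuous_on S (\<lambda>z. Jac (\<gamma> (z $ 3)))"
      by (rule continuous_on_compose2[OF J(1), of S "\<lambda>z. z $ 3"]) (use SD in \<open>auto intro!: continuous_intros\<close>)
    show "continuous_on S (\<lambda>z. ?k (pr2 z))"
      by (rule continuous_on_compose2[OF kB continuous_on_pr2]) (use SD in auto)
  qed
  then have j: "continuous_on S (\<lambda>z. det (matrix (F' z)))"
    by (rule continuous_on_cong[THEN iffD1, rotated 2]) (simp_all only: det)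
  from haar_image_le[OF \<mu> S md j] obtain Q where Q: "Q \<in> sets borel" "F ` S \<subseteq> Q"
    "emeasure \<mu> Q \<le> (\<integral>\<^sup>+z\<in>S. ennreal \<bar>vol0 * det (matrix (F' z))\<bar> \<partial>lborel)" by blast
  have m: "m \<ge> 0" using J(2)[of 0] t by simp
  let ?f = "\<lambda>x. ennreal \<bar>vol0 * ?k x\<bar> * indicator B x" and ?h = "\<lambda>s. ennreal m * indicator {0..t} s"
  have "(\<integral>\<^sup>+z\<in>S. ennreal \<bar>vol0 * det (matrix (F' z))\<bar> \<partial>lborel) \<le> (\<integral>\<^sup>+z. ?f (pr2 z) * ?h (z $ 3) \<partial>lborel)"
  proof (rule nn_integral_mono)
    fix z :: "real^3"
    show "ennreal \<bar>vol0 * det (matrix (F' z))\<bar> * indicator S z \<le> ?f (pr2 z) * ?h (z $ 3)"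
    proof (cases "z \<in> S")
      case z: True
      have "\<bar>vol0 * det (matrix (F' z))\<bar> = \<bar>vol0 * ?k (pr2 z)\<bar> * \<bar>Jac (\<gamma> (z $ 3))\<bar>"
        by (simp add: det[OF z] abs_mult)
      also have "\<dots> \<le> \<bar>vol0 * ?k (pr2 z)\<bar> * m"
        by (rule mult_left_mono[OF J(2)[OF SD(3,4)[OF z]]]) simp
      finally have "ennreal \<bar>vol0 * det (matrix (F' z))\<bar> \<le> ennreal \<bar>vol0 * ?k (pr2 z)\<bar> * ennreal m"
        using m by (subst ennreal_mult''[symmetric]) (auto intro: ennreal_leI)
      then show ?thesis using z SD[OF z] by simp
    qed simp
  qed
  also have "\<dots> = (\<integral>\<^sup>+x. ?f x \<partial>lborel) * (\<integral>\<^sup>+s. ?h s \<partial>lborel)"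
  proof (rule nn_integral_real3)
    have "?f \<in> borel_measurable lborel"
      by (rule borel_measurable_ennreal_indicator[OF B(1)]) (intro continuous_intros kB)
    then show "?f \<in> borel_measurable borel" by simp
  qed simp
  also have "(\<integral>\<^sup>+s. ?h s \<partial>lborel) = ennreal (m * t)"
    using t m by (simp add: nn_integral_cmult ennreal_mult)
  also have "(\<integral>\<^sup>+x. ?f x \<partial>lborel) * ennreal (m * t) \<le>
      piece_perimeter A mul iv \<theta> g X Y (u, \<sigma>, B) * ennreal (m * t)"
    by (rule mult_right_mono[OF flux_le_piece_perimeter[OF P X Y w]]) simp
  finally have le: "emeasure \<mu> Q \<le> ennreal (m * t) * piece_perimeter A mul iv \<theta> g X Y (u, \<sigma>, B)"
    using Q(3) by (simp add: mult.commute)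
  have "mul p (\<gamma> s) \<in> Q" if p: "p \<in> \<sigma> ` B" and s: "0 \<le> s" "s \<le> t" for p s
  proof -
    obtain x where x: "x \<in> B" "p = \<sigma> x" using p by blast
    have "emb3 (x, s) \<in> S" using x s by (simp add: S_def)
    moreover have "F (emb3 (x, s)) = mul p (\<gamma> s)" by (simp add: F_def x)
    ultimately show ?thesis using Q(2) by (metis imageI subsetD)
  qed
  then have "(\<lambda>(p, s). mul p (\<gamma> s)) ` (\<sigma> ` B \<times> {0..t}) \<subseteq> Q" by auto
  then show ?thesis using that Q(1) le by blast
qed

end

section \<open>Local parametrization of surfaces and covering by pieces\<close>

lemma hyperplane_param:
  fixes a :: "real^3"
  assumes "a \<noteq> 0"
  obtains j :: "real^2 \<Rightarrow> real^3" where "linear j" "inj j" "range j = {x. a \<bullet> x = 0}"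
proof -
  have d: "dim (UNIV :: (real^2) set) = dim {x. a \<bullet> x = 0}"
    using assms by (simp add: dim_hyperplane)
  obtain j :: "real^2 \<Rightarrow> real^3" where "linear j" "j ` UNIV = {x. a \<bullet> x = 0}" "inj_on j UNIV"
    using subspace_isomorphism[OF subspace_UNIV subspace_hyperplane d] by blast
  then show ?thesis using that by blast
qed

text \<open>The straightening map \<open>x \<mapsto> x + (f x - a \<bullet> x) a / |a|\<^sup>2\<close> has identity derivative at \<open>p\<close> when
  \<open>a\<close> is the gradient of \<open>f\<close> there, and it maps the zero set of \<open>f\<close> into the hyperplane
  orthogonal to \<open>a\<close>.\<close>

lemma straighten_level_set:
  fixes f :: "real^3 \<Rightarrow> real"
  assumes V: "open V" "p \<in> V" and f: "Ck_on 1 V f" and nz: "frechet_derivative f (at p) v0 \<noteq> 0"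
  obtains \<Phi> :: "real^3 \<Rightarrow> real^3" and g a U U' where "a \<noteq> 0" "open U" "U \<subseteq> V" "p \<in> U" "open U'" "homeomorphism U U' \<Phi> g"
    "\<forall>x\<in>U. a \<bullet> \<Phi> x = f x" "\<forall>x\<in>U. \<Phi> differentiable (at x)" "Ck_on 1 U' g"
proof -
  let ?D = "\<lambda>x. frechet_derivative f (at x)"
  have D: "(f has_derivative ?D x) (at x)" if "x \<in> V" for x
    by (rule Ck_on_has_derivative[OF f _ that]) simp
  have lin: "linear (?D x)" if "x \<in> V" for x using D[OF that] has_derivative_linear by blast
  have cD: "continuous_on V (\<lambda>x. ?D x v)" for v using f unfolding Ck_on_1_iff by blast
  define a where "a = (\<chi> i. ?D p (axis i 1))"
  have a: "?D p v = a \<bullet> v" for v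
    using linear_real3[OF lin[OF V(2)], of v] by (simp add: a_def inner_vec_def sum_3 mult.commute)
  have a0: "a \<noteq> 0"
  proof
    assume "a = 0"
    then have "?D p v0 = 0" using a[of v0] by (simp only: inner_zero_left)
    then show False using nz by contradiction
  qed
  then have aa: "a \<bullet> a \<noteq> 0" by simp
  define \<Phi> where "\<Phi> = (\<lambda>x. x + ((f x - a \<bullet> x) / (a \<bullet> a)) *\<^sub>R a)"
  define \<Phi>' where "\<Phi>' = (\<lambda>x v. v + ((?D x v - a \<bullet> v) / (a \<bullet> a)) *\<^sub>R a)"
  have a\<Phi>: "a \<bullet> \<Phi> x = f x" for x
    using aa by (simp add: \<Phi>_def inner_add_right)
  have d\<Phi>: "(\<Phi> has_derivative \<Phi>' x) (at x)" if "x \<in> V" for x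
    unfolding \<Phi>_def \<Phi>'_def
    by (rule has_derivative_eq_rhs) (auto intro!: derivative_eq_intros D[OF that] simp: a0)
  have bl: "bounded_linear (\<Phi>' x)" if "x \<in> V" for x
    using d\<Phi>[OF that] by (rule has_derivative_bounded_linear)
  have app: "blinfun_apply (Blinfun (\<Phi>' x)) = \<Phi>' x" if "x \<in> V" for x
    by (rule bounded_linear_Blinfun_apply[OF bl[OF that]])
  have der: "(\<Phi> has_derivative blinfun_apply (Blinfun (\<Phi>' x))) (at x)" if "x \<in> V" for x
    using d\<Phi>[OF that] by (simp only: app[OF that])
  have cont: "continuous_on V (\<lambda>x. Blinfun (\<Phi>' x))"
  proof (rule continuous_on_blinfun_componentwise)
    fix i :: "real^3"
    have "continuous_on V (\<lambda>x. \<Phi>' x i)"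
      unfolding \<Phi>'_def by (intro continuous_intros cD) (use aa in auto)
    then show "continuous_on V (\<lambda>x. blinfun_apply (Blinfun (\<Phi>' x)) i)"
      by (rule continuous_on_cong[THEN iffD1, rotated 2]) (simp_all only: app)
  qed
  \<comment> \<open>a represents the derivative of f at p, so the correction term has derivative 0
    there.\<close>
  have id: "id_blinfun o\<^sub>L Blinfun (\<Phi>' p) = id_blinfun"
  proof (rule blinfun_eqI)
    fix v
    have "blinfun_apply (Blinfun (\<Phi>' p)) v = v" unfolding app[OF V(2)] by (simp add: \<Phi>'_def a)
    then show "blinfun_apply (id_blinfun o\<^sub>L Blinfun (\<Phi>' p)) v = blinfun_apply id_blinfun v"
      by (simp only: blinfun_apply_blinfun_compose blinfun_apply_id_blinfun)
  qed
  obtain U U' g g' where U: "open U" "U \<subseteq> V" "p \<in> U" "open U'" "\<Phi> p \<in> U'" "homeomorphism U U' \<Phi> g"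
    and dg: "\<And>y. y \<in> U' \<Longrightarrow> (g has_derivative (g' y)) (at y)"
    and g': "\<And>y. y \<in> U' \<Longrightarrow> g' y = inv (blinfun_apply (Blinfun (\<Phi>' (g y))))"
    and bij: "\<And>y. y \<in> U' \<Longrightarrow> bij (blinfun_apply (Blinfun (\<Phi>' (g y))))"
  proof (rule inverse_function_theorem[OF V(1) der cont V(2) id])
    fix U U' g g'
    assume "open U" "U \<subseteq> V" "p \<in> U" "open U'" "\<Phi> p \<in> U'" "homeomorphism U U' \<Phi> g"
      "\<And>y. y \<in> U' \<Longrightarrow> (g has_derivative (g' y)) (at y)"
      "\<And>y. y \<in> U' \<Longrightarrow> g' y = inv (blinfun_apply (Blinfun (\<Phi>' (g y))))"
      "\<And>y. y \<in> U' \<Longrightarrow> bij (blinfun_apply (Blinfun (\<Phi>' (g y))))"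
    from that[OF this] show thesis .
  qed
  have gV: "g y \<in> V" if "y \<in> U'" for y
    using that U(2,6) by (auto simp: homeomorphism_def)
  have cg: "continuous_on U' g" using U(6) by (simp add: homeomorphism_def)
  \<comment> \<open>The derivative of \<Phi> multiplies the direction a by
    \<open>?D (g y) a / (a \<bullet> a)\<close>; being bijective, it cannot annihilate a.\<close>
  have Da: "?D (g y) a \<noteq> 0" if y: "y \<in> U'" for y
  proof
    assume "?D (g y) a = 0"
    then have "\<Phi>' (g y) a = 0" using aa by (simp add: \<Phi>'_def)
    moreover have "\<Phi>' (g y) 0 = 0" using linear_0[OF lin[OF gV[OF y]]] by (simp add: \<Phi>'_def)
    ultimately have "a = 0"
      using bij[OF y] unfolding app[OF gV[OF y]] by (metis bij_is_inj injD)
    then show False using a0 by simp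
  qed
  \<comment> \<open>The inverse of a rank-one perturbation of the identity in closed form, from
    which continuity of \<open>g'\<close> can be read off.\<close>
  have g'_eq: "g' y w = w - ((?D (g y) w - a \<bullet> w) / ?D (g y) a) *\<^sub>R a" if y: "y \<in> U'" for y w
  proof -
    let ?l = "?D (g y)" let ?s = "(?l w - a \<bullet> w) / ?l a"
    have l: "linear ?l" by (rule lin[OF gV[OF y]])
    have "?l (w - ?s *\<^sub>R a) - a \<bullet> (w - ?s *\<^sub>R a) = ?s * (a \<bullet> a)"
      using Da[OF y] by (simp add: linear_diff[OF l] linear_scale[OF l] inner_diff_right field_simps)
    then have "\<Phi>' (g y) (w - ?s *\<^sub>R a) = w" unfolding \<Phi>'_def using aa by simp
    then show ?thesis
      unfolding g'[OF y] app[OF gV[OF y]]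
      using bij[OF y] unfolding app[OF gV[OF y]] by (metis bij_is_inj inv_f_f)
  qed
  have "Ck_on 1 U' g"
  proof (rule Ck_on_1_I[OF dg])
    fix w
    have "continuous_on U' (\<lambda>y. ?D (g y) v)" for v
      by (rule continuous_on_compose2[OF cD cg]) (use gV in auto)
    then have "continuous_on U' (\<lambda>y. w - ((?D (g y) w - a \<bullet> w) / ?D (g y) a) *\<^sub>R a)"
      by (intro continuous_intros) (use Da in auto)
    then show "continuous_on U' (\<lambda>y. g' y w)"
      by (rule continuous_on_cong[THEN iffD1, rotated 2]) (simp_all only: g'_eq)
  qed
  moreover have "\<Phi> differentiable (at x)" if "x \<in> U" for x
    using d\<Phi> that U(2) differentiableI by blast
  ultimately show ?thesis using that[OF a0 U(1,2,3,4,6)] a\<Phi> by simp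
qed

context lie_group3
begin

lemma smooth_transition:
  assumes "c \<in> A" "d \<in> A"
  shows "Ck_on k (snd c ` (fst c \<inter> fst d)) (\<lambda>x. snd d (chart_inv c x))"
  using atlas assms unfolding smooth_atlas_def smooth_on_def o_def by blast

lemma surface_param:
  assumes u: "defining_function A \<Sigma> W u" and p: "p \<in> \<Sigma> \<inter> W"
  obtains D \<sigma> G where "regular_param A D \<sigma>" "\<sigma> ` D \<subseteq> \<Sigma> \<inter> W" "open G" "p \<in> G" "\<sigma> ` D = \<Sigma> \<inter> G"
proof -
  have W: "open W" and uC: "Ck_fun_on A 1 W u" and \<Sigma>W: "\<Sigma> \<inter> W = {q \<in> W. u q = 0}"
    using u by (auto simp: defining_function_def)
  obtain c where c: "c \<in> A" "p \<in> fst c" using chart_at by blast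
  define V where "V = snd c ` (fst c \<inter> W)"
  define f where "f = (\<lambda>x. u (chart_inv c x))"
  have V: "open V" "snd c p \<in> V"
    using open_chart_image_Int[OF c(1) W] c p by (auto simp: V_def)
  have f: "Ck_on 1 V f" using uC c unfolding Ck_fun_on_def V_def f_def o_def by blast
  obtain v where v: "v \<in> tangent_space A p" "v u \<noteq> 0" using u p unfolding defining_function_def by blast
  then obtain \<xi> where \<xi>: "tv p \<xi> u \<noteq> 0" unfolding tangent_space_eq by blast
  have "tv p \<xi> = pushvec A (chart_inv c) (snd c p) (Pm c p \<xi>)"
    using pushvec_eq_tv[OF md_chart_inv[OF c]] Pinv_Pm[OF c] chart_inv_chart[OF c] by simp
  then have "frechet_derivative f (at (snd c p)) (Pm c p \<xi>) \<noteq> 0"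
    using \<xi> by (auto simp: pushvec_def f_def o_def split: if_splits)
  then obtain \<Phi> :: "real^3 \<Rightarrow> real^3" and g a U U' where a: "a \<noteq> 0"
    and U: "open U" "U \<subseteq> V" "snd c p \<in> U" "open U'" "homeomorphism U U' \<Phi> g"
    and a\<Phi>': "\<forall>x\<in>U. a \<bullet> \<Phi> x = f x" and d\<Phi>': "\<forall>x\<in>U. \<Phi> differentiable (at x)"
    and g: "Ck_on 1 U' g" by (rule straighten_level_set[OF V f])
  note a\<Phi> = bspec[OF a\<Phi>'] and d\<Phi> = bspec[OF d\<Phi>']
  have hom: "\<And>x. x \<in> U \<Longrightarrow> \<Phi> x \<in> U'" "\<And>x. x \<in> U \<Longrightarrow> g (\<Phi> x) = x" "\<And>y. y \<in> U' \<Longrightarrow> g y \<in> U"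
    "\<And>y. y \<in> U' \<Longrightarrow> \<Phi> (g y) = y" using U(5) by (auto simp: homeomorphism_def)
  obtain j :: "real^2 \<Rightarrow> real^3" where j: "linear j" "inj j" "range j = {x. a \<bullet> x = 0}"
    by (rule hyperplane_param[OF a])
  have bj: "bounded_linear j" using j(1) linear_conv_bounded_linear by blast
  define D where "D = j -` U'"
  define \<sigma> where "\<sigma> = (\<lambda>y. chart_inv c (g (j y)))"
  have D: "open D" unfolding D_def
    by (rule open_vimage[OF U(4) linear_continuous_on[OF bj]])
  have UV: "x \<in> snd c ` fst c" "chart_inv c x \<in> fst c" "chart_inv c x \<in> W" if "x \<in> U" for x
    using that U(2) chart_inv_chart[OF c(1)] unfolding V_def by auto
  have gD: "g (j y) \<in> U" if "y \<in> D" for y using that hom(3) by (auto simp: D_def)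
  have \<sigma>D: "\<sigma> y \<in> fst c" "\<sigma> y \<in> W" "snd c (\<sigma> y) = g (j y)" if "y \<in> D" for y
    using UV[OF gD[OF that]] chart_chart_inv[OF c(1)] by (auto simp: \<sigma>_def)
  define G where "G = fst c \<inter> snd c -` U"
  have G: "open G" unfolding G_def
    by (rule continuous_open_preimage[OF continuous_on_chart[OF c(1)] open_chart[OF c(1)] U(1)])
  have GW: "q \<in> W" "f (snd c q) = u q" if "q \<in> G" for q
    using that UV(3)[of "snd c q"] chart_inv_chart[OF c(1), of q] by (auto simp: G_def f_def)
  have img: "\<sigma> ` D = \<Sigma> \<inter> G"
  proof (intro equalityI subsetI)
    fix q assume "q \<in> \<sigma> ` D"
    then obtain y where y: "y \<in> D" "q = \<sigma> y" by blast
    have qG: "q \<in> G" using \<sigma>D[OF y(1)] gD[OF y(1)] by (simp add: y G_def)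
    have "f (g (j y)) = a \<bullet> \<Phi> (g (j y))" using a\<Phi>[OF gD[OF y(1)]] by simp
    also have "\<dots> = a \<bullet> j y" using y(1) hom(4) by (simp add: D_def)
    also have "\<dots> = 0" using j(3) by blast
    finally have "u q = 0" using GW(2)[OF qG] \<sigma>D(3)[OF y(1)] y by simp
    then show "q \<in> \<Sigma> \<inter> G" using GW(1)[OF qG] \<Sigma>W qG by blast
  next
    fix q assume q: "q \<in> \<Sigma> \<inter> G"
    then have qU: "snd c q \<in> U" "q \<in> fst c" by (auto simp: G_def)
    have "u q = 0" using q GW(1)[of q] \<Sigma>W by blast
    then have "a \<bullet> \<Phi> (snd c q) = 0" using GW(2)[of q] q a\<Phi>[OF qU(1)] by simp
    then obtain y where y: "\<Phi> (snd c q) = j y" using j(3) by blast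
    then have "y \<in> D" using hom(1)[OF qU(1)] by (simp add: D_def)
    moreover have "\<sigma> y = q"
      using hom(2)[OF qU(1)] chart_inv_chart[OF c(1) qU(2)] by (simp add: \<sigma>_def flip: y)
    ultimately show "q \<in> \<sigma> ` D" by blast
  qed
  have h: "Ck_on 1 D (\<lambda>y. g (j y))"
    by (rule Ck_on_compose[OF D U(4) _ g Ck_on_linear[OF bj]]) (auto simp: D_def)
  have cont: "continuous_on D \<sigma>"
    unfolding \<sigma>_def
    by (rule continuous_on_compose2[OF continuous_on_chart_inv[OF c(1)] Ck_on_imp_continuous[OF h]])
      (use gD UV(1) in blast)
  have reg: "regular_param A D \<sigma>"
    unfolding regular_param_def
  proof (intro conjI ballI)
    show "open D" by (rule D)
    show "continuous_on D \<sigma>" by (rule cont)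
    show "inj_on \<sigma> D"
    proof (rule inj_onI)
      fix y z assume y: "y \<in> D" and z: "z \<in> D" and eq: "\<sigma> y = \<sigma> z"
      have "g (j y) = g (j z)" using \<sigma>D(3)[OF y] \<sigma>D(3)[OF z] by (simp only: eq)
      then have "\<Phi> (g (j y)) = \<Phi> (g (j z))" by (rule arg_cong)
      moreover have "j y \<in> U'" "j z \<in> U'" using y z by (simp_all add: D_def)
      ultimately have "j y = j z" by (simp only: hom(4))
      then show "y = z" using j(2) by (simp add: inj_eq)
    qed
    fix d assume d: "d \<in> A"
    let ?O = "D \<inter> \<sigma> -` fst d"
    have O: "open ?O" by (rule continuous_open_preimage[OF cont D open_chart[OF d]])
    have T: "open (snd c ` (fst c \<inter> fst d))" by (rule open_chart_image_Int[OF c(1) open_chart[OF d]])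
    have mem: "g (j y) \<in> snd c ` (fst c \<inter> fst d)" if "y \<in> ?O" for y
      using that \<sigma>D[of y] by (metis IntE IntI image_eqI vimageE)
    have "Ck_on 1 ?O (\<lambda>y. snd d (chart_inv c (g (j y))))"
      by (rule Ck_on_compose[OF O T _ smooth_transition[OF c(1) d] Ck_on_subset[OF h]]) (use mem in auto)
    then show C: "Ck_on 1 ?O (snd d \<circ> \<sigma>)" by (simp add: \<sigma>_def o_def)
    fix y assume y: "y \<in> ?O"
    then have yD: "y \<in> D" and yd: "\<sigma> y \<in> fst d" by auto
    let ?L = "frechet_derivative (snd d \<circ> \<sigma>) (at y)"
    have L: "((\<lambda>y. snd d (\<sigma> y)) has_derivative ?L) (at y)"
      using Ck_on_has_derivative[OF C _ y] by (simp add: o_def)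
    let ?R = "\<lambda>x. snd c (chart_inv d x)"
    have "snd d (\<sigma> y) \<in> snd d ` (fst d \<inter> fst c)" using yd \<sigma>D(1)[OF yD] by blast
    then have R: "(?R has_derivative frechet_derivative ?R (at (snd d (\<sigma> y)))) (at (snd d (\<sigma> y)))"
      by (intro Ck_on_has_derivative[OF smooth_transition[OF d c(1), of 1]]) auto
    have Ry: "?R (snd d (\<sigma> y)) = g (j y)" if "y \<in> ?O" for y
      using that \<sigma>D(3) chart_inv_chart[OF d] by auto
    obtain P where P: "(\<Phi> has_derivative P) (at (g (j y)))"
      using d\<Phi>[OF gD[OF yD]] unfolding differentiable_def by blast
    \<comment> \<open>Near y, the injective linear map j is \<Phi> after a chart transition after
      \<sigma> in the chart d. Its derivative factors through \<open>?L\<close>, so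
      \<open>?L\<close> is injective.\<close>
    have "((\<lambda>y. \<Phi> (?R (snd d (\<sigma> y)))) has_derivative
        (\<lambda>v. P (frechet_derivative ?R (at (snd d (\<sigma> y))) (?L v)))) (at y)"
      by (rule has_derivative_compose[OF has_derivative_compose[OF L R]]) (use P Ry[OF y] in simp)
    then have "(j has_derivative (\<lambda>v. P (frechet_derivative ?R (at (snd d (\<sigma> y))) (?L v)))) (at y)"
    proof (rule has_derivative_transform_within_open[OF _ O y])
      fix z assume z: "z \<in> ?O"
      show "\<Phi> (?R (snd d (\<sigma> z))) = j z" unfolding Ry[OF z] using z hom(4) by (auto simp: D_def)
    qed
    then have "(\<lambda>v. P (frechet_derivative ?R (at (snd d (\<sigma> y))) (?L v))) = j"
      by (rule has_derivative_unique[OF _ bounded_linear_imp_has_derivative[OF bj]])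
    then have jv: "j v = P (frechet_derivative ?R (at (snd d (\<sigma> y))) (?L v))" for v by metis
    show "inj ?L"
    proof (rule injI)
      fix v w assume "?L v = ?L w"
      then have "j v = j w" by (simp only: jv)
      then show "v = w" using j(2) by (simp add: inj_eq)
    qed
  qed
  show ?thesis
  proof (rule that[OF reg _ G _ img])
    show "\<sigma> ` D \<subseteq> \<Sigma> \<inter> W" using img GW(1) by blast
    show "p \<in> G" using c U(3) by (simp add: G_def)
  qed
qed

text \<open>Lindelof's theorem selects countably many of the parametrized patches; disjointness is
  then achieved in the parameter domains, where Borel sets are allowed.\<close>

lemma piece_cover:
  assumes \<Sigma>: "C1_surface A \<Sigma>"
  obtains P :: "nat \<Rightarrow> 'g piece" where "\<And>i. is_piece A \<Sigma> (P i)" "disjoint_family (\<lambda>i. piece_set (P i))"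
    "\<Sigma> \<subseteq> (\<Union>i. piece_set (P i))"
proof (cases "\<Sigma> = {}")
  case True
  \<comment> \<open>Pieces are indexed by all natural numbers, so the empty surface needs legal ones
    as well; with empty domains every clause is vacuous.\<close>
  let ?P = "\<lambda>i::nat. ((\<lambda>_. 0, \<lambda>_. unit, {}) :: 'g piece)"
  have "is_piece A \<Sigma> (?P i)" for i
    unfolding is_piece_def prod.case
  proof (intro exI[of _ "{}"] conjI)
    show "defining_function A \<Sigma> {} (\<lambda>_. 0)"
      unfolding defining_function_def Ck_fun_on_def Ck_on_1_iff by simp
    show "regular_param A {} (\<lambda>_. unit)"
      unfolding regular_param_def Ck_on_1_iff by simp
  qed auto
  then show ?thesis using that[of ?P] True by (simp add: piece_set_def disjoint_family_on_def)
next
  case False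
  have "\<forall>p\<in>\<Sigma>. \<exists>x. (\<lambda>(u, W, D, \<sigma>, G). defining_function A \<Sigma> W u \<and> regular_param A D \<sigma> \<and>
      \<sigma> ` D \<subseteq> \<Sigma> \<inter> W \<and> open G \<and> p \<in> G \<and> \<sigma> ` D = \<Sigma> \<inter> G) x"
  proof
    fix p assume p: "p \<in> \<Sigma>"
    then obtain W u where u: "p \<in> W" "defining_function A \<Sigma> W u" using \<Sigma> unfolding C1_surface_def by blast
    obtain D \<sigma> G where "regular_param A D \<sigma>" "\<sigma> ` D \<subseteq> \<Sigma> \<inter> W" "open G" "p \<in> G" "\<sigma> ` D = \<Sigma> \<inter> G"
      by (rule surface_param[OF u(2) IntI[OF p u(1)]])
    with u(2) show "\<exists>x. (\<lambda>(u, W, D, \<sigma>, G). defining_function A \<Sigma> W u \<and> regular_param A D \<sigma> \<and>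
      \<sigma> ` D \<subseteq> \<Sigma> \<inter> W \<and> open G \<and> p \<in> G \<and> \<sigma> ` D = \<Sigma> \<inter> G) x"
      by (intro exI[of _ "(u, W, D, \<sigma>, G)"]) simp
  qed
  from bchoice[OF this] obtain X where "\<forall>p\<in>\<Sigma>. (\<lambda>(u, W, D, \<sigma>, G). defining_function A \<Sigma> W u \<and>
      regular_param A D \<sigma> \<and> \<sigma> ` D \<subseteq> \<Sigma> \<inter> W \<and> open G \<and> p \<in> G \<and> \<sigma> ` D = \<Sigma> \<inter> G) (X p)" by (rule exE)
  note X = bspec[OF this]
  define uu where "uu = (\<lambda>p. fst (X p))"
  define WW where "WW = (\<lambda>p. fst (snd (X p)))"
  define DD where "DD = (\<lambda>p. fst (snd (snd (X p))))"
  define ss where "ss = (\<lambda>p. fst (snd (snd (snd (X p)))))"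
  define GG where "GG = (\<lambda>p. snd (snd (snd (snd (X p)))))"
  have X': "defining_function A \<Sigma> (WW p) (uu p)" "regular_param A (DD p) (ss p)"
    "ss p ` DD p \<subseteq> \<Sigma> \<inter> WW p" "open (GG p)" "p \<in> GG p" "ss p ` DD p = \<Sigma> \<inter> GG p" if "p \<in> \<Sigma>" for p
    using X[OF that] unfolding uu_def WW_def DD_def ss_def GG_def case_prod_beta by blast+
  obtain F where F: "F \<subseteq> GG ` \<Sigma>" "countable F" "\<Union>F = \<Union>(GG ` \<Sigma>)"
    by (rule Lindelof[of "GG ` \<Sigma>"]) (use X'(4) in blast)+
  obtain S where S: "countable S" "S \<subseteq> \<Sigma>" "F = GG ` S"
    using F(1,2) by (metis countable_subset_image)
  have cov: "\<Sigma> \<subseteq> (\<Union>p\<in>S. GG p)" using F(3) S(3) X'(5) by blast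
  then have "S \<noteq> {}" using False by auto
  define e where "e = from_nat_into S"
  have e: "range e = S" unfolding e_def by (rule range_from_nat_into[OF \<open>S \<noteq> {}\<close> S(1)])
  then have e\<Sigma>: "e i \<in> \<Sigma>" for i using S(2) by blast
  \<comment> \<open>Parameters landing in an earlier patch are removed. They form an open set, so B
    i is Borel, and piece i avoids all earlier patches.\<close>
  define B where "B = (\<lambda>i. DD (e i) - (DD (e i) \<inter> ss (e i) -` (\<Union>k<i. GG (e k))))"
  define P where "P = (\<lambda>i. (uu (e i), ss (e i), B i))"
  have piece: "is_piece A \<Sigma> (P i)" for i
  proof -
    note X'' = X'[OF e\<Sigma>[of i]]
    have D: "open (DD (e i))" "continuous_on (DD (e i)) (ss (e i))"
      using X''(2) by (auto simp: regular_param_def)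
    have "open (\<Union>k<i. GG (e k))" using X'(4)[OF e\<Sigma>] by blast
    then have "open (DD (e i) \<inter> ss (e i) -` (\<Union>k<i. GG (e k)))"
      by (rule continuous_open_preimage[OF D(2,1)])
    then have "B i \<in> sets borel" unfolding B_def using D(1) by (intro sets.Diff borel_open)
    moreover have "B i \<subseteq> DD (e i)" by (auto simp: B_def)
    ultimately show ?thesis unfolding is_piece_def P_def prod.case using X'' by blast
  qed
  have ps: "piece_set (P i) = ss (e i) ` B i" for i by (simp add: piece_set_def P_def)
  have sub: "piece_set (P i) \<subseteq> GG (e i) - (\<Union>k<i. GG (e k))" for i
  proof -
    have "ss (e i) ` B i \<subseteq> ss (e i) ` DD (e i) - (\<Union>k<i. GG (e k))" by (auto simp: B_def)
    then show ?thesis using X'(6)[OF e\<Sigma>[of i]] unfolding ps by blast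
  qed
  have "disjoint_family (\<lambda>i. piece_set (P i))"
    unfolding disjoint_family_on_def
  proof (intro ballI impI)
    fix i k :: nat assume "i \<noteq> k"
    then consider "i < k" | "k < i" by linarith
    then show "piece_set (P i) \<inter> piece_set (P k) = {}"
      using sub[of i] sub[of k] by cases blast+
  qed
  moreover have "\<Sigma> \<subseteq> (\<Union>i. piece_set (P i))"
  proof
    fix q assume q: "q \<in> \<Sigma>"
    then have "\<exists>i. q \<in> GG (e i)" using cov e by blast
    then obtain i where i: "q \<in> GG (e i)" and least: "\<And>k. k < i \<Longrightarrow> q \<notin> GG (e k)"
      using exists_least_iff[of "\<lambda>i. q \<in> GG (e i)"] by blast
    have "q \<in> ss (e i) ` DD (e i)" using X'(6)[OF e\<Sigma>[of i]] q i by blast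
    then obtain y where y: "y \<in> DD (e i)" "q = ss (e i) y" by blast
    then have "y \<in> B i" using least by (auto simp: B_def)
    then have "q \<in> piece_set (P i)" using y by (simp add: ps)
    then show "q \<in> (\<Union>i. piece_set (P i))" by blast
  qed
  ultimately show ?thesis using that piece by blast
qed

\<comment> \<open>Sweeping the boundary and the isoperimetric inequality\<close>
end

context contact_lie_group3
begin

text \<open>The path s -> q \<gamma>(s)^-1 runs from q, outside \<Omega>, to a point of \<Omega> at
  time t. Being connected, it meets the frontier, at some p = q \<gamma>(s)^-1.\<close>

lemma swept_by_boundary:
  fixes t :: real
  assumes \<gamma>: "continuous_on {0..t} \<gamma>" "\<gamma> 0 = unit" and t: "t \<ge> 0"
    and q: "q \<in> (\<lambda>p. mul p (\<gamma> t)) ` \<Omega> - \<Omega>"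
  shows "\<exists>p\<in>frontier \<Omega>. \<exists>s. 0 \<le> s \<and> s \<le> t \<and> q = mul p (\<gamma> s)"
proof -
  let ?c = "\<lambda>s. mul q (iv (\<gamma> s))"
  have "continuous_on {0..t} ?c" by (intro continuous_on_mul continuous_on_iv \<gamma> continuous_on_const)
  then have conn: "connected (?c ` {0..t})" by (intro connected_continuous_image connected_Icc)
  have "iv unit = unit" by (rule inverse_neutral)
  then have "?c 0 = q" by (simp add: \<gamma>)
  then have out: "?c ` {0..t} - \<Omega> \<noteq> {}" using q t by force
  obtain p where p: "p \<in> \<Omega>" "q = mul p (\<gamma> t)" using q by blast
  then have "?c t = p" by simp
  then have "?c ` {0..t} \<inter> \<Omega> \<noteq> {}" using p t by force
  from connected_Int_frontier[OF conn this out]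
  obtain s where s: "s \<in> {0..t}" "?c s \<in> frontier \<Omega>" by blast
  then show ?thesis by (intro bexI[OF _ s(2)] exI[of _ s]) simp
qed

lemma isoperimetric_of_curve:
  assumes \<mu>: "contact_haar A mul iv \<theta> \<mu>" and X: "X = (\<lambda>p. tv p x)" and Y: "Y = (\<lambda>p. tv p y)"
    and w: "w = x \<or> w = y \<or> w = - x \<or> w = - y"
    and t: "t > 0" and \<gamma>0: "\<gamma> 0 = unit" and \<gamma>: "\<And>s. 0 \<le> s \<Longrightarrow> s \<le> t \<Longrightarrow> md \<gamma> (\<lambda>r. r *\<^sub>R w) s"
    and Nw: "\<And>s. 0 \<le> s \<Longrightarrow> s \<le> t \<Longrightarrow> N (\<gamma> s) w = w"
    and J: "continuous_on {0..t} (\<lambda>s. Jac (\<gamma> s))" "\<And>s. 0 \<le> s \<Longrightarrow> s \<le> t \<Longrightarrow> \<bar>Jac (\<gamma> s)\<bar> \<le> m"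
    and J1: "Jac (\<gamma> t) > 1"
    and \<Omega>: "open \<Omega>" "emeasure \<mu> \<Omega> < \<infinity>" "C1_surface A (frontier \<Omega>)"
  shows "emeasure \<mu> \<Omega> \<le> ennreal (m * t / (Jac (\<gamma> t) - 1)) * perimeter A mul iv \<theta> g X Y (frontier \<Omega>)"
proof -
  let ?h = "\<gamma> t" let ?Per = "perimeter A mul iv \<theta> g X Y (frontier \<Omega>)"
  let ?pp = "piece_perimeter A mul iv \<theta> g X Y"
  have sets\<mu>: "sets \<mu> = sets borel" using \<mu> by (simp add: contact_haar_def)
  obtain P where P: "\<And>i. is_piece A (frontier \<Omega>) (P i)" "disjoint_family (\<lambda>i. piece_set (P i))"
    "frontier \<Omega> \<subseteq> (\<Union>i::nat. piece_set (P i))"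
    using piece_cover[OF \<Omega>(3)] by metis
  let ?T = "\<lambda>i. (\<lambda>(p, s). mul p (\<gamma> s)) ` (piece_set (P i) \<times> {0..t})"
  have "\<exists>Q. Q \<in> sets \<mu> \<and> ?T i \<subseteq> Q \<and> emeasure \<mu> Q \<le> ennreal (m * t) * ?pp (P i)" for i
  proof -
    obtain u \<sigma> B where Pi: "P i = (u, \<sigma>, B)" by (cases "P i") auto
    have "is_piece A (frontier \<Omega>) (u, \<sigma>, B)" using P(1)[of i] by (simp add: Pi)
    from swept_piece[OF \<mu> this X Y w t \<gamma> Nw J]
    obtain Q where "Q \<in> sets borel" "(\<lambda>(p, s). mul p (\<gamma> s)) ` (\<sigma> ` B \<times> {0..t}) \<subseteq> Q"
      "emeasure \<mu> Q \<le> ennreal (m * t) * ?pp (u, \<sigma>, B)" by metis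
    then show ?thesis by (intro exI[of _ Q]) (simp add: Pi piece_set_def sets\<mu>)
  qed
  then obtain Q where Q: "Q \<in> sets \<mu>" "(\<Union>i. ?T i) \<subseteq> Q" "emeasure \<mu> Q \<le> (\<Sum>i. ennreal (m * t) * ?pp (P i))"
    by (rule outer_measure_UN)
  let ?R = "(\<lambda>p. mul p ?h) ` \<Omega>"
  have "continuous_on {0..t} \<gamma>"
    using \<gamma> by (intro continuous_at_imp_continuous_on) (auto simp: md_def)
  then have sw: "\<exists>p\<in>frontier \<Omega>. \<exists>s. 0 \<le> s \<and> s \<le> t \<and> q = mul p (\<gamma> s)" if "q \<in> ?R - \<Omega>" for q
    by (rule swept_by_boundary[OF _ \<gamma>0 less_imp_le[OF t] that])
  have RQ: "?R \<subseteq> \<Omega> \<union> Q"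
  proof
    fix q assume q: "q \<in> ?R"
    show "q \<in> \<Omega> \<union> Q"
    proof (cases "q \<in> \<Omega>")
      case False
      then obtain p s where ps: "p \<in> frontier \<Omega>" "0 \<le> s" "s \<le> t" "q = mul p (\<gamma> s)" using sw q by blast
      then obtain i where "p \<in> piece_set (P i)" using P(3) by blast
      with ps have "q \<in> ?T i" by (intro image_eqI[of _ _ "(p, s)"]) auto
      then show ?thesis using Q(2) by blast
    qed simp
  qed
  have R: "?R \<in> sets borel"
  proof -
    have "?R = (\<lambda>q. mul q (iv ?h)) -` \<Omega>"
    proof (intro equalityI subsetI)
      fix q assume "q \<in> (\<lambda>q. mul q (iv ?h)) -` \<Omega>"
      then show "q \<in> ?R" by (intro image_eqI[of _ _ "mul q (iv ?h)"]) auto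
    qed auto
    moreover have "open ((\<lambda>q. mul q (iv ?h)) -` \<Omega>)"
      by (rule open_vimage[OF \<Omega>(1)]) (intro continuous_on_mul continuous_intros)
    ultimately show ?thesis by simp
  qed
  have \<Omega>s: "\<Omega> \<in> sets \<mu>" using \<Omega>(1) by (simp add: sets\<mu>)
  \<comment> \<open>Only upper bounds for translates are available; translating \<open>?R\<close>
    back by the inverse turns one into the lower bound Jac(h) \<mu>(\<Omega>) <= \<mu>(\<Omega>
    h).\<close>
  obtain N' where N': "N' \<in> sets borel" "(\<lambda>q. mul q (iv ?h)) ` ?R \<subseteq> N'"
    "emeasure \<mu> N' \<le> ennreal \<bar>Jac (iv ?h)\<bar> * emeasure \<mu> ?R"
    by (rule haar_rtrans_le[OF \<mu> R])
  have "\<Omega> \<subseteq> N'"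
  proof
    fix p assume p: "p \<in> \<Omega>"
    have "mul (mul p ?h) (iv ?h) \<in> N'" using N'(2) p by blast
    then show "p \<in> N'" by simp
  qed
  then have "emeasure \<mu> \<Omega> \<le> emeasure \<mu> N'" using N'(1) by (intro emeasure_mono) (simp_all add: sets\<mu>)
  also note N'(3)
  finally have le1: "emeasure \<mu> \<Omega> \<le> ennreal \<bar>Jac (iv ?h)\<bar> * emeasure \<mu> ?R" .
  have "Jac ?h * Jac (iv ?h) = 1" using Jac_mul[of ?h "iv ?h"] by (simp add: Jac_unit)
  moreover from this have "Jac (iv ?h) > 0"
    using J1 zero_less_mult_pos[of "Jac ?h" "Jac (iv ?h)"] by simp
  ultimately have JJ: "ennreal (Jac ?h) * ennreal \<bar>Jac (iv ?h)\<bar> = 1"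
    by (subst ennreal_mult''[symmetric]) simp_all
  have "ennreal (Jac ?h) * emeasure \<mu> \<Omega> \<le> ennreal (Jac ?h) * (ennreal \<bar>Jac (iv ?h)\<bar> * emeasure \<mu> ?R)"
    by (rule mult_left_mono[OF le1]) simp
  also have "\<dots> = emeasure \<mu> ?R" by (simp only: mult.assoc[symmetric] JJ mult_1_left)
  also have "\<dots> \<le> emeasure \<mu> (\<Omega> \<union> Q)"
    using RQ Q(1) \<Omega>s by (intro emeasure_mono) auto
  also have "\<dots> \<le> emeasure \<mu> \<Omega> + emeasure \<mu> Q"
    by (rule emeasure_subadditive[OF \<Omega>s Q(1)])
  also note Q(3)
  also have "(\<Sum>i. ennreal (m * t) * ?pp (P i)) = ennreal (m * t) * (\<Sum>i. ?pp (P i))" by (rule ennreal_suminf_cmult)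
  \<comment> \<open>The perimeter is a supremum over finite disjoint families, and every initial
    segment of \<open>P\<close> is one.\<close>
  also have "(\<Sum>i. ?pp (P i)) \<le> ?Per"
    unfolding suminf_eq_SUP
  proof (rule SUP_least)
    fix n
    have "disjoint_family_on (\<lambda>i. piece_set (P i)) {..<n}"
      using P(2) by (rule disjoint_family_on_mono[rotated]) simp
    then show "(\<Sum>i<n. ?pp (P i)) \<le> ?Per"
      unfolding perimeter_def using P(1) by (intro Sup_upper) blast
  qed
  finally have main: "ennreal (Jac ?h) * emeasure \<mu> \<Omega> \<le> emeasure \<mu> \<Omega> + ennreal (m * t) * ?Per"
    by (simp add: add_left_mono mult_left_mono)
  have m: "m \<ge> 0" using J(2)[of 0] t by simp
  obtain V where V: "emeasure \<mu> \<Omega> = ennreal V" "V \<ge> 0"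
    using \<Omega>(2) by (cases "emeasure \<mu> \<Omega>") auto
  show ?thesis
  \<comment> \<open>With infinite perimeter the bound is trivial. Otherwise all quantities are real,
    because \<Omega> has finite volume, and \<mu>(\<Omega>) can be subtracted from both
    sides.\<close>
  proof (cases "ennreal (m * t) * ?Per = \<infinity>")
    case True
    have "ennreal (m * t / (Jac ?h - 1)) * ?Per = \<infinity>"
      using True J1 m t by (auto simp: ennreal_mult_eq_top_iff divide_le_0_iff not_le)
    then show ?thesis by simp
  next
    case False
    then obtain r where r: "ennreal (m * t) * ?Per = ennreal r" "r \<ge> 0"
      by (cases "ennreal (m * t) * ?Per") auto
    have "ennreal (Jac ?h * V) \<le> ennreal (V + r)"
      using main J1 V(2) r(2) unfolding V(1) r(1) by (simp add: ennreal_mult'' ennreal_plus)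
    moreover have "0 \<le> V + r" using V(2) r(2) by simp
    ultimately have "Jac ?h * V \<le> V + r" by (simp only: ennreal_le_iff)
    then have "V \<le> r / (Jac ?h - 1)" using J1 by (simp add: pos_le_divide_eq algebra_simps)
    then have "ennreal V \<le> ennreal (1 / (Jac ?h - 1)) * ennreal r"
      using J1 r(2) by (subst ennreal_mult''[symmetric]) (auto intro: ennreal_leI)
    also have "\<dots> = ennreal (m * t / (Jac ?h - 1)) * ?Per"
      unfolding r(1)[symmetric] mult.assoc[symmetric]
      using J1 m t by (subst ennreal_mult''[symmetric]) auto
    finally show ?thesis by (simp only: V(1))
  qed
qed

lemma isoperimetric:
  assumes nonuni: "\<not> unimodular A mul" and \<mu>: "contact_haar A mul iv \<theta> \<mu>"
  shows "\<exists>C::real. C > 0 \<and> (\<forall>\<Omega>. open \<Omega> \<and> emeasure \<mu> \<Omega> < \<infinity> \<and> C1_surface A (frontier \<Omega>)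
       \<longrightarrow> emeasure \<mu> \<Omega> \<le> ennreal C * perimeter A mul iv \<theta> g X Y (frontier \<Omega>))"
proof -
  obtain x where X: "X = (\<lambda>p. tv p x)" using fields(1) by (auto simp: lie_algebra_eq)
  obtain y where Y: "Y = (\<lambda>p. tv p y)" using fields(2) by (auto simp: lie_algebra_eq)
  have neg: "tau (- v) = - tau v" for v by (rule linear_neg[OF linear_tau])
  have "tau x \<noteq> 0 \<or> tau y \<noteq> 0" by (rule nonunimodular_imp_tau[OF nonuni X Y])
  then have "tau x < 0 \<or> tau y < 0 \<or> tau (- x) < 0 \<or> tau (- y) < 0" unfolding neg by linarith
  then have "\<exists>w. (w = x \<or> w = y \<or> w = - x \<or> w = - y) \<and> tau w < 0" by blast
  then obtain w where w: "w = x \<or> w = y \<or> w = - x \<or> w = - y" and "tau w < 0" by blast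
  from this(2) obtain t \<gamma> where t: "t > 0" and \<gamma>: "\<gamma> 0 = unit" "\<And>s. 0 \<le> s \<Longrightarrow> s \<le> t \<Longrightarrow> md \<gamma> (\<lambda>r. r *\<^sub>R w) s"
    and Nw: "\<And>s. 0 \<le> s \<Longrightarrow> s \<le> t \<Longrightarrow> N (\<gamma> s) w = w"
    and J: "continuous_on {0..t} (\<lambda>s. Jac (\<gamma> s))" "Jac (\<gamma> t) > 1"
  proof (rule expanding_curve)
    fix t \<gamma>
    assume "t > 0" "\<gamma> 0 = unit" "\<And>s. 0 \<le> s \<Longrightarrow> s \<le> t \<Longrightarrow> md \<gamma> (\<lambda>r. r *\<^sub>R w) s"
      "\<And>s. 0 \<le> s \<Longrightarrow> s \<le> t \<Longrightarrow> N (\<gamma> s) w = w" "continuous_on {0..t} (\<lambda>s. Jac (\<gamma> s))" "Jac (\<gamma> t) > 1"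
    from that[OF this] show thesis .
  qed
  have "bounded ((\<lambda>s. Jac (\<gamma> s)) ` {0..t})"
    by (rule compact_imp_bounded[OF compact_continuous_image[OF J(1) compact_Icc]])
  then obtain m where m: "m > 0" "\<And>s. s \<in> {0..t} \<Longrightarrow> \<bar>Jac (\<gamma> s)\<bar> \<le> m"
    unfolding bounded_pos by auto
  show ?thesis
  \<comment> \<open>w, the curve, t and m come from the group and its frame alone, so the constant
    is fixed before \<Omega>.\<close>
  proof (intro exI[of _ "m * t / (Jac (\<gamma> t) - 1)"] conjI allI impI)
    show "m * t / (Jac (\<gamma> t) - 1) > 0" using m(1) t J(2) by simp
    fix \<Omega> assume \<Omega>: "open \<Omega> \<and> emeasure \<mu> \<Omega> < \<infinity> \<and> C1_surface A (frontier \<Omega>)"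
    show "emeasure \<mu> \<Omega> \<le> ennreal (m * t / (Jac (\<gamma> t) - 1)) * perimeter A mul iv \<theta> g X Y (frontier \<Omega>)"
      by (rule isoperimetric_of_curve[OF \<mu> X Y w t \<gamma> Nw J(1) _ J(2)]) (use m(2) \<Omega> in auto)
  qed
qed

end

theorem theorem3p1:
  fixes mul :: "'g::{t2_space,second_countable_topology} \<Rightarrow> 'g \<Rightarrow> 'g"
    and unit :: 'g and iv :: "'g \<Rightarrow> 'g"
    and A :: "'g chart set"
    and \<theta> :: "'g form1" and g :: "'g hmetric"
    and X Y T :: "'g vfield" and a3 b3 c :: real
    and \<mu> :: "'g measure"
  assumes G: "contact_lie_group3 mul unit iv A \<theta> g X Y T a3 b3 c"
    and conn: "connected (UNIV :: 'g set)"
    and noncompact: "\<not> compact (UNIV :: 'g set)"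
    and nonunimodular: "\<not> unimodular A mul"
    and haar: "contact_haar A mul iv \<theta> \<mu>"
  shows "\<exists>C::real. C > 0 \<and>
    (\<forall>\<Omega>. open \<Omega> \<and> connected \<Omega> \<and> \<Omega> \<in> sets \<mu> \<and> emeasure \<mu> \<Omega> < \<infinity> \<and> C1_surface A (frontier \<Omega>)
       \<longrightarrow> emeasure \<mu> \<Omega> \<le> ennreal C * perimeter A mul iv \<theta> g X Y (frontier \<Omega>))"
proof -
  interpret contact_lie_group3 mul unit iv A \<theta> g X Y T a3 b3 c by (rule G)
  show ?thesis using isoperimetric[OF nonunimodular haar] by blast
qed

end
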